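(* Let $V$ be a finite-dimensional vector space over an algebraically closed field $\Bbbk$ of characteristic $0$ and let $K\subseteq\bigwedge^2V$ be a linear subspace. Suppose $W(V,K)$ is a strongly isotropic Koszul module and write $\mathcal{R}(V,K)=\overline V_1^\vee\cup\cdots\cup\overline V_k^\vee$, where the $\overline V_t^\vee$ are the (linear) irreducible components. Then for all $q\gg0$ \[ \dim W_q(V,K)=\sum_{t=1}^k(q+1)\binom{q+\dim\overline V_t}{q+2}. \]
   Context: $S=\mathrm{Sym}(V)$; $K^\perp\subseteq\bigwedge^2V^\vee$ is the space of functionals vanishing on $K$. The Koszul module $W(V,K)$ is the graded $S$-module given by the middle homology of $K\otimes S\xrightarrow{\delta_2|_{K\otimes S}}V\otimes S(1)\xrightarrow{\delta_1}S(2)$, where $\delta_2(v_1\wedge v_2\otimes f)=v_2\otimes v_1f-v_1\otimes v_2f$ and $\delta_1(v\otimes f)=vf$; its degree $q$ piece $W_q(V,K)$ is the homology of $K\otimes\mathrm{Sym}^qV\to V\otimes\mathrm{Sym}^{q+1}V\to\mathrm{Sym}^{q+2}V$. The resonance variety is $\mathcal{R}(V,K)=\{a\in V^\vee:\exists\, b\in V^\vee,\ a\wedge b\in K^\perp\setminus\{0\}\}\cup\{0\}$. Let $E=\bigwedge V^\vee$ and let $\langle U\rangle_E$ denote the ideal of $E$ generated by $U$. A linear subspace $\overline V^\vee\subseteq V^\vee$ is strongly isotropic (with respect to $K$) if $K^\perp\cap\langle\overline V^\vee\rangle_E=\bigwedge^2\overline V^\vee$. The Koszul module $W(V,K)$ is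 strongly isotropic if all irreducible components of $\mathcal{R}(V,K)$ are linear subspaces of $V^\vee$ and each of them is strongly isotropic. *)

theory Defs
  imports
    "HOL-Library.Poly_Mapping"
    "HOL-Library.Function_Algebras"
    "HOL-Computational_Algebra.Polynomial"
begin

text \<open>
  Tensor, exterior and symmetric algebras are built by generators and relations: each of them is
  a quotient \<open>F / R\<close> of a free vector space \<open>F = 'x \<Rightarrow>\<^sub>0 'k\<close> by a subspace \<open>R\<close> of relations.
  Throughout, a subspace of \<open>F / R\<close> is represented by its full preimage in \<open>F\<close>,
  i.e. by a subspace of \<open>F\<close> containing \<open>R\<close>, and an element of \<open>F / R\<close> by any representative.
\<close>


section \<open>Free vector spaces and quotients\<close>

definition fscale :: "'k::field \<Rightarrow> ('x \<Rightarrow>\<^sub>0 'k) \<Rightarrow> ('x \<Rightarrow>\<^sub>0 'k)"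
  where "fscale c = Poly_Mapping.map ((*) c)"

lemma lookup_fscale [simp]: "Poly_Mapping.lookup (fscale c f) x = c * Poly_Mapping.lookup f x"
  by (simp add: fscale_def Poly_Mapping.map.rep_eq when_def)

global_interpretation fvs: vector_space "fscale :: 'k::field \<Rightarrow> ('x \<Rightarrow>\<^sub>0 'k) \<Rightarrow> ('x \<Rightarrow>\<^sub>0 'k)"
  by unfold_locales
    (auto intro!: poly_mapping_eqI simp: lookup_add algebra_simps)

definition gen :: "'x \<Rightarrow> ('x \<Rightarrow>\<^sub>0 'k::field)"
  where "gen x = Poly_Mapping.single x 1"

definition free_on :: "'x set \<Rightarrow> ('x \<Rightarrow>\<^sub>0 'k::field) set"
  where "free_on X = {f. Poly_Mapping.keys f \<subseteq> X}"

definition lin_ext :: "('x \<Rightarrow> 'y \<Rightarrow>\<^sub>0 'k) \<Rightarrow> ('x \<Rightarrow>\<^sub>0 'k::field) \<Rightarrow> ('y \<Rightarrow>\<^sub>0 'k)"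
  where "lin_ext h f = (\<Sum>x\<in>Poly_Mapping.keys f. fscale (Poly_Mapping.lookup f x) (h x))"

text \<open>The classes of the elements of \<open>C\<close> form a basis of \<open>A / B\<close>, for subspaces \<open>B \<subseteq> A\<close>.\<close>

definition quotient_basis :: "('x \<Rightarrow>\<^sub>0 'k::field) set \<Rightarrow> ('x \<Rightarrow>\<^sub>0 'k) set \<Rightarrow> ('x \<Rightarrow>\<^sub>0 'k) set \<Rightarrow> bool"
  where "quotient_basis A B C \<longleftrightarrow>
    C \<subseteq> A \<and> A \<subseteq> fvs.span (B \<union> C) \<and> (\<forall>x\<in>C. x \<notin> fvs.span (B \<union> (C - {x})))"

definition quotient_dim :: "('x \<Rightarrow>\<^sub>0 'k::field) set \<Rightarrow> ('x \<Rightarrow>\<^sub>0 'k) set \<Rightarrow> nat"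
  where "quotient_dim A B = card (SOME C. quotient_basis A B C)"


section \<open>Exterior and symmetric algebras\<close>

text \<open>
  \<open>'a list \<Rightarrow>\<^sub>0 'k\<close> is the free associative algebra on the type \<open>'a\<close>, the word \<open>[u\<^sub>1, \<dots>, u\<^sub>p]\<close> standing
  for the product \<open>u\<^sub>1 \<cdots> u\<^sub>p\<close>.  For a vector space with carrier \<open>U\<close> and scalar multiplication \<open>sc\<close>,
  the quotient of the free algebra on \<open>U\<close> by the linear relations is the tensor algebra of \<open>U\<close>.
\<close>

definition words :: "'a set \<Rightarrow> nat \<Rightarrow> 'a list set"
  where "words U p = {w. set w \<subseteq> U \<and> length w = p}"

definition free_mult :: "('a list \<Rightarrow>\<^sub>0 'k::field) \<Rightarrow> ('a list \<Rightarrow>\<^sub>0 'k) \<Rightarrow> ('a list \<Rightarrow>\<^sub>0 'k)"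
  where "free_mult f g = lin_ext (\<lambda>xs. lin_ext (\<lambda>ys. gen (xs @ ys)) g) f"

definition free_ideal :: "'a set \<Rightarrow> ('a list \<Rightarrow>\<^sub>0 'k::field) set \<Rightarrow> ('a list \<Rightarrow>\<^sub>0 'k) set"
  where "free_ideal U R =
    fvs.span {free_mult (free_mult (gen xs) r) (gen ys) | xs r ys.
      set xs \<subseteq> U \<and> r \<in> R \<and> set ys \<subseteq> U}"

definition linear_rels ::
  "('k::field \<Rightarrow> 'a::ab_group_add \<Rightarrow> 'a) \<Rightarrow> 'a set \<Rightarrow> ('a list \<Rightarrow>\<^sub>0 'k) set"
  where "linear_rels sc U =
    {gen [u + v] - gen [u] - gen [v] | u v. u \<in> U \<and> v \<in> U} \<union>
    {gen [sc c u] - fscale c (gen [u]) | c u. u \<in> U}"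

definition exterior_rels ::
  "('k::field \<Rightarrow> 'a::ab_group_add \<Rightarrow> 'a) \<Rightarrow> 'a set \<Rightarrow> ('a list \<Rightarrow>\<^sub>0 'k) set"
  where "exterior_rels sc U = linear_rels sc U \<union> {gen [u, u] | u. u \<in> U}"

definition symmetric_rels ::
  "('k::field \<Rightarrow> 'a::ab_group_add \<Rightarrow> 'a) \<Rightarrow> 'a set \<Rightarrow> ('a list \<Rightarrow>\<^sub>0 'k) set"
  where "symmetric_rels sc U =
    linear_rels sc U \<union> {gen [u, v] - gen [v, u] | u v. u \<in> U \<and> v \<in> U}"

text \<open>
  All relations are homogeneous, so the degree \<open>p\<close> piece of the exterior (symmetric) algebra is
  \<open>free_on (words U p)\<close> modulo the elements of the exterior (symmetric) ideal lying in it.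
\<close>

definition exterior_ideal ::
  "('k::field \<Rightarrow> 'a::ab_group_add \<Rightarrow> 'a) \<Rightarrow> 'a set \<Rightarrow> ('a list \<Rightarrow>\<^sub>0 'k) set"
  where "exterior_ideal sc U = free_ideal U (exterior_rels sc U)"

definition symmetric_ideal ::
  "('k::field \<Rightarrow> 'a::ab_group_add \<Rightarrow> 'a) \<Rightarrow> 'a set \<Rightarrow> ('a list \<Rightarrow>\<^sub>0 'k) set"
  where "symmetric_ideal sc U = free_ideal U (symmetric_rels sc U)"

definition subspace_of_exterior_square ::
  "('k::field \<Rightarrow> 'v::ab_group_add \<Rightarrow> 'v) \<Rightarrow> ('v list \<Rightarrow>\<^sub>0 'k) set \<Rightarrow> bool"
  where "subspace_of_exterior_square sc K \<longleftrightarrow>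
    fvs.subspace K \<and> K \<subseteq> free_on (words UNIV 2) \<and>
    exterior_ideal sc UNIV \<inter> free_on (words UNIV 2) \<subseteq> K"


section \<open>Koszul modules\<close>

text \<open>
  \<open>V \<otimes> Sym\<^sup>p V\<close> is presented by the generators \<open>(v, w)\<close> with \<open>v\<close> a vector and \<open>w\<close> a word of length
  \<open>p\<close>, and \<open>\<And>\<^sup>2V \<otimes> Sym\<^sup>p V\<close> by the generators \<open>(z, w)\<close> with \<open>z\<close> a word of length 2.
\<close>

definition tensor :: "('x \<Rightarrow>\<^sub>0 'k::field) \<Rightarrow> ('y \<Rightarrow>\<^sub>0 'k) \<Rightarrow> ('x \<times> 'y \<Rightarrow>\<^sub>0 'k)"
  where "tensor f g = lin_ext (\<lambda>x. lin_ext (\<lambda>y. gen (x, y)) g) f"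

definition V_tensor_Sym_rels ::
  "('k::field \<Rightarrow> 'v::ab_group_add \<Rightarrow> 'v) \<Rightarrow> nat \<Rightarrow> ('v \<times> 'v list \<Rightarrow>\<^sub>0 'k) set"
  where "V_tensor_Sym_rels sc p = fvs.span (
    {gen (u + v, w) - gen (u, w) - gen (v, w) | u v w. w \<in> words UNIV p} \<union>
    {gen (sc c v, w) - fscale c (gen (v, w)) | c v w. w \<in> words UNIV p} \<union>
    {tensor (gen v) r | v r. r \<in> symmetric_ideal sc UNIV \<inter> free_on (words UNIV p)})"

definition koszul_delta1 :: "('v \<times> 'v list \<Rightarrow>\<^sub>0 'k::field) \<Rightarrow> ('v list \<Rightarrow>\<^sub>0 'k)"
  where "koszul_delta1 = lin_ext (\<lambda>(v, w). gen (v # w))"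

definition koszul_delta2 :: "('v list \<times> 'v list \<Rightarrow>\<^sub>0 'k::field) \<Rightarrow> ('v \<times> 'v list \<Rightarrow>\<^sub>0 'k)"
  where "koszul_delta2 =
    lin_ext (\<lambda>(z, w). gen (z ! 1, z ! 0 # w) - gen (z ! 0, z ! 1 # w))"

text \<open>
  The next two are the preimages, in the free vector space presenting \<open>V \<otimes> Sym\<^sup>q\<^sup>+\<^sup>1 V\<close>, of the
  kernel of \<open>\<delta>\<^sub>1\<close> and of the image of \<open>K \<otimes> Sym\<^sup>q V\<close> under \<open>\<delta>\<^sub>2\<close>.
\<close>

definition koszul_cycles ::
  "('k::field \<Rightarrow> 'v::ab_group_add \<Rightarrow> 'v) \<Rightarrow> nat \<Rightarrow> ('v \<times> 'v list \<Rightarrow>\<^sub>0 'k) set"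
  where "koszul_cycles sc q =
    {x \<in> free_on (UNIV \<times> words UNIV (q + 1)). koszul_delta1 x \<in> symmetric_ideal sc UNIV}"

definition koszul_boundaries ::
  "('k::field \<Rightarrow> 'v::ab_group_add \<Rightarrow> 'v) \<Rightarrow> ('v list \<Rightarrow>\<^sub>0 'k) set \<Rightarrow> nat \<Rightarrow>
    ('v \<times> 'v list \<Rightarrow>\<^sub>0 'k) set"
  where "koszul_boundaries sc K q = fvs.span (
    koszul_delta2 ` {tensor \<kappa> f | \<kappa> f. \<kappa> \<in> K \<and> f \<in> free_on (words UNIV q)} \<union>
    V_tensor_Sym_rels sc (q + 1))"

definition koszul_module_dim ::
  "('k::field \<Rightarrow> 'v::ab_group_add \<Rightarrow> 'v) \<Rightarrow> ('v list \<Rightarrow>\<^sub>0 'k) set \<Rightarrow> nat \<Rightarrow> nat"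
  where "koszul_module_dim sc K q = quotient_dim (koszul_cycles sc q) (koszul_boundaries sc K q)"


section \<open>Dual space, annihilator, resonance\<close>

definition dual_scale :: "'k::field \<Rightarrow> ('v \<Rightarrow> 'k) \<Rightarrow> ('v \<Rightarrow> 'k)"
  where "dual_scale c a = (\<lambda>v. c * a v)"

global_interpretation functionals: vector_space "dual_scale :: 'k::field \<Rightarrow> ('v \<Rightarrow> 'k) \<Rightarrow> ('v \<Rightarrow> 'k)"
  by unfold_locales (auto simp: dual_scale_def fun_eq_iff algebra_simps)

definition dual_space :: "('k::field \<Rightarrow> 'v::ab_group_add \<Rightarrow> 'v) \<Rightarrow> ('v \<Rightarrow> 'k) set"
  where "dual_space sc = {a. Vector_Spaces.linear sc (*) a}"

text \<open>
  The pairing \<open>\<langle>a \<and> b, v \<and> w\<rangle> = a(v) b(w) - a(w) b(v)\<close>, which identifies the exterior square of the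
  dual of \<open>V\<close> with the dual of the exterior square of \<open>V\<close>.
\<close>

definition exterior_pairing :: "(('v \<Rightarrow> 'k) list \<Rightarrow>\<^sub>0 'k::field) \<Rightarrow> ('v list \<Rightarrow>\<^sub>0 'k) \<Rightarrow> 'k"
  where "exterior_pairing \<phi> \<kappa> =
    (\<Sum>l\<in>Poly_Mapping.keys \<phi>. \<Sum>z\<in>Poly_Mapping.keys \<kappa>.
      Poly_Mapping.lookup \<phi> l * Poly_Mapping.lookup \<kappa> z *
      ((l ! 0) (z ! 0) * (l ! 1) (z ! 1) - (l ! 0) (z ! 1) * (l ! 1) (z ! 0)))"

definition annihilator ::
  "('k::field \<Rightarrow> 'v::ab_group_add \<Rightarrow> 'v) \<Rightarrow> ('v list \<Rightarrow>\<^sub>0 'k) set \<Rightarrow>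
    (('v \<Rightarrow> 'k) list \<Rightarrow>\<^sub>0 'k) set"
  where "annihilator sc K =
    {\<phi> \<in> free_on (words (dual_space sc) 2). \<forall>\<kappa>\<in>K. exterior_pairing \<phi> \<kappa> = 0}"

definition resonance_variety ::
  "('k::field \<Rightarrow> 'v::ab_group_add \<Rightarrow> 'v) \<Rightarrow> ('v list \<Rightarrow>\<^sub>0 'k) set \<Rightarrow> ('v \<Rightarrow> 'k) set"
  where "resonance_variety sc K =
    {a \<in> dual_space sc. \<exists>b\<in>dual_space sc.
       gen [a, b] \<in> annihilator sc K \<and>
       gen [a, b] \<notin> exterior_ideal dual_scale (dual_space sc)} \<union> {0}"


section \<open>Zariski topology on the dual space\<close>

definition eval_at :: "('v \<Rightarrow> 'k) \<Rightarrow> ('v list \<Rightarrow>\<^sub>0 'k::field) \<Rightarrow> 'k"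
  where "eval_at a f =
    (\<Sum>w\<in>Poly_Mapping.keys f. Poly_Mapping.lookup f w * prod_list (map a w))"

text \<open>The closed sets are the common zero sets of elements of \<open>Sym(V)\<close>.\<close>

definition zariski_closed ::
  "('k::field \<Rightarrow> 'v::ab_group_add \<Rightarrow> 'v) \<Rightarrow> ('v \<Rightarrow> 'k) set \<Rightarrow> bool"
  where "zariski_closed sc Z \<longleftrightarrow>
    (\<exists>F :: ('v list \<Rightarrow>\<^sub>0 'k) set. Z = {a \<in> dual_space sc. \<forall>f\<in>F. eval_at a f = 0})"

definition zariski_irreducible ::
  "('k::field \<Rightarrow> 'v::ab_group_add \<Rightarrow> 'v) \<Rightarrow> ('v \<Rightarrow> 'k) set \<Rightarrow> bool"
  where "zariski_irreducible sc Y \<longleftrightarrow>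
    Y \<noteq> {} \<and> Y \<subseteq> dual_space sc \<and>
    (\<forall>Z1 Z2. zariski_closed sc Z1 \<and> zariski_closed sc Z2 \<and> Y \<subseteq> Z1 \<union> Z2 \<longrightarrow> Y \<subseteq> Z1 \<or> Y \<subseteq> Z2)"

definition irreducible_components ::
  "('k::field \<Rightarrow> 'v::ab_group_add \<Rightarrow> 'v) \<Rightarrow> ('v \<Rightarrow> 'k) set \<Rightarrow> ('v \<Rightarrow> 'k) set set"
  where "irreducible_components sc X =
    {Y. Y \<subseteq> X \<and> zariski_irreducible sc Y \<and>
      (\<forall>Y'. Y \<subseteq> Y' \<and> Y' \<subseteq> X \<and> zariski_irreducible sc Y' \<longrightarrow> Y' = Y)}"


section \<open>Strong isotropy\<close>

text \<open>The preimage in the free algebra of the ideal of the exterior algebra of the dual space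
  generated by a set \<open>U\<close> of functionals.\<close>

definition exterior_ideal_generated ::
  "('k::field \<Rightarrow> 'v::ab_group_add \<Rightarrow> 'v) \<Rightarrow> ('v \<Rightarrow> 'k) set \<Rightarrow> (('v \<Rightarrow> 'k) list \<Rightarrow>\<^sub>0 'k) set"
  where "exterior_ideal_generated sc U =
    free_ideal (dual_space sc)
      (exterior_rels dual_scale (dual_space sc) \<union> {gen [u] | u. u \<in> U})"

text \<open>The image of the exterior square of \<open>U\<close> in the exterior square of the dual space.\<close>

definition exterior_square_of ::
  "('k::field \<Rightarrow> 'v::ab_group_add \<Rightarrow> 'v) \<Rightarrow> ('v \<Rightarrow> 'k) set \<Rightarrow> (('v \<Rightarrow> 'k) list \<Rightarrow>\<^sub>0 'k) set"
  where "exterior_square_of sc U = fvs.span (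
    {gen [u, w] | u w. u \<in> U \<and> w \<in> U} \<union>
    (exterior_ideal dual_scale (dual_space sc) \<inter> free_on (words (dual_space sc) 2)))"

definition strongly_isotropic_subspace ::
  "('k::field \<Rightarrow> 'v::ab_group_add \<Rightarrow> 'v) \<Rightarrow> ('v list \<Rightarrow>\<^sub>0 'k) set \<Rightarrow> ('v \<Rightarrow> 'k) set \<Rightarrow> bool"
  where "strongly_isotropic_subspace sc K U \<longleftrightarrow>
    functionals.subspace U \<and> U \<subseteq> dual_space sc \<and>
    annihilator sc K \<inter> exterior_ideal_generated sc U = exterior_square_of sc U"

definition strongly_isotropic_koszul ::
  "('k::field \<Rightarrow> 'v::ab_group_add \<Rightarrow> 'v) \<Rightarrow> ('v list \<Rightarrow>\<^sub>0 'k) set \<Rightarrow> bool"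
  where "strongly_isotropic_koszul sc K \<longleftrightarrow>
    (\<forall>U \<in> irreducible_components sc (resonance_variety sc K).
       functionals.subspace U \<and> strongly_isotropic_subspace sc K U)"

end

theory Submission
  imports Defs
begin

text \<open>
  The dual of \<open>W\<^sub>q(V, K)\<close> is the space \<open>D\<^sub>q\<close> of closed 2-forms on \<open>V\<close> with polynomial coefficients of degree
  \<open>q\<close> and with all values in \<open>K\<^sup>\<bottom>\<close>; closed forms are exact because the characteristic is 0.  The forms
  pulled back along \<open>V \<rightarrow> V\<^sub>t\<close>, where \<open>V\<^sub>t\<close> has the component \<open>U\<^sub>t\<close> as its dual, lie in \<open>D\<^sub>q\<close> since
  \<open>U\<^sub>t\<close> is isotropic, and they span a space of dimension \<open>(q+1) (q + dim U\<^sub>t choose q+2)\<close>.  Since distinct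
  components meet only in 0, the sum \<open>C\<^sub>q\<close> of these spaces is direct for large \<open>q\<close>, and it remains to see
  that \<open>C\<^sub>q = D\<^sub>q\<close> for large \<open>q\<close>.  The vectors of \<open>V\<close> act by contraction \<open>D\<^sub>q\<^sub>+\<^sub>1 \<rightarrow> D\<^sub>q\<close>.  If \<open>D\<^sub>q / C\<^sub>q\<close> were
  nonzero for infinitely many \<open>q\<close>, a dual form of the projective Nullstellensatz would give a functional
  \<open>a \<noteq> 0\<close> and \<open>f\<^sub>q \<in> D\<^sub>q - C\<^sub>q\<close> such that the contraction of \<open>f\<^sub>q\<^sub>+\<^sub>1\<close> with \<open>v\<close> is \<open>a(v) f\<^sub>q\<close> modulo \<open>C\<^sub>q\<close>.  The
  error terms in the components \<open>U\<^sub>t\<close> not containing \<open>a\<close> are coboundaries and can be removed.  If \<open>a\<close> is in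
  no component, closedness then forces \<open>f\<^sub>q = a \<and> b\<close>, so that \<open>a\<close> is resonant, which is absurd; if \<open>a\<close> is
  in \<open>U\<^sub>t\<close>, closedness forces the values of \<open>f\<^sub>q\<close> into the ideal generated by \<open>U\<^sub>t\<close>, and strong isotropy
  makes \<open>f\<^sub>q\<close> a pullback.
\<close>

section \<open>Linear algebra\<close>

text \<open>The transpose of \<open>koszul_delta2\<close> is, up to sign, the exterior derivative of
  1-forms, and the functionals that factor through \<open>koszul_delta1\<close> are exactly the
  closed 1-forms. Restricting functionals to the cycles thus amounts to differentiating 1-forms, and
  killing the boundaries means that the derivative has values in the annihilator of
  \<open>K\<close>. That two components meet only in 0 comes from strong isotropy: for
  \<open>a \<noteq> 0\<close> in both and \<open>b\<close> in one of them, \<open>a \<and> b\<close>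
  lies in the annihilator of \<open>K\<close> and in the ideal of the other, hence in its exterior
  square, so \<open>b\<close> lies in it too. The obstacle is that the eigenvector argument takes
  place in \<open>D\<^sub>q / C\<^sub>q\<close>, where it requires that for large \<open>q\<close> a
  class with vanishing contractions is 0. For \<open>D\<^sub>q\<close> alone this is trivial; modulo
  \<open>C\<^sub>q\<close> the components of the contractions have to be integrated to forms on each
  component. This works because they are unique once \<open>q\<close> is at least the number of
  components: contracting with a vector that kills one component removes it at the price of one
  degree.\<close>

definition fin_dim :: "('k::field \<Rightarrow> 'b::ab_group_add \<Rightarrow> 'b) \<Rightarrow> 'b set \<Rightarrow> bool"
  where "fin_dim sc A \<longleftrightarrow> (\<exists>S. finite S \<and> A \<subseteq> module.span sc S)"

context vector_space
begin

lemma fin_dim_subset: "fin_dim scale B \<Longrightarrow> A \<subseteq> B \<Longrightarrow> fin_dim scale A"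
  unfolding fin_dim_def by blast

lemma fin_dim_basis:
  assumes "fin_dim scale A"
  obtains B where "B \<subseteq> A" "finite B" "\<not> dependent B" "A \<subseteq> span B" "card B = local.dim A"
proof -
  obtain B where B: "B \<subseteq> A" "\<not> dependent B" "A \<subseteq> span B" "card B = local.dim A"
    using basis_exists by blast
  obtain S where "finite S" "A \<subseteq> span S" using assms unfolding fin_dim_def by blast
  hence "finite B" using B(1,2) independent_span_bound by blast
  with B that show thesis by blast
qed

lemma dim_subset_fin_dim:
  assumes "fin_dim scale B" "A \<subseteq> B"
  shows "local.dim A \<le> local.dim B"
proof -
  obtain S where S: "finite S" "B \<subseteq> span S" "card S = local.dim B"
    using fin_dim_basis[OF assms(1)] by metis
  thus ?thesis using assms(2) dim_le_card[of A S] by auto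
qed

lemma dim_psubset_fin_dim:
  assumes "fin_dim scale B" "subspace A" "A \<subseteq> B" "x \<in> B" "x \<notin> A"
  shows "local.dim A < local.dim B"
proof -
  obtain C where C: "C \<subseteq> A" "finite C" "\<not> dependent C" "A \<subseteq> span C" "card C = local.dim A"
    using fin_dim_basis[OF fin_dim_subset[OF assms(1,3)]] .
  have "span C \<subseteq> A" using C(1) assms(2) by (simp add: span_minimal)
  hence x: "x \<notin> span C" using assms(5) by blast
  hence ind: "\<not> dependent (insert x C)" using C(3) independent_insertI by blast
  obtain S where S: "finite S" "B \<subseteq> span S" "card S = local.dim B"
    using fin_dim_basis[OF assms(1)] by metis
  have "card (insert x C) \<le> card S"
    using independent_span_bound[OF S(1) ind] C(1) assms(3,4) S(2) by blast
  moreover have "x \<notin> C" using x span_base by blast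
  ultimately show ?thesis using C(2,5) S(3) by simp
qed

lemma subspace_eq_if_dim_eq:
  assumes "fin_dim scale B" "subspace A" "A \<subseteq> B" "local.dim A = local.dim B"
  shows "A = B"
proof (rule ccontr)
  assume "A \<noteq> B"
  then obtain x where "x \<in> B" "x \<notin> A" using assms(3) by blast
  thus False using dim_psubset_fin_dim[OF assms(1,2,3)] assms(4) by simp
qed

text \<open>The image of \<open>p\<close> serves as a model of the quotient by \<open>C\<close>
  inside the same space. A basis of \<open>C\<close> is extended to the whole space, and
  \<open>p\<close> kills the basis of \<open>C\<close> and fixes the other members.\<close>

lemma projection_along_subspace:
  assumes "subspace C"
  shows "\<exists>p. Vector_Spaces.linear scale scale p \<and> (\<forall>x\<in>C. p x = 0) \<and> (\<forall>x. x - p x \<in> C)"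
proof -
  interpret vp: vector_space_pair scale scale ..
  obtain B where B: "B \<subseteq> C" "\<not> dependent B" "C \<subseteq> span B" using maximal_independent_subset by blast
  define B' where "B' = extend_basis B"
  have B': "B \<subseteq> B'" "\<not> dependent B'" "span B' = UNIV"
    using extend_basis_superset[OF B(2)] independent_extend_basis[OF B(2)] span_extend_basis[OF B(2)]
    by (auto simp: B'_def)
  define p where "p = vp.construct B' (\<lambda>b. if b \<in> B then 0 else b)"
  have lin: "Vector_Spaces.linear scale scale p"
    unfolding p_def by (rule vp.linear_construct[OF B'(2)])
  interpret p: Vector_Spaces.linear scale scale p by (rule lin)
  have pb: "p b = (if b \<in> B then 0 else b)" if "b \<in> B'" for b
    unfolding p_def using vp.construct_basis[OF B'(2) that] by simp
  have "p x = 0" if "x \<in> C" for x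
  proof (rule p.eq_0_on_span)
    show "x \<in> span B" using that B(3) by blast
    show "p b = 0" if "b \<in> B" for b using that pb[of b] B'(1) by auto
  qed
  moreover have "x - p x \<in> C" for x
  proof -
    have "x \<in> span B'" using B'(3) by simp
    thus ?thesis
    proof (induction rule: span_induct_alt)
      case base
      show ?case using assms by (simp add: p.zero subspace_0)
    next
      case (step c b y)
      have "b - p b \<in> C" using pb[OF step(1)] B(1) assms by (auto simp: subspace_0)
      hence "c *s (b - p b) + (y - p y) \<in> C"
        using step(2) assms by (simp add: subspace_add subspace_scale)
      also have "c *s (b - p b) + (y - p y) = (c *s b + y) - p (c *s b + y)"
        by (simp add: p.add p.scale scale_right_diff_distrib)
      finally show ?case .
    qed
  qed
  ultimately show ?thesis using lin by blast
qed

text \<open>The last hypothesis is linear independence of the restrictions of the \<open>F i\<close>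
  to \<open>A\<close>. The induction is Gram-Schmidt for the pairing: a vector for the new
  functional is found in the common kernel of the old ones, and then used to correct the old
  vectors.\<close>

lemma dual_vectors:
  assumes "finite I" "subspace A"
    and "\<And>i. i \<in> I \<Longrightarrow> Vector_Spaces.linear scale (*) (F i)"
    and "\<And>c. (\<And>x. x \<in> A \<Longrightarrow> (\<Sum>i\<in>I. c i * F i x) = 0) \<Longrightarrow> \<forall>i\<in>I. c i = 0"
  shows "\<exists>e. \<forall>j\<in>I. e j \<in> A \<and> (\<forall>i\<in>I. F i (e j) = (if i = j then 1 else 0))"
  using assms(1,3,4)
proof (induction I rule: finite_induct)
  case empty
  show ?case by simp
next
  case (insert j I)
  have lin: "Vector_Spaces.linear scale (*) (F i)" if "i \<in> insert j I" for i
    using insert.prems(1) that by blast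
  have "\<forall>i\<in>I. c i = 0" if c: "\<And>x. x \<in> A \<Longrightarrow> (\<Sum>i\<in>I. c i * F i x) = 0" for c
  proof -
    have "\<forall>i\<in>insert j I. (c(j := 0)) i = 0"
    proof (rule insert.prems(2))
      fix x assume "x \<in> A"
      have "(\<Sum>i\<in>I. (c(j := 0)) i * F i x) = (\<Sum>i\<in>I. c i * F i x)"
        using insert.hyps by (intro sum.cong) auto
      thus "(\<Sum>i\<in>insert j I. (c(j := 0)) i * F i x) = 0"
        using insert.hyps c[OF \<open>x \<in> A\<close>] by simp
    qed
    thus ?thesis using insert.hyps(2) by (auto split: if_splits)
  qed
  hence "\<exists>e. \<forall>j\<in>I. e j \<in> A \<and> (\<forall>i\<in>I. F i (e j) = (if i = j then 1 else 0))"
    using lin by (intro insert.IH) auto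
  then obtain e where e: "\<And>i. i \<in> I \<Longrightarrow> e i \<in> A"
      "\<And>i k. i \<in> I \<Longrightarrow> k \<in> I \<Longrightarrow> F i (e k) = (if i = k then 1 else 0)"
    by blast
  \<comment> \<open>\<open>r\<close> maps \<open>A\<close> into the common kernel of the old
    functionals.\<close>
  define r where "r x = x - (\<Sum>i\<in>I. F i x *s e i)" for x
  have rA: "r x \<in> A" if "x \<in> A" for x
    unfolding r_def using that e(1) assms(2) by (intro subspace_diff subspace_sum subspace_scale) auto
  have Fr: "F i (r x) = F i x - (\<Sum>k\<in>I. F k x * F i (e k))" if "i \<in> insert j I" for i x
  proof -
    interpret Fi: Vector_Spaces.linear scale "(*)" "F i" by (rule lin[OF that])
    show ?thesis by (simp add: r_def Fi.diff Fi.sum Fi.scale)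
  qed
  have FrI: "F i (r x) = 0" if "i \<in> I" for i x
  proof -
    have "(\<Sum>k\<in>I. F k x * F i (e k)) = (\<Sum>k\<in>I. if k = i then F k x else 0)"
      using that e(2) by (intro sum.cong) auto
    thus ?thesis using that insert.hyps Fr[of i x] by simp
  qed
  have "\<exists>x\<in>A. F j (r x) \<noteq> 0"
  proof (rule ccontr)
    assume neg: "\<not> ?thesis"
    \<comment> \<open>If \<open>F j\<close> vanished on all \<open>r x\<close>, then on
      \<open>A\<close> it would be the combination of the \<open>F i\<close> with coefficients
      \<open>F j (e i)\<close>, a relation with coefficient 1 at \<open>j\<close>.\<close>
    define c where "c = (\<lambda>i. if i = j then 1 else - F j (e i))"
    have "\<forall>i\<in>insert j I. c i = 0"
    proof (rule insert.prems(2))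
      fix x assume "x \<in> A"
      hence "F j (r x) = 0" using neg by blast
      hence "F j x = (\<Sum>k\<in>I. F k x * F j (e k))" using Fr[of j x] by simp
      moreover have "(\<Sum>i\<in>I. c i * F i x) = - (\<Sum>k\<in>I. F k x * F j (e k))"
        unfolding sum_negf[symmetric] c_def using insert.hyps by (intro sum.cong) auto
      ultimately show "(\<Sum>i\<in>insert j I. c i * F i x) = 0"
        using insert.hyps by (simp add: c_def)
    qed
    thus False by (simp add: c_def)
  qed
  then obtain x where x: "x \<in> A" "F j (r x) \<noteq> 0" by blast
  define f where "f = inverse (F j (r x)) *s r x"
  have fA: "f \<in> A" unfolding f_def using x rA assms(2) by (intro subspace_scale)
  have Ff: "F i f = (if i = j then 1 else 0)" if "i \<in> insert j I" for i
  proof -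
    interpret Fi: Vector_Spaces.linear scale "(*)" "F i" by (rule lin[OF that])
    show ?thesis using x(2) FrI that insert.hyps by (auto simp: f_def Fi.scale)
  qed
  define e' where "e' = (\<lambda>k. if k = j then f else e k - F j (e k) *s f)"
  have "e' k \<in> A \<and> (\<forall>i\<in>insert j I. F i (e' k) = (if i = k then 1 else 0))" if k: "k \<in> insert j I" for k
  proof (cases "k = j")
    case True
    thus ?thesis using fA Ff by (simp add: e'_def)
  next
    case False
    hence kI: "k \<in> I" using k by blast
    have "F i (e' k) = (if i = k then 1 else 0)" if i: "i \<in> insert j I" for i
    proof -
      interpret Fi: Vector_Spaces.linear scale "(*)" "F i" by (rule lin[OF i])
      show ?thesis using i kI False insert.hyps Ff[OF i] e(2)
        by (auto simp: e'_def Fi.diff Fi.scale)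
    qed
    moreover have "e' k \<in> A" unfolding e'_def using False kI e(1) fA assms(2)
      by (auto intro: subspace_diff subspace_scale)
    ultimately show ?thesis by blast
  qed
  thus ?case by blast
qed

end

text \<open>Rank-nullity for a finite-dimensional subspace of a possibly infinite-dimensional space.
  A basis \<open>C\<close> of the kernel is extended to a basis \<open>B\<close> of
  \<open>A\<close>; the remaining vectors \<open>B - C\<close> span a complement, on which
  \<open>f\<close> is injective, and map to a basis of the image.\<close>

lemma (in vector_space_pair) dim_kernel_image:
  assumes "vs1.subspace A" "fin_dim s1 A" "Vector_Spaces.linear s1 s2 f"
  shows "vs1.dim A = vs1.dim {x\<in>A. f x = 0} + vs2.dim (f ` A)" and "fin_dim s2 (f ` A)"
proof -
  interpret f: Vector_Spaces.linear s1 s2 f by fact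
  let ?N = "{x\<in>A. f x = 0}"
  have subN: "vs1.subspace ?N"
    using assms(1) by (auto simp: vs1.subspace_def f.zero f.add f.scale)
  obtain C where C: "C \<subseteq> ?N" "finite C" "\<not> vs1.dependent C" "?N \<subseteq> vs1.span C" "card C = vs1.dim ?N"
    using vs1.fin_dim_basis[OF vs1.fin_dim_subset[OF assms(2), of ?N]] by blast
  obtain B where B: "C \<subseteq> B" "B \<subseteq> A" "\<not> vs1.dependent B" "A \<subseteq> vs1.span B"
    using vs1.maximal_independent_subset_extend[of C A] C(1,3) by blast
  obtain S where "finite S" "A \<subseteq> vs1.span S" using assms(2) unfolding fin_dim_def by blast
  hence finB: "finite B" using B(2,3) vs1.independent_span_bound by blast
  have inj: "inj_on f (vs1.span (B - C))"
    unfolding f.inj_on_iff_eq_0[OF vs1.subspace_span]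
  proof (intro ballI impI)
    fix x assume x: "x \<in> vs1.span (B - C)" "f x = 0"
    have "x \<in> A" using x(1) B(2) assms(1) vs1.span_minimal[of "B - C" A] by blast
    hence "x \<in> vs1.span C" using x(2) C(4) by blast
    moreover have "vs1.span (B - C) \<inter> vs1.span C = {0}"
    proof -
      have "y = 0" if y: "y \<in> vs1.span (B - C)" "y \<in> vs1.span C" for y
      proof (rule ccontr)
        assume "y \<noteq> 0"
        have r1: "vs1.representation (B - C) y = vs1.representation B y"
          using vs1.representation_extend[OF B(3) y(1)] by auto
        have r2: "vs1.representation C y = vs1.representation B y"
          using vs1.representation_extend[OF B(3) y(2) B(1)] by auto
        have "vs1.representation B y b = 0" for b
          using vs1.representation_ne_zero[of "B - C" y b] vs1.representation_ne_zero[of C y b]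
          unfolding r1 r2 by blast
        moreover have "y \<in> vs1.span B" using y(1) vs1.span_mono[of "B - C" B] by blast
        hence "(\<Sum>b\<in>B. s1 (vs1.representation B y b) b) = y"
          using vs1.sum_representation_eq[OF B(3) _ finB order_refl] by blast
        ultimately show False using \<open>y \<noteq> 0\<close> by simp
      qed
      thus ?thesis using vs1.span_zero by blast
    qed
    ultimately show "x = 0" using x(1) by blast
  qed
  have ind: "\<not> vs2.dependent (f ` (B - C))"
    using f.independent_injective_image[OF _ inj] B(3) vs1.independent_mono by blast
  have fspan: "f ` A \<subseteq> vs2.span (f ` (B - C))"
  proof -
    have "f ` A \<subseteq> vs2.span (f ` B)" using f.spans_image[OF B(4)] .
    also have "\<dots> \<subseteq> vs2.span (f ` (B - C))"
    proof (intro vs2.span_minimal vs2.subspace_span subsetI)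
      fix y assume "y \<in> f ` B"
      then obtain b where b: "b \<in> B" "y = f b" by blast
      show "y \<in> vs2.span (f ` (B - C))"
      proof (cases "b \<in> C")
        case True
        hence "y = 0" using b C(1) by auto
        thus ?thesis by (simp add: vs2.span_zero)
      next
        case False
        thus ?thesis using b by (intro vs2.span_base) blast
      qed
    qed
    finally show ?thesis .
  qed
  have "card (f ` (B - C)) = card (B - C)"
    using inj by (intro card_image) (meson inj_on_subset vs1.span_superset)
  moreover have "card (f ` (B - C)) = vs2.dim (f ` A)"
    using fspan ind B(2) by (intro vs2.basis_card_eq_dim) auto
  moreover have "card B = vs1.dim A" using B by (intro vs1.basis_card_eq_dim)
  moreover have "card B = card C + card (B - C)"
    using finB B(1) C(2) by (simp add: card_Diff_subset card_mono)
  ultimately show "vs1.dim A = vs1.dim ?N + vs2.dim (f ` A)" using C(5) by linarith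
  show "fin_dim s2 (f ` A)" unfolding fin_dim_def using finB fspan by blast
qed

text \<open>Rank-nullity for the projection along \<open>B\<close>, which is injective on
  \<open>A\<close> and has kernel \<open>B\<close> on the sum.\<close>

lemma (in vector_space) dim_sum_direct:
  assumes "subspace A" "subspace B" "A \<inter> B = {0}" "fin_dim scale A" "fin_dim scale B"
  shows "local.dim {x + y | x y. x \<in> A \<and> y \<in> B} = local.dim A + local.dim B"
    and "fin_dim scale {x + y | x y. x \<in> A \<and> y \<in> B}"
proof -
  interpret vp: vector_space_pair scale scale ..
  let ?S = "{x + y | x y. x \<in> A \<and> y \<in> B}"
  obtain p where p: "Vector_Spaces.linear scale scale p" "\<And>x. x \<in> B \<Longrightarrow> p x = 0" "\<And>x. x - p x \<in> B"
    using projection_along_subspace[OF assms(2)] by blast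
  interpret p: Vector_Spaces.linear scale scale p by (rule p(1))
  obtain S T where "finite S" "A \<subseteq> span S" "finite T" "B \<subseteq> span T"
    using assms(4,5) unfolding fin_dim_def by blast
  hence "finite (S \<union> T)" "?S \<subseteq> span (S \<union> T)" by (auto simp: span_Un)
  thus fd: "fin_dim scale ?S" unfolding fin_dim_def by blast
  have sub: "subspace ?S" using subspace_sums[OF assms(1,2)] .
  have pB: "p x = 0 \<longleftrightarrow> x \<in> B" for x using p(2) p(3)[of x] by auto
  have "{x\<in>A. p x = 0} = {0}" using assms(3) pB by auto
  moreover have "local.dim {0} = 0" using dim_le_card[of "{0}" "{}"] by simp
  ultimately have 1: "local.dim A = local.dim (p ` A)"
    using vp.dim_kernel_image(1)[OF assms(1,4) p(1)] by simp
  have "B \<subseteq> ?S"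
  proof
    fix y assume "y \<in> B"
    hence "0 + y \<in> ?S" using subspace_0[OF assms(1)] by blast
    thus "y \<in> ?S" by simp
  qed
  hence "{x\<in>?S. p x = 0} = B" using pB by blast
  moreover have "p ` ?S = p ` A"
  proof
    show "p ` ?S \<subseteq> p ` A" using p(2) by (auto simp: p.add)
    show "p ` A \<subseteq> p ` ?S"
    proof (intro image_mono subsetI)
      fix x assume "x \<in> A"
      hence "x + 0 \<in> ?S" using subspace_0[OF assms(2)] by blast
      thus "x \<in> ?S" by simp
    qed
  qed
  ultimately show "local.dim ?S = local.dim A + local.dim B"
    using vp.dim_kernel_image(1)[OF sub fd p(1)] 1 by simp
qed

section \<open>A dual form of the projective Nullstellensatz\<close>

text \<open>\<open>T\<close> is assumed linear only on \<open>A\<close>. A nonzero polynomial of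
  least degree whose value at \<open>T\<close> kills a fixed \<open>v \<noteq> 0\<close> has a root
  \<open>a\<close>; the cofactor of the linear factor, applied to \<open>v\<close>, is an
  eigenvector, nonzero by minimality.\<close>

lemma eigenvector_exists:
  fixes sc :: "'k::alg_closed_field \<Rightarrow> 'b::ab_group_add \<Rightarrow> 'b"
  assumes "vector_space sc" "module.subspace sc A" "A \<noteq> {0}" "fin_dim sc A"
    and "\<And>x. x \<in> A \<Longrightarrow> T x \<in> A"
    and "\<And>x y. x \<in> A \<Longrightarrow> y \<in> A \<Longrightarrow> T (x + y) = T x + T y"
    and "\<And>c x. x \<in> A \<Longrightarrow> T (sc c x) = sc c (T x)"
  shows "\<exists>a x. x \<in> A \<and> x \<noteq> 0 \<and> T x = sc a x"
proof -
  interpret vector_space sc by fact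
  note subA = assms(2)
  have sumT: "T (\<Sum>i\<in>I. sc (c i) (x i)) = (\<Sum>i\<in>I. sc (c i) (T (x i)))"
    if "\<And>i. i \<in> I \<Longrightarrow> x i \<in> A" "finite I" for I :: "nat set" and c x
    using that(2,1)
  proof (induction I rule: finite_induct)
    case empty
    have "T 0 = 0" using assms(7)[OF subspace_0[OF subA], of 0] by simp
    thus ?case by simp
  next
    case (insert i I)
    have "(\<Sum>i\<in>I. sc (c i) (x i)) \<in> A"
      using insert.prems by (intro subspace_sum[OF subA] subspace_scale[OF subA]) auto
    thus ?case using insert assms(6,7) subspace_scale[OF subA] by simp
  qed
  obtain v where v: "v \<in> A" "v \<noteq> 0" using assms(3) subspace_0[OF subA] by blast
  \<comment> \<open>The orbit of \<open>v\<close>; \<open>ev p\<close> below is the polynomial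
    \<open>p\<close> in \<open>T\<close> applied to \<open>v\<close>.\<close>
  define P where "P i = (T ^^ i) v" for i
  have PA: "P i \<in> A" for i unfolding P_def by (induction i) (auto simp: v(1) assms(5))
  have TP: "T (P i) = P (Suc i)" for i by (simp add: P_def)
  define ev where "ev p = (\<Sum>i\<le>degree p. sc (coeff p i) (P i))" for p
  have ev_eq: "ev p = (\<Sum>i\<le>n. sc (coeff p i) (P i))" if "degree p \<le> n" for p n
    unfolding ev_def using that by (intro sum.mono_neutral_left) (auto simp: coeff_eq_0)
  have evA: "ev p \<in> A" for p
    unfolding ev_def using PA by (intro subspace_sum[OF subA] subspace_scale[OF subA])
  have "\<exists>p. p \<noteq> 0 \<and> ev p = 0"
  proof (cases "inj P")
    case False
    then obtain i j where ij: "P i = P j" "i < j"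
      unfolding inj_def by (metis linorder_neqE_nat)
    \<comment> \<open>A repetition in the orbit gives the annihilating polynomial
      \<open>X^j - X^i\<close> at once. In the other case the orbit points are distinct, so that
      \<open>card S + 1\<close> of them are dependent.\<close>
    define p where "p = monom 1 j - monom (1::'k) i"
    have "coeff p j = 1" using ij(2) by (simp add: p_def)
    hence "p \<noteq> 0" by auto
    have "degree p \<le> j" unfolding p_def using ij(2)
      by (intro degree_diff_le degree_monom_le order.trans[OF degree_monom_le]) auto
    hence "ev p = (\<Sum>k\<le>j. sc (coeff p k) (P k))" by (rule ev_eq)
    also have "\<dots> = (\<Sum>k\<le>j. if k = j then P j else 0) - (\<Sum>k\<le>j. if k = i then P i else 0)"
      unfolding sum_subtractf[symmetric] using ij(2)
      by (intro sum.cong) (auto simp: p_def)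
    also have "\<dots> = 0" using ij by simp
    finally show ?thesis using \<open>p \<noteq> 0\<close> by blast
  next
    case True
    obtain S where S: "finite S" "A \<subseteq> span S" using assms(4) unfolding fin_dim_def by blast
    have inj: "inj_on P {..card S}" using True inj_on_subset by blast
    have "card (P ` {..card S}) = Suc (card S)" using card_image[OF inj] by simp
    moreover have "P ` {..card S} \<subseteq> span S" using PA S(2) by blast
    ultimately have "dependent (P ` {..card S})" using independent_span_bound[OF S(1)] by fastforce
    then obtain u x where u: "x \<in> P ` {..card S}" "u x \<noteq> 0" "(\<Sum>x\<in>P ` {..card S}. sc (u x) x) = 0"
      using dependent_finite[of "P ` {..card S}"] by auto
    define p where "p = (\<Sum>i\<le>card S. monom (u (P i)) i)"
    have cf: "coeff p i = (if i \<le> card S then u (P i) else 0)" for i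
      by (auto simp: p_def coeff_sum)
    obtain i where "i \<le> card S" "x = P i" using u(1) by blast
    hence "coeff p i \<noteq> 0" using u(2) cf by simp
    hence "p \<noteq> 0" by auto
    have "degree p \<le> card S" by (intro degree_le) (simp add: cf)
    hence "ev p = (\<Sum>i\<le>card S. sc (u (P i)) (P i))"
      by (subst ev_eq[of _ "card S"]) (auto simp: cf)
    also have "\<dots> = 0" using u(3) sum.reindex[OF inj, of "\<lambda>x. sc (u x) x"] by simp
    finally show ?thesis using \<open>p \<noteq> 0\<close> by blast
  qed
  then obtain p where p: "p \<noteq> 0 \<and> ev p = 0"
    and min: "\<And>r. r \<noteq> 0 \<and> ev r = 0 \<Longrightarrow> degree p \<le> degree r"
    using ex_has_least_nat[of "\<lambda>p. p \<noteq> 0 \<and> ev p = 0" _ degree] by blast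
  have "degree p \<noteq> 0"
  proof
    assume 0: "degree p = 0"
    then obtain c where "p = [:c:]" using degree_eq_zeroE by blast
    hence "ev p = sc c v" "c \<noteq> 0" using p by (auto simp: ev_def P_def)
    thus False using p v(2) by simp
  qed
  then obtain a where "poly p a = 0" using alg_closed_imp_poly_has_root[of p] by blast
  then obtain r where r: "p = [:-a, 1:] * r" using poly_eq_0_iff_dvd dvdE by blast
  have "r \<noteq> 0" using p r by auto
  hence deg: "degree p = Suc (degree r)" unfolding r by (subst degree_mult_eq) auto
  have cf: "coeff p (Suc i) = coeff r i - a * coeff r (Suc i)" "coeff p 0 = - a * coeff r 0" for i
    by (simp_all add: r)
  have "ev p = sc (coeff p 0) (P 0) + (\<Sum>i\<le>degree r. sc (coeff p (Suc i)) (P (Suc i)))"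
    unfolding ev_def deg by (rule sum.atMost_Suc_shift)
  also have "\<dots> = (\<Sum>i\<le>degree r. sc (coeff r i) (P (Suc i)))
      - sc a (sc (coeff r 0) (P 0) + (\<Sum>i\<le>degree r. sc (coeff r (Suc i)) (P (Suc i))))"
    by (simp add: cf scale_left_diff_distrib sum_subtractf scale_right_distrib scale_sum_right)
  also have "sc (coeff r 0) (P 0) + (\<Sum>i\<le>degree r. sc (coeff r (Suc i)) (P (Suc i))) =
      (\<Sum>i\<le>Suc (degree r). sc (coeff r i) (P i))"
    by (rule sum.atMost_Suc_shift[symmetric])
  also have "\<dots> = ev r" by (rule ev_eq[symmetric]) simp
  also have "(\<Sum>i\<le>degree r. sc (coeff r i) (P (Suc i))) = T (ev r)"
    unfolding ev_def by (subst sumT) (auto simp: PA TP)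
  finally have "T (ev r) = sc a (ev r)" using p by simp
  moreover have "ev r \<noteq> 0" using min[of r] \<open>r \<noteq> 0\<close> deg by auto
  ultimately show ?thesis using evA by blast
qed

text \<open>Induction on the dimension: if some \<open>T j\<close> is not a scalar on
  \<open>A\<close>, one of its eigenspaces is a proper nonzero subspace, which the other maps
  preserve because they commute with \<open>T j\<close>.\<close>

lemma common_eigenvector_exists:
  fixes sc :: "'k::alg_closed_field \<Rightarrow> 'b::ab_group_add \<Rightarrow> 'b"
  assumes "vector_space sc" "module.subspace sc A" "A \<noteq> {0}" "fin_dim sc A"
    and "\<And>j x. j \<in> J \<Longrightarrow> x \<in> A \<Longrightarrow> T j x \<in> A"
    and "\<And>j x y. j \<in> J \<Longrightarrow> x \<in> A \<Longrightarrow> y \<in> A \<Longrightarrow> T j (x + y) = T j x + T j y"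
    and "\<And>j c x. j \<in> J \<Longrightarrow> x \<in> A \<Longrightarrow> T j (sc c x) = sc c (T j x)"
    and "\<And>i j x. i \<in> J \<Longrightarrow> j \<in> J \<Longrightarrow> x \<in> A \<Longrightarrow> T i (T j x) = T j (T i x)"
  shows "\<exists>a x. x \<in> A \<and> x \<noteq> 0 \<and> (\<forall>j\<in>J. T j x = sc (a j) x)"
  using assms(2-)
proof (induction "vector_space.dim sc A" arbitrary: A rule: less_induct)
  case less
  interpret vector_space sc by fact
  note subA = less.prems(1)
  show ?case
  proof (cases "\<forall>j\<in>J. \<exists>a. \<forall>x\<in>A. T j x = sc a x")
    case True
    then obtain a where "\<forall>j\<in>J. \<forall>x\<in>A. T j x = sc (a j) x" by metis
    moreover obtain x where "x \<in> A" "x \<noteq> 0" using less.prems(2) subspace_0[OF subA] by blast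
    ultimately show ?thesis by blast
  next
    case False
    then obtain j where j: "j \<in> J" "\<And>a. \<exists>x\<in>A. T j x \<noteq> sc a x" by blast
    obtain a v where v: "v \<in> A" "v \<noteq> 0" "T j v = sc a v"
      using eigenvector_exists[OF assms(1) less.prems(1-3), of "T j"] less.prems(4-6)[OF j(1)] by blast
    define A' where "A' = {x\<in>A. T j x = sc a x}"
    have subA': "subspace A'"
    proof (rule subspaceI)
      have "T j 0 = 0" using less.prems(6)[OF j(1) subspace_0[OF subA], of 0] by simp
      thus "0 \<in> A'" using subspace_0[OF subA] by (simp add: A'_def)
      show "x + y \<in> A'" if "x \<in> A'" "y \<in> A'" for x y
        using that less.prems(5)[OF j(1)] subspace_add[OF subA] by (simp add: A'_def scale_right_distrib)
      show "sc c x \<in> A'" if "x \<in> A'" for x c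
        using that less.prems(6)[OF j(1)] subspace_scale[OF subA] by (simp add: A'_def scale_left_commute)
    qed
    obtain x where x: "x \<in> A" "T j x \<noteq> sc a x" using j(2) by blast
    have sub: "A' \<subseteq> A" by (auto simp: A'_def)
    have lt: "local.dim A' < local.dim A"
      using dim_psubset_fin_dim[OF less.prems(3) subA' sub x(1)] x(2) by (simp add: A'_def)
    have ne: "A' \<noteq> {0}" using v by (auto simp: A'_def)
    have inv: "T i y \<in> A'" if "i \<in> J" "y \<in> A'" for i y
    proof -
      have y: "y \<in> A" "T j y = sc a y" using that(2) by (auto simp: A'_def)
      have "T j (T i y) = T i (T j y)" using less.prems(7)[OF j(1) that(1) y(1)] .
      also have "\<dots> = sc a (T i y)" using y less.prems(6)[OF that(1)] by simp
      finally show ?thesis using less.prems(4)[OF that(1) y(1)] by (simp add: A'_def)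
    qed
    have "\<exists>a x. x \<in> A' \<and> x \<noteq> 0 \<and> (\<forall>j\<in>J. T j x = sc (a j) x)"
    proof (rule less.hyps[OF lt subA' ne fin_dim_subset[OF less.prems(3) sub] inv])
      show "T i (x + y) = T i x + T i y" if "i \<in> J" "x \<in> A'" "y \<in> A'" for i x y
        using that sub by (intro less.prems(5)) auto
      show "T i (sc c x) = sc c (T i x)" if "i \<in> J" "x \<in> A'" for i c x
        using that sub by (intro less.prems(6)) auto
      show "T i (T k x) = T k (T i x)" if "i \<in> J" "k \<in> J" "x \<in> A'" for i k x
        using that sub by (intro less.prems(7)) auto
    qed
    thus ?thesis using sub by blast
  qed
qed

lemma decseq_nat_eventually_const:
  fixes d :: "nat \<Rightarrow> nat"
  assumes "\<And>q. q \<ge> q0 \<Longrightarrow> d (Suc q) \<le> d q"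
  shows "\<exists>q1\<ge>q0. \<forall>q\<ge>q1. d q = d q1"
proof -
  obtain q1 where q1: "q1 \<ge> q0" and min: "\<And>q. q \<ge> q0 \<Longrightarrow> d q1 \<le> d q"
    using ex_has_least_nat[of "\<lambda>q. q \<ge> q0" q0 d] by blast
  have "d q \<le> d q1" if "q \<ge> q1" for q
    using that by (induction rule: dec_induct) (use q1 assms in \<open>auto intro: le_trans\<close>)
  thus ?thesis using q1 min by (meson dual_order.antisym order.trans)
qed

text \<open>
  The dual form of the projective Nullstellensatz for finitely generated graded modules: the spaces
  \<open>E q\<close> are the duals of the graded pieces, and \<open>Y i q\<close> is the transpose of the multiplication by the
  \<open>i\<close>-th variable.
\<close>

theorem graded_common_eigenvector:
  fixes sc :: "'k::alg_closed_field \<Rightarrow> 'b::ab_group_add \<Rightarrow> 'b"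
    and Y :: "'i \<Rightarrow> nat \<Rightarrow> 'b \<Rightarrow> 'b"
  assumes "vector_space sc" "finite I"
    and "\<And>q. module.subspace sc (E q)" "\<And>q. fin_dim sc (E q)"
    and "\<And>i q f. i \<in> I \<Longrightarrow> f \<in> E (Suc q) \<Longrightarrow> Y i q f \<in> E q"
    and "\<And>i q. i \<in> I \<Longrightarrow> Vector_Spaces.linear sc sc (Y i q)"
    and "\<And>i j q f. i \<in> I \<Longrightarrow> j \<in> I \<Longrightarrow> f \<in> E (Suc (Suc q)) \<Longrightarrow>
           Y i q (Y j (Suc q) f) = Y j q (Y i (Suc q) f)"
    and "\<And>q f. q \<ge> q0 \<Longrightarrow> f \<in> E (Suc q) \<Longrightarrow> (\<And>i. i \<in> I \<Longrightarrow> Y i q f = 0) \<Longrightarrow> f = 0"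
    and "\<exists>\<^sub>\<infinity>q. E q \<noteq> {0}"
  shows "\<exists>a q1 f. (\<exists>i\<in>I. a i \<noteq> 0) \<and>
           (\<forall>q\<ge>q1. f q \<in> E q \<and> f q \<noteq> 0 \<and> (\<forall>i\<in>I. Y i q (f (Suc q)) = sc (a i) (f q)))"
  using assms(2-)
proof (induction I arbitrary: E q0 rule: finite_induct)
  case empty
  interpret vector_space sc by fact
  \<comment> \<open>Without variables the injectivity hypothesis says that every element of
    \<open>E (Suc q')\<close> with \<open>q' \<ge> q0\<close> is 0.\<close>
  have "E q = {0}" if "q > q0" for q
  proof (cases q)
    case (Suc q')
    have "f = 0" if "f \<in> E q" for f
    proof (rule empty.prems(6))
      show "q0 \<le> q'" using \<open>q > q0\<close> Suc by simp
      show "f \<in> E (Suc q')" using that Suc by simp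
    qed simp
    moreover have "0 \<in> E q" by (rule subspace_0[OF empty.prems(1)])
    ultimately show ?thesis by blast
  qed (use that in simp)
  moreover obtain q where "q > q0" "E q \<noteq> {0}" using empty.prems(7) unfolding INFM_nat by blast
  ultimately show ?case by blast
next
  case (insert j I)
  interpret vector_space sc by fact
  interpret vp: vector_space_pair sc sc ..
  note subE = insert.prems(1) and fdE = insert.prems(2) and YE = insert.prems(3)
    and Ylin = insert.prems(4) and Ycomm = insert.prems(5)
    and Yinj = insert.prems(6) and Einf = insert.prems(7)
  have Yadd: "Y i q (f + g) = Y i q f + Y i q g" and Ysc: "Y i q (sc c f) = sc c (Y i q f)"
    and Ydiff: "Y i q (f - g) = Y i q f - Y i q g" and Y0: "Y i q 0 = 0"
    if "i \<in> insert j I" for i q f g c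
  proof -
    interpret Vector_Spaces.linear sc sc "Y i q" by (rule Ylin[OF that])
    show "Y i q (f + g) = Y i q f + Y i q g" "Y i q (sc c f) = sc c (Y i q f)"
      "Y i q (f - g) = Y i q f - Y i q g" "Y i q 0 = 0" by (rule add scale diff zero)+
  qed
  define E' where "E' q = {f\<in>E q. \<forall>q'. q = Suc q' \<longrightarrow> Y j q' f = 0}" for q
  have E'E: "f \<in> E q" if "f \<in> E' q" for f q using that by (simp add: E'_def)
  have subE': "subspace (E' q)" for q
    using subspace_0[OF subE] subspace_add[OF subE] subspace_scale[OF subE] Y0 Yadd Ysc
    by (intro subspaceI) (auto simp: E'_def)
  show ?case
  proof (cases "\<exists>\<^sub>\<infinity>q. E' q \<noteq> {0}")
    \<comment> \<open>The kernel of \<open>Y j\<close> is stable under the remaining variables, and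
      an eigenfamily in it extends by the eigenvalue 0 at \<open>j\<close>.\<close>
    case True
    have "\<exists>a q1 f. (\<exists>i\<in>I. a i \<noteq> 0) \<and>
       (\<forall>q\<ge>q1. f q \<in> E' q \<and> f q \<noteq> 0 \<and> (\<forall>i\<in>I. Y i q (f (Suc q)) = sc (a i) (f q)))"
    proof (rule insert.IH[where E = E' and ?q0.0 = q0, OF subE' _ _ _ _ _ True])
      show "fin_dim sc (E' q)" for q using fin_dim_subset[OF fdE[of q]] E'E by blast
      show "Y i q f \<in> E' q" if "i \<in> I" "f \<in> E' (Suc q)" for i q f
      proof -
        have f: "f \<in> E (Suc q)" "Y j q f = 0" using that(2) by (auto simp: E'_def)
        have "Y j q' (Y i q f) = 0" if "q = Suc q'" for q'
          using Ycomm[of j i f q'] f Y0[of i q'] \<open>i \<in> I\<close> that by simp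
        thus ?thesis using YE[of i f q] f(1) \<open>i \<in> I\<close> by (simp add: E'_def)
      qed
      show "Vector_Spaces.linear sc sc (Y i q)" if "i \<in> I" for i q using that by (intro Ylin) simp
      show "Y i q (Y k (Suc q) f) = Y k q (Y i (Suc q) f)"
        if "i \<in> I" "k \<in> I" "f \<in> E' (Suc (Suc q))" for i k q f
        using that by (intro Ycomm) (auto intro: E'E)
      show "f = 0" if "q \<ge> q0" "f \<in> E' (Suc q)" "\<And>i. i \<in> I \<Longrightarrow> Y i q f = 0" for q f
        using that by (intro Yinj[of q f]) (auto simp: E'_def)
    qed
    then obtain a q1 f where a: "\<exists>i\<in>I. a i \<noteq> 0" and
      f: "\<And>q. q \<ge> q1 \<Longrightarrow> f q \<in> E' q" "\<And>q. q \<ge> q1 \<Longrightarrow> f q \<noteq> 0"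
        "\<And>q i. q \<ge> q1 \<Longrightarrow> i \<in> I \<Longrightarrow> Y i q (f (Suc q)) = sc (a i) (f q)" by blast
    have "Y j q (f (Suc q)) = 0" if "q \<ge> q1" for q
      using f(1)[of "Suc q"] that by (simp add: E'_def)
    hence "\<forall>q\<ge>q1. f q \<in> E q \<and> f q \<noteq> 0 \<and>
        (\<forall>i\<in>insert j I. Y i q (f (Suc q)) = sc ((a(j := 0)) i) (f q))"
      using f E'E insert.hyps(2) by auto
    moreover have "\<exists>i\<in>insert j I. (a(j := 0)) i \<noteq> 0" using a insert.hyps(2) by auto
    ultimately show ?thesis by blast
  next
    \<comment> \<open>Now \<open>Y j\<close> is injective in high degrees, so the dimensions
      decrease and become constant; \<open>Y j\<close> is then bijective and can be inverted, which
      amounts to working in the affine chart where the \<open>j\<close>-th coordinate is 1.\<close>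
    case False
    then obtain q1 where q1: "\<And>q. q \<ge> q1 \<Longrightarrow> E' q = {0}"
      unfolding not_INFM MOST_nat by (metis Suc_le_eq)
    have inj: "f = 0" if "q \<ge> q1" "f \<in> E (Suc q)" "Y j q f = 0" for q f
      using q1[of "Suc q"] that by (auto simp: E'_def)
    have inj': "f = g" if "q \<ge> q1" "f \<in> E (Suc q)" "g \<in> E (Suc q)" "Y j q f = Y j q g" for q f g
    proof -
      have "Y j q (f - g) = 0" using that(4) Ydiff[of j q f g] by simp
      hence "f - g = 0" by (rule inj[OF that(1) subspace_diff[OF subE that(2,3)]])
      thus ?thesis by simp
    qed
    have subY: "subspace (Y j q ` E (Suc q))" for q
      using Ylin[OF insertI1, of q] subE
      by (intro module_hom.subspace_image) (simp add: module_hom_iff_linear)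
    have imE: "Y j q ` E (Suc q) \<subseteq> E q" for q using YE by blast
    have dimim: "local.dim (Y j q ` E (Suc q)) = local.dim (E (Suc q))" if "q \<ge> q1" for q
    proof -
      have "{f\<in>E (Suc q). Y j q f = 0} = {0}"
        using inj[OF that] subspace_0[OF subE] Y0[of j q] by auto
      moreover have "local.dim {0} = 0" using dim_le_card[of "{0}" "{}"] by simp
      ultimately show ?thesis
        using vp.dim_kernel_image(1)[OF subE fdE Ylin[OF insertI1], of "Suc q" q] by simp
    qed
    have "local.dim (E (Suc q)) \<le> local.dim (E q)" if "q \<ge> q1" for q
      using dim_subset_fin_dim[OF fdE imE, of q] dimim[OF that] by simp
    hence "\<exists>q2\<ge>q1. \<forall>q\<ge>q2. local.dim (E q) = local.dim (E q2)"
      by (rule decseq_nat_eventually_const)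
    then obtain q2 d where q2: "q2 \<ge> q1" "\<And>q. q \<ge> q2 \<Longrightarrow> local.dim (E q) = d"
      by metis
    have surj: "Y j q ` E (Suc q) = E q" if "q \<ge> q2" for q
      using that q2 dimim[of q] by (intro subspace_eq_if_dim_eq[OF fdE subY imE]) auto
    define Z where "Z q f = (SOME g. g \<in> E (Suc q) \<and> Y j q g = f)" for q f
    have Z: "Z q f \<in> E (Suc q)" "Y j q (Z q f) = f" if "q \<ge> q2" "f \<in> E q" for q f
    proof -
      have "f \<in> Y j q ` E (Suc q)" using surj[OF that(1)] that(2) by simp
      hence "\<exists>g. g \<in> E (Suc q) \<and> Y j q g = f" by blast
      from someI_ex[OF this] show "Z q f \<in> E (Suc q)" "Y j q (Z q f) = f" unfolding Z_def by auto
    qed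
    have Zadd: "Z q (f + g) = Z q f + Z q g" if "q \<ge> q2" "f \<in> E q" "g \<in> E q" for q f g
    proof (rule inj'[of q])
      note fg = Z[OF that(1) that(2)] Z[OF that(1) that(3)] Z[OF that(1) subspace_add[OF subE that(2,3)]]
      show "q1 \<le> q" using that(1) q2(1) by simp
      show "Z q (f + g) \<in> E (Suc q)" by (rule fg(5))
      show "Z q f + Z q g \<in> E (Suc q)" by (rule subspace_add[OF subE fg(1,3)])
      show "Y j q (Z q (f + g)) = Y j q (Z q f + Z q g)"
        using fg(2,4,6) by (simp add: Yadd)
    qed
    have Zsc: "Z q (sc c f) = sc c (Z q f)" if "q \<ge> q2" "f \<in> E q" for q f c
    proof (rule inj'[of q])
      note f = Z[OF that] Z[OF that(1) subspace_scale[OF subE that(2)], of c]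
      show "q1 \<le> q" using that(1) q2(1) by simp
      show "Z q (sc c f) \<in> E (Suc q)" by (rule f(3))
      show "sc c (Z q f) \<in> E (Suc q)" by (rule subspace_scale[OF subE f(1)])
      show "Y j q (Z q (sc c f)) = Y j q (sc c (Z q f))"
        using f(2,4) by (simp add: Ysc)
    qed
    \<comment> \<open>\<open>Y i\<close> divided by \<open>Y j\<close>, an operator on the single
      space \<open>E q2\<close>; a common eigenvector of these operators gives a point of the
      chart.\<close>
    define T where "T i f = Y i q2 (Z q2 f)" for i f
    have YZ: "Y i q (Z q (Y j q h)) = Y i q h" if "q \<ge> q2" "h \<in> E (Suc q)" "i \<in> insert j I" for i q h
      using inj'[of q "Z q (Y j q h)" h] Z[OF that(1) YE[of j h q]] that q2(1) by simp
    have Tcomm: "T i (T k f) = T k (T i f)" if ik: "i \<in> I" "k \<in> I" and f: "f \<in> E q2" for i k f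
    proof -
      define h where "h = Z (Suc q2) (Z q2 f)"
      have z: "Z q2 f \<in> E (Suc q2)" using Z f by simp
      have h: "h \<in> E (Suc (Suc q2))" "Y j (Suc q2) h = Z q2 f" using Z[of "Suc q2", OF _ z] by (auto simp: h_def)
      have 1: "T l f = Y j q2 (Y l (Suc q2) h)" if "l \<in> I" for l
        using Ycomm[of l j h q2] h that by (simp add: T_def)
      have 2: "T m (T l f) = Y m q2 (Y l (Suc q2) h)" if "l \<in> I" "m \<in> I" for l m
      proof -
        have "Y l (Suc q2) h \<in> E (Suc q2)" using YE[of l h] h(1) that(1) by simp
        from YZ[OF order_refl this, of m] show ?thesis
          unfolding 1[OF that(1)] using that(2) by (simp add: T_def)
      qed
      show ?thesis using 2 ik Ycomm[of i k h q2] h by simp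
    qed
    have ne: "E q2 \<noteq> {0}"
    proof
      assume "E q2 = {0}"
      moreover have "local.dim {0} = 0" using dim_le_card[of "{0}" "{}"] by simp
      ultimately have "local.dim (E q2) = 0" by simp
      hence d: "d = 0" using q2(2)[OF order_refl] by (rule trans[OF sym, rotated])
      have "E q = {0}" if "q \<ge> q2" for q
      proof -
        obtain B where B: "finite B" "E q \<subseteq> span B" "card B = local.dim (E q)"
          using fin_dim_basis[OF fdE[of q]] by metis
        moreover have "local.dim (E q) = 0" using q2(2)[OF \<open>q \<ge> q2\<close>] d by (rule trans)
        ultimately have "B = {}" by simp
        thus ?thesis using B(2) subspace_0[OF subE, of q] by auto
      qed
      moreover obtain q where "q \<ge> q2" "E q \<noteq> {0}" using Einf unfolding INFM_nat_le by blast
      ultimately show False by blast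
    qed
    have "\<exists>a x. x \<in> E q2 \<and> x \<noteq> 0 \<and> (\<forall>i\<in>I. T i x = sc (a i) x)"
    proof (rule common_eigenvector_exists[OF assms(1) subE ne fdE])
      have Y: "i \<in> I \<Longrightarrow> i \<in> insert j I" for i by simp
      note Z2 = Z[OF order_refl]
      show "T i x \<in> E q2" if "i \<in> I" "x \<in> E q2" for i x
        unfolding T_def by (rule YE[OF Y[OF that(1)] Z2(1)[OF that(2)]])
      show "T i (x + y) = T i x + T i y" if "i \<in> I" "x \<in> E q2" "y \<in> E q2" for i x y
        unfolding T_def Zadd[OF order_refl that(2,3)] by (rule Yadd[OF Y[OF that(1)]])
      show "T i (sc c x) = sc c (T i x)" if "i \<in> I" "x \<in> E q2" for i c x
        unfolding T_def Zsc[OF order_refl that(2)] by (rule Ysc[OF Y[OF that(1)]])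
      show "T i (T k x) = T k (T i x)" if "i \<in> I" "k \<in> I" "x \<in> E q2" for i k x
        by (rule Tcomm[OF that])
    qed
    then obtain a x where x: "x \<in> E q2" "x \<noteq> 0" "\<And>i. i \<in> I \<Longrightarrow> T i x = sc (a i) x" by blast
    \<comment> \<open>The eigenvector is transported to all higher degrees by the inverse of
      \<open>Y j\<close>, so the eigenvalue at \<open>j\<close> is 1.\<close>
    define g where "g = rec_nat x (\<lambda>m y. Z (q2 + m) y)"
    have g0: "g 0 = x" and gS: "g (Suc m) = Z (q2 + m) (g m)" for m by (simp_all add: g_def)
    have gE: "g m \<in> E (q2 + m)" for m
      by (induction m) (use x(1) Z(1) in \<open>auto simp: g0 gS\<close>)
    have Yg: "Y j (q2 + m) (g (Suc m)) = g m" for m using Z(2) gE by (simp add: gS)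
    have gne: "g m \<noteq> 0" for m
    proof (induction m)
      case (Suc m)
      thus ?case using Yg[of m] Y0[of j "q2 + m"] by auto
    qed (simp add: g0 x(2))
    have eig: "Y i (q2 + m) (g (Suc m)) = sc (a i) (g m)" if i: "i \<in> I" for i m
    proof (induction m)
      case 0
      show ?case using x(3)[OF i] by (simp add: g0 gS T_def)
    next
      case (Suc m)
      have S: "g (Suc m) \<in> E (Suc (q2 + m))" "g (Suc (Suc m)) \<in> E (Suc (Suc (q2 + m)))"
        using gE[of "Suc m"] gE[of "Suc (Suc m)"] by simp_all
      have Yg': "Y j (Suc (q2 + m)) (g (Suc (Suc m))) = g (Suc m)" using Yg[of "Suc m"] by simp
      have "Y j (q2 + m) (Y i (Suc (q2 + m)) (g (Suc (Suc m)))) = sc (a i) (g m)"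
        using Ycomm[of j i "g (Suc (Suc m))" "q2 + m"] i S Yg' Suc by simp
      also have "\<dots> = Y j (q2 + m) (sc (a i) (g (Suc m)))"
        using Yg[of m] by (simp add: Ysc)
      finally show ?case
        using inj'[of "q2 + m" "Y i (Suc (q2 + m)) (g (Suc (Suc m)))" "sc (a i) (g (Suc m))"]
          YE[of i "g (Suc (Suc m))" "Suc (q2 + m)"] S i q2(1) subspace_scale[OF subE] by simp
    qed
    define f where "f q = g (q - q2)" for q
    have "f q \<in> E q \<and> f q \<noteq> 0 \<and> (\<forall>i\<in>insert j I. Y i q (f (Suc q)) = sc ((a(j := 1)) i) (f q))"
      if q: "q \<ge> q2" for q
    proof -
      obtain m where m: "q = q2 + m" using q le_Suc_ex by blast
      hence fm: "f q = g m" "f (Suc q) = g (Suc m)" by (simp_all add: f_def Suc_diff_le)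
      show ?thesis unfolding fm using m gE gne Yg eig insert.hyps(2) by auto
    qed
    moreover have "\<exists>i\<in>insert j I. (a(j := 1)) i \<noteq> 0" by auto
    ultimately show ?thesis by blast
  qed
qed

section \<open>Forms with polynomial coefficients\<close>

lemma sum_fun_apply: "(\<Sum>i\<in>I. f i) x = (\<Sum>i\<in>I. f i x)" for f :: "'i \<Rightarrow> 'x \<Rightarrow> 'k::comm_monoid_add"
  by (induction I rule: infinite_finite_induct) auto

lemma dual_scale_apply [simp]: "dual_scale c f x = c * f x"
  by (simp add: dual_scale_def)

text \<open>Adjacent transpositions generate all permutations: the head of \<open>w\<close> is moved
  letter by letter to its place in \<open>w'\<close>, and \<open>xs\<close> holds the letters
  already matched.\<close>

lemma mset_invariant_if_adjacent_swap:
  assumes "\<And>xs a b ys. h (xs @ a # b # ys) = h (xs @ b # a # ys)" and "mset w = mset w'"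
  shows "h w = h w'"
proof -
  have move: "h (xs @ a # ys @ zs) = h (xs @ ys @ a # zs)" for xs a ys zs
  proof (induction ys arbitrary: xs)
    case (Cons y ys)
    have "h (xs @ a # y # ys @ zs) = h ((xs @ [y]) @ a # ys @ zs)" using assms(1) by simp
    also have "\<dots> = h ((xs @ [y]) @ ys @ a # zs)" by (rule Cons.IH)
    finally show ?case by simp
  qed simp
  have "h (xs @ w) = h (xs @ w')" for xs
    using assms(2)
  proof (induction w arbitrary: xs w')
    case (Cons a w)
    then obtain ys zs where w': "w' = ys @ a # zs"
      by (metis list.set_intros(1) set_mset_mset split_list)
    have "h (xs @ a # w) = h ((xs @ [a]) @ w)" by simp
    also have "\<dots> = h ((xs @ [a]) @ ys @ zs)" using Cons.prems w' by (intro Cons.IH) simp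
    also have "\<dots> = h (xs @ w')" using move[of xs a ys zs] w' by simp
    finally show ?case .
  qed simp
  from this[of "[]"] show ?thesis by simp
qed

locale koszul_space = finite_dimensional_vector_space scale Basis
  for scale :: "'k::{alg_closed_field, field_char_0} \<Rightarrow> 'v::ab_group_add \<Rightarrow> 'v" (infixr "*s" 75)
    and Basis :: "'v set"
begin

definition lin :: "('v \<Rightarrow> 'k) \<Rightarrow> bool"
  where "lin a \<longleftrightarrow> (\<forall>x y. a (x + y) = a x + a y) \<and> (\<forall>c x. a (c *s x) = c * a x)"

lemma lin_iff: "lin a \<longleftrightarrow> Vector_Spaces.linear scale (*) a"
proof
  assume "lin a"
  thus "Vector_Spaces.linear scale (*) a"
    by unfold_locales (auto simp: lin_def algebra_simps)
next
  assume "Vector_Spaces.linear scale (*) a"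
  then interpret Vector_Spaces.linear scale "(*)" a .
  show "lin a" by (simp add: lin_def add scale)
qed

lemma mem_dual_space_iff: "a \<in> dual_space scale \<longleftrightarrow> lin a"
  by (simp add: dual_space_def lin_iff)

lemma lin_add: "lin a \<Longrightarrow> a (x + y) = a x + a y"
  and lin_scale: "lin a \<Longrightarrow> a (c *s x) = c * a x"
  by (simp_all add: lin_def)

lemma lin_zero: "lin a \<Longrightarrow> a 0 = 0"
  using lin_scale[of a 0 0] by simp

lemma lin_minus: "lin a \<Longrightarrow> a (- x) = - a x"
  using lin_scale[of a "-1" x] by simp

lemma lin_diff: "lin a \<Longrightarrow> a (x - y) = a x - a y"
  using lin_add[of a x "- y"] by (simp add: lin_minus)

lemma lin_sum: "lin a \<Longrightarrow> a (\<Sum>i\<in>I. f i) = (\<Sum>i\<in>I. a (f i))"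
  by (induction I rule: infinite_finite_induct) (auto simp: lin_zero lin_add)

lemma linI: "(\<And>x y. a (x + y) = a x + a y) \<Longrightarrow> (\<And>c x. a (c *s x) = c * a x) \<Longrightarrow> lin a"
  by (simp add: lin_def)

lemma subspace_dual_space: "functionals.subspace (dual_space scale)"
  by (rule functionals.subspaceI) (auto simp: mem_dual_space_iff lin_def algebra_simps)

text \<open>
  The functions below encode the graded dual of the Koszul complex: \<open>Sym\<^sup>p V\<close> is replaced by the
  symmetric \<open>p\<close>-linear functions on words, extended by zero to the words of other lengths.  The
  functions vanishing as soon as one argument lies in \<open>L\<close> are those pulled back from \<open>V / L\<close>.
\<close>

definition sym_forms :: "'v set \<Rightarrow> nat \<Rightarrow> ('v list \<Rightarrow> 'k) set"
  where "sym_forms L p = {h. (\<forall>w. length w \<noteq> p \<longrightarrow> h w = 0) \<and>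
    (\<forall>w w'. mset w = mset w' \<longrightarrow> h w = h w') \<and>
    (\<forall>w. lin (\<lambda>v. h (v # w))) \<and> (\<forall>v\<in>L. \<forall>w. h (v # w) = 0)}"

definition one_forms :: "'v set \<Rightarrow> nat \<Rightarrow> ('v \<times> 'v list \<Rightarrow> 'k) set"
  where "one_forms L p = {\<eta>. (\<forall>v. (\<lambda>w. \<eta> (v, w)) \<in> sym_forms L p) \<and>
    (\<forall>w. lin (\<lambda>v. \<eta> (v, w))) \<and> (\<forall>v\<in>L. \<forall>w. \<eta> (v, w) = 0)}"

text \<open>These are polynomial 2-forms: evaluating a coefficient on \<open>z # w\<close> is, up to
  a constant, differentiating it along \<open>z\<close>, so the last condition is closedness. For
  \<open>L = {0}\<close> the vanishing conditions follow from linearity, and all closed forms on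
  \<open>V\<close> are obtained.\<close>

definition closed_forms :: "'v set \<Rightarrow> nat \<Rightarrow> ('v \<times> 'v \<times> 'v list \<Rightarrow> 'k) set"
  where "closed_forms L p = {f. (\<forall>x y. (\<lambda>w. f (x, y, w)) \<in> sym_forms L p) \<and>
    (\<forall>y w. lin (\<lambda>x. f (x, y, w))) \<and> (\<forall>x y w. f (y, x, w) = - f (x, y, w)) \<and>
    (\<forall>x\<in>L. \<forall>y w. f (x, y, w) = 0) \<and>
    (\<forall>x y z w. f (x, y, z # w) + f (y, z, x # w) + f (z, x, y # w) = 0)}"

text \<open>The vector is inserted into the polynomial coefficient, not into the 2-form: up to a
  constant this is the derivative along \<open>v\<close>, and it is the transpose of multiplication
  by \<open>v\<close> on the symmetric algebra.\<close>

definition contract :: "'v \<Rightarrow> ('v \<times> 'v \<times> 'v list \<Rightarrow> 'k) \<Rightarrow> ('v \<times> 'v \<times> 'v list \<Rightarrow> 'k)"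
  where "contract v f = (\<lambda>(x, y, w). f (x, y, v # w))"

lemma contract_apply [simp]: "contract v f (x, y, w) = f (x, y, v # w)"
  by (simp add: contract_def)

lemma sym_formsD:
  assumes "h \<in> sym_forms L p"
  shows "length w \<noteq> p \<Longrightarrow> h w = 0" "mset w = mset w' \<Longrightarrow> h w = h w'"
    "lin (\<lambda>v. h (v # w))" "v \<in> L \<Longrightarrow> h (v # w) = 0"
  using assms unfolding sym_forms_def by blast+

lemma sym_formsI:
  assumes "\<And>w. length w \<noteq> p \<Longrightarrow> h w = 0" "\<And>w w'. mset w = mset w' \<Longrightarrow> h w = h w'"
    "\<And>w. lin (\<lambda>v. h (v # w))" "\<And>v w. v \<in> L \<Longrightarrow> h (v # w) = 0"
  shows "h \<in> sym_forms L p"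
  using assms unfolding sym_forms_def by blast

lemma one_formsI:
  assumes "\<And>v. (\<lambda>w. \<eta> (v, w)) \<in> sym_forms L p" "\<And>w. lin (\<lambda>v. \<eta> (v, w))"
    "\<And>v w. v \<in> L \<Longrightarrow> \<eta> (v, w) = 0"
  shows "\<eta> \<in> one_forms L p"
  using assms unfolding one_forms_def by blast

lemma closed_formsI:
  assumes "\<And>x y. (\<lambda>w. f (x, y, w)) \<in> sym_forms L p" "\<And>y w. lin (\<lambda>x. f (x, y, w))"
    "\<And>x y w. f (y, x, w) = - f (x, y, w)" "\<And>x y w. x \<in> L \<Longrightarrow> f (x, y, w) = 0"
    "\<And>x y z w. f (x, y, z # w) + f (y, z, x # w) + f (z, x, y # w) = 0"
  shows "f \<in> closed_forms L p"
  using assms unfolding closed_forms_def by blast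

lemma one_formsD:
  assumes "\<eta> \<in> one_forms L p"
  shows "(\<lambda>w. \<eta> (v, w)) \<in> sym_forms L p" "lin (\<lambda>v. \<eta> (v, w))" "v \<in> L \<Longrightarrow> \<eta> (v, w) = 0"
    "length w \<noteq> p \<Longrightarrow> \<eta> (v, w) = 0" "mset w = mset w' \<Longrightarrow> \<eta> (v, w) = \<eta> (v, w')"
    "lin (\<lambda>u. \<eta> (v, u # w))" "u \<in> L \<Longrightarrow> \<eta> (v, u # w) = 0"
  using assms unfolding one_forms_def sym_forms_def by blast+

lemma closed_formsD:
  assumes "f \<in> closed_forms L p"
  shows "(\<lambda>w. f (x, y, w)) \<in> sym_forms L p" "lin (\<lambda>x. f (x, y, w))" "f (y, x, w) = - f (x, y, w)"
    "x \<in> L \<Longrightarrow> f (x, y, w) = 0" "f (x, y, z # w) + f (y, z, x # w) + f (z, x, y # w) = 0"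
    "length w \<noteq> p \<Longrightarrow> f (x, y, w) = 0" "mset w = mset w' \<Longrightarrow> f (x, y, w) = f (x, y, w')"
    "lin (\<lambda>v. f (x, y, v # w))" "v \<in> L \<Longrightarrow> f (x, y, v # w) = 0"
  using assms unfolding closed_forms_def sym_forms_def by blast+

lemma closed_forms_lin2: "f \<in> closed_forms L p \<Longrightarrow> lin (\<lambda>y. f (x, y, w))"
proof -
  assume f: "f \<in> closed_forms L p"
  have "(\<lambda>y. f (x, y, w)) = (\<lambda>y. - f (y, x, w))"
    by (rule ext) (rule closed_formsD(3)[OF f])
  thus ?thesis using closed_formsD(2)[OF f, of x w] by (simp add: lin_def)
qed

lemma closed_forms_kills2: "f \<in> closed_forms L p \<Longrightarrow> y \<in> L \<Longrightarrow> f (x, y, w) = 0"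
  using closed_formsD(3)[of f L p x y w] closed_formsD(4)[of f L p y x w] by simp

lemma subspace_sym_forms: "functionals.subspace (sym_forms L p)"
proof (rule functionals.subspaceI)
  show "h + g \<in> sym_forms L p" if h: "h \<in> sym_forms L p" and g: "g \<in> sym_forms L p" for h g
  proof (rule sym_formsI)
    show "(h + g) w = (h + g) w'" if "mset w = mset w'" for w w'
      using sym_formsD(2)[OF h that] sym_formsD(2)[OF g that] by simp
    show "lin (\<lambda>v. (h + g) (v # w))" for w
      using sym_formsD(3)[OF h, of w] sym_formsD(3)[OF g, of w] by (simp add: lin_def algebra_simps)
  qed (simp_all add: sym_formsD(1,4)[OF h] sym_formsD(1,4)[OF g])
  show "dual_scale c h \<in> sym_forms L p" if h: "h \<in> sym_forms L p" for c h
  proof (rule sym_formsI)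
    show "dual_scale c h w = dual_scale c h w'" if "mset w = mset w'" for w w'
      using sym_formsD(2)[OF h that] by simp
    show "lin (\<lambda>v. dual_scale c h (v # w))" for w
      using sym_formsD(3)[OF h, of w] by (simp add: lin_def algebra_simps)
  qed (simp_all add: sym_formsD(1,4)[OF h])
qed (simp add: sym_forms_def lin_def)

lemma subspace_one_forms: "functionals.subspace (one_forms L p)"
proof (rule functionals.subspaceI)
  show "h + g \<in> one_forms L p" if h: "h \<in> one_forms L p" and g: "g \<in> one_forms L p" for h g
  proof (rule one_formsI)
    show "(\<lambda>w. (h + g) (v, w)) \<in> sym_forms L p" for v
      using functionals.subspace_add[OF subspace_sym_forms one_formsD(1)[OF h] one_formsD(1)[OF g]]
      by (simp add: plus_fun_def)
    show "lin (\<lambda>v. (h + g) (v, w))" for w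
      using one_formsD(2)[OF h, of w] one_formsD(2)[OF g, of w] by (simp add: lin_def algebra_simps)
  qed (simp add: one_formsD(3)[OF h] one_formsD(3)[OF g])
  show "dual_scale c h \<in> one_forms L p" if h: "h \<in> one_forms L p" for c h
  proof (rule one_formsI)
    show "(\<lambda>w. dual_scale c h (v, w)) \<in> sym_forms L p" for v
      using functionals.subspace_scale[OF subspace_sym_forms one_formsD(1)[OF h]]
      by (simp add: dual_scale_def)
    show "lin (\<lambda>v. dual_scale c h (v, w))" for w
      using one_formsD(2)[OF h, of w] by (simp add: lin_def algebra_simps)
  qed (simp add: one_formsD(3)[OF h])
qed (simp add: sym_forms_def one_forms_def lin_def)

lemma subspace_closed_forms: "functionals.subspace (closed_forms L p)"
proof (rule functionals.subspaceI)
  show "f + g \<in> closed_forms L p" if f: "f \<in> closed_forms L p" and g: "g \<in> closed_forms L p" for f g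
  proof (rule closed_formsI)
    show "(\<lambda>w. (f + g) (x, y, w)) \<in> sym_forms L p" for x y
      using functionals.subspace_add[OF subspace_sym_forms closed_formsD(1)[OF f] closed_formsD(1)[OF g]]
      by (simp add: plus_fun_def)
    show "lin (\<lambda>x. (f + g) (x, y, w))" for y w
      using closed_formsD(2)[OF f, of y w] closed_formsD(2)[OF g, of y w] by (simp add: lin_def algebra_simps)
    show "(f + g) (y, x, w) = - (f + g) (x, y, w)" for x y w
      using closed_formsD(3)[OF f, of y x w] closed_formsD(3)[OF g, of y x w] by simp
    show "(f + g) (x, y, z # w) + (f + g) (y, z, x # w) + (f + g) (z, x, y # w) = 0" for x y z w
    proof -
      have "(f + g) (x, y, z # w) + (f + g) (y, z, x # w) + (f + g) (z, x, y # w) =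
          (f (x, y, z # w) + f (y, z, x # w) + f (z, x, y # w)) +
          (g (x, y, z # w) + g (y, z, x # w) + g (z, x, y # w))" by (simp add: algebra_simps)
      thus ?thesis using closed_formsD(5)[OF f, of x y z w] closed_formsD(5)[OF g, of x y z w] by simp
    qed
  qed (simp add: closed_formsD(4)[OF f] closed_formsD(4)[OF g])
  show "dual_scale c f \<in> closed_forms L p" if f: "f \<in> closed_forms L p" for c f
  proof (rule closed_formsI)
    show "(\<lambda>w. dual_scale c f (x, y, w)) \<in> sym_forms L p" for x y
      using functionals.subspace_scale[OF subspace_sym_forms closed_formsD(1)[OF f]]
      by (simp add: dual_scale_def)
    show "lin (\<lambda>x. dual_scale c f (x, y, w))" for y w
      using closed_formsD(2)[OF f, of y w] by (simp add: lin_def algebra_simps)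
    show "dual_scale c f (y, x, w) = - dual_scale c f (x, y, w)" for x y w
      using closed_formsD(3)[OF f, of y x w] by simp
    show "dual_scale c f (x, y, z # w) + dual_scale c f (y, z, x # w) + dual_scale c f (z, x, y # w) = 0"
      for x y z w
    proof -
      have "c * (f (x, y, z # w) + f (y, z, x # w) + f (z, x, y # w)) = 0"
        using closed_formsD(5)[OF f] by simp
      thus ?thesis by (simp add: distrib_left)
    qed
  qed (simp add: closed_formsD(4)[OF f])
qed (simp add: sym_forms_def closed_forms_def lin_def)

lemma closed_forms_mono: "L' \<subseteq> L \<Longrightarrow> closed_forms L p \<subseteq> closed_forms L' p"
  unfolding closed_forms_def sym_forms_def by blast

lemma closed_forms_strengthen:
  assumes "f \<in> closed_forms L' p" "\<And>x y w. x \<in> L \<Longrightarrow> f (x, y, w) = 0"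
    "\<And>x y v w. v \<in> L \<Longrightarrow> f (x, y, v # w) = 0"
  shows "f \<in> closed_forms L p"
  by (intro closed_formsI sym_formsI closed_formsD(2,3,5-8)[OF assms(1)] assms(2,3))

lemma contract_linear:
  "contract v (f + g) = contract v f + contract v g"
  "contract v (f - g) = contract v f - contract v g"
  "contract v (dual_scale c f) = dual_scale c (contract v f)"
  "contract v 0 = 0"
  by (auto simp: fun_eq_iff contract_def)

lemma contract_sum: "contract v (\<Sum>i\<in>I. f i) = (\<Sum>i\<in>I. contract v (f i))"
proof (rule ext)
  fix t show "contract v (\<Sum>i\<in>I. f i) t = (\<Sum>i\<in>I. contract v (f i)) t"
    by (cases t) (simp add: sum_fun_apply)
qed

lemma contract_add_vector:
  "f \<in> closed_forms L p \<Longrightarrow> contract (u + v) f = contract u f + contract v f"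
  using closed_formsD(8) by (auto simp: fun_eq_iff lin_def)

lemma contract_scale_vector:
  "f \<in> closed_forms L p \<Longrightarrow> contract (c *s v) f = dual_scale c (contract v f)"
  using closed_formsD(8) by (auto simp: fun_eq_iff lin_def)

lemma contract_commute:
  "f \<in> closed_forms L p \<Longrightarrow> contract u (contract v f) = contract v (contract u f)"
  by (auto simp: fun_eq_iff intro: closed_formsD(7))

lemma contract_kills: "f \<in> closed_forms L p \<Longrightarrow> v \<in> L \<Longrightarrow> contract v f = 0"
  by (auto simp: fun_eq_iff intro: closed_formsD(9))

lemma contract_closed_forms:
  assumes f: "f \<in> closed_forms L (Suc p)"
  shows "contract v f \<in> closed_forms L p"
proof -
  have swap: "f (x, y, v # u # w) = f (x, y, u # v # w)" for x y u w
    by (rule closed_formsD(7)[OF f]) simp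
  show ?thesis
  proof (intro closed_formsI sym_formsI)
    show "contract v f (x, y, w) = contract v f (x, y, w')" if "mset w = mset w'" for x y w w'
      unfolding contract_apply using that by (intro closed_formsD(7)[OF f]) simp
    show "lin (\<lambda>u. contract v f (x, y, u # w))" for x y w
      using closed_formsD(8)[OF f, of x y "v # w"] by (simp add: swap)
    show "contract v f (x, y, u # w) = 0" if "u \<in> L" for x y u w
      using closed_formsD(9)[OF f that] by (simp add: swap)
    show "contract v f (x, y, z # w) + contract v f (y, z, x # w) + contract v f (z, x, y # w) = 0" for x y z w
      using closed_formsD(5)[OF f, of x y z "v # w"] by (simp add: swap)
    show "contract v f (y, x, w) = - contract v f (x, y, w)" for x y w
      using closed_formsD(3)[OF f, of y x] by simp
  qed (use closed_formsD(2,4,6)[OF f] in simp_all)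
qed

text \<open>The degree is positive because every contraction of a form with constant coefficients is
  0.\<close>

lemma closed_form_eq_0_if_contractions:
  assumes "f \<in> closed_forms L (Suc p)" "\<And>v. contract v f = 0"
  shows "f = 0"
proof (rule ext)
  fix t :: "'v \<times> 'v \<times> 'v list"
  obtain x y w where t: "t = (x, y, w)" by (cases t)
  show "f t = 0 t"
  proof (cases w)
    case Nil
    thus ?thesis using closed_formsD(6)[OF assms(1), of w x y] t by simp
  next
    case (Cons v u)
    thus ?thesis using fun_cong[OF assms(2)[of v], of "(x, y, u)"] t by simp
  qed
qed

text \<open>Integration of a linear family with symmetric second contractions. Symmetry of
  \<open>g\<close> in its first two letters is \<open>swap\<close>, in the others it comes from the
  \<open>G v\<close>. The degree of the \<open>G v\<close> is positive because closedness of
  \<open>g\<close> is read off from closedness of the \<open>G v\<close>, which is an empty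
  condition for constant coefficients.\<close>

lemma closed_form_with_contractions:
  assumes G: "\<And>v. G v \<in> closed_forms L (Suc p)"
    and add: "\<And>u v. G (u + v) = G u + G v" and scale: "\<And>c v. G (c *s v) = dual_scale c (G v)"
    and swap: "\<And>u v. contract u (G v) = contract v (G u)"
  shows "\<exists>g\<in>closed_forms L (Suc (Suc p)). \<forall>v. contract v g = G v"
proof -
  define g where "g = (\<lambda>(x, y, w). case w of [] \<Rightarrow> 0 | v # u \<Rightarrow> G v (x, y, u))"
  have g: "g (x, y, []) = 0" "g (x, y, v # u) = G v (x, y, u)" for x y v u
    by (simp_all add: g_def)
  have sw: "G v (x, y, u # w) = G u (x, y, v # w)" for u v x y w
    using fun_cong[OF swap[of u v], of "(x, y, w)"] by simp
  have sym: "g (x, y, w) = g (x, y, w')" if "mset w = mset w'" for x y w w'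
    using that
  proof (rule mset_invariant_if_adjacent_swap[rotated])
    fix xs a b ys
    show "g (x, y, xs @ a # b # ys) = g (x, y, xs @ b # a # ys)"
      using sw by (cases xs) (auto simp: g intro: closed_formsD(7)[OF G])
  qed
  have short: "g (x, y, w) = 0" if "length w \<noteq> Suc (Suc p)" for x y w
    using that closed_formsD(6)[OF G] by (cases w) (auto simp: g)
  have "g \<in> closed_forms L (Suc (Suc p))"
  proof (intro closed_formsI sym_formsI)
    fix x y z w
    show "lin (\<lambda>v. g (x, y, v # w))" by (rule linI) (simp_all add: g add scale)
    show "lin (\<lambda>x. g (x, y, w))"
      using closed_formsD(2)[OF G] by (cases w) (auto simp: g lin_def)
    show "g (y, x, w) = - g (x, y, w)"
      using closed_formsD(3)[OF G, of _ y x] by (cases w) (simp_all add: g)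
    show "g (x, y, w) = 0" if "x \<in> L"
      using closed_formsD(4)[OF G that] by (cases w) (auto simp: g)
    show "g (x, y, v # w) = 0" if "v \<in> L" for v
    proof (cases w)
      case Nil
      thus ?thesis using short by simp
    next
      case (Cons a u)
      thus ?thesis using closed_formsD(9)[OF G that, of a x y u] sw by (simp add: g)
    qed
    show "g (x, y, z # w) + g (y, z, x # w) + g (z, x, y # w) = 0"
    proof (cases w)
      case Nil
      thus ?thesis using short by simp
    next
      case (Cons a u)
      thus ?thesis using closed_formsD(5)[OF G, of a x y z u] by (simp add: g sw[of a])
    qed
    show "g (x, y, w) = 0" if "length w \<noteq> Suc (Suc p)" by (rule short[OF that])
    show "g (x, y, w) = g (x, y, w')" if "mset w = mset w'" for w' by (rule sym[OF that])
  qed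
  moreover have "contract v g = G v" for v by (auto simp: fun_eq_iff g)
  ultimately show ?thesis by blast
qed

end

section \<open>Dimensions of spaces of forms\<close>

text \<open>Evaluation at the points \<open>pt m\<close> identifies \<open>S\<close> with the
  functions on \<open>M\<close>: \<open>sep\<close> is injectivity, and the \<open>F m\<close> are
  the basis dual to the evaluations.\<close>

lemma dim_eq_card_evaluation_points:
  fixes S :: "('x \<Rightarrow> 'k::field) set"
  assumes sub: "functionals.subspace S" and fin: "finite M"
    and F: "\<And>m. m \<in> M \<Longrightarrow> F m \<in> S"
    and dual: "\<And>m m'. m \<in> M \<Longrightarrow> m' \<in> M \<Longrightarrow> F m (pt m') = (if m = m' then 1 else 0)"
    and sep: "\<And>f. f \<in> S \<Longrightarrow> (\<And>m. m \<in> M \<Longrightarrow> f (pt m) = 0) \<Longrightarrow> f = 0"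
  shows "functionals.dim S = card M" and "fin_dim dual_scale S"
proof -
  have inj: "inj_on F M"
    using dual by (intro inj_onI) (metis zero_neq_one)
  have val: "(\<Sum>m\<in>M. dual_scale (c m) (F m)) (pt m') = c m'" if "m' \<in> M" for c m'
  proof -
    have "(\<Sum>m\<in>M. dual_scale (c m) (F m)) (pt m') = (\<Sum>m\<in>M. if m = m' then c m else 0)"
      unfolding sum_fun_apply using dual that by (intro sum.cong) auto
    thus ?thesis using that fin by simp
  qed
  have ind: "\<not> functionals.dependent (F ` M)"
  proof
    assume "functionals.dependent (F ` M)"
    then obtain u x where u: "x \<in> F ` M" "u x \<noteq> 0" "(\<Sum>x\<in>F ` M. dual_scale (u x) x) = 0"
      using functionals.dependent_finite[of "F ` M"] fin by auto
    have "(\<Sum>m\<in>M. dual_scale (u (F m)) (F m)) = 0"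
      using u(3) sum.reindex[OF inj, of "\<lambda>x. dual_scale (u x) x"] by simp
    hence "u (F m) = 0" if "m \<in> M" for m using val[OF that, of "\<lambda>m. u (F m)"] by simp
    thus False using u(1,2) by blast
  qed
  have span: "S \<subseteq> functionals.span (F ` M)"
  proof
    fix f assume f: "f \<in> S"
    define g where "g = (\<Sum>m\<in>M. dual_scale (f (pt m)) (F m))"
    have "g \<in> S" unfolding g_def
      using F by (intro functionals.subspace_sum[OF sub] functionals.subspace_scale[OF sub])
    hence "f - g = 0"
      using val[of _ "\<lambda>m. f (pt m)"] by (intro sep functionals.subspace_diff[OF sub f]) (auto simp: g_def)
    moreover have "g \<in> functionals.span (F ` M)" unfolding g_def
      by (intro functionals.span_sum functionals.span_scale functionals.span_base) blast
    ultimately show "f \<in> functionals.span (F ` M)" by simp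
  qed
  show "fin_dim dual_scale S" unfolding fin_dim_def using span fin by blast
  have "card (F ` M) = functionals.dim S"
    using F span ind by (intro functionals.basis_card_eq_dim) auto
  thus "functionals.dim S = card M" using card_image[OF inj] by simp
qed

text \<open>The symmetrization of the product of the functionals in \<open>m\<close>, with the terms corresponding to
  equal functionals identified.\<close>

primrec sym_prod :: "('v \<Rightarrow> 'k::field) multiset \<Rightarrow> 'v list \<Rightarrow> 'k" where
  "sym_prod m [] = (if m = {#} then 1 else 0)"
| "sym_prod m (v # w) = (\<Sum>b\<in>set_mset m. b v * sym_prod (m - {#b#}) w)"

lemma sym_prod_length: "length w \<noteq> size m \<Longrightarrow> sym_prod m w = 0"
proof (induction w arbitrary: m)
  case (Cons v w)
  have "sym_prod (m - {#b#}) w = 0" if "b \<in># m" for b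
  proof (rule Cons.IH)
    have "size m > 0" using that nonempty_has_size by fastforce
    thus "length w \<noteq> size (m - {#b#})" using Cons.prems size_Diff_singleton[OF that] by simp
  qed
  thus ?case by simp
qed auto

lemma sym_prod_adjacent_swap: "sym_prod m (xs @ a # b # ys) = sym_prod m (xs @ b # a # ys)"
proof (induction xs arbitrary: m)
  case Nil
  \<comment> \<open>The ordered pairs of functionals that can be removed from \<open>m\<close> one
    after the other; \<open>c = d\<close> is allowed if it occurs twice. This set is symmetric, and
    exchanging the members of a pair exchanges the roles of \<open>a\<close> and
    \<open>b\<close>.\<close>
  let ?P = "SIGMA c:set_mset m. set_mset (m - {#c#})"
  have sw: "(d, c) \<in> ?P" if "(c, d) \<in> ?P" for c d
    using that by (cases "c = d") (auto simp: in_diff_count dest: in_diffD split: if_splits)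
  have expand: "sym_prod m (a # b # ys) = (\<Sum>(c, d)\<in>?P. c a * (d b * sym_prod (m - {#c#} - {#d#}) ys))" for a b
  proof -
    have "sym_prod m (a # b # ys) =
        (\<Sum>c\<in>set_mset m. \<Sum>d\<in>set_mset (m - {#c#}). c a * (d b * sym_prod (m - {#c#} - {#d#}) ys))"
      by (simp only: sym_prod.simps sum_distrib_left)
    also have "\<dots> = (\<Sum>(c, d)\<in>?P. c a * (d b * sym_prod (m - {#c#} - {#d#}) ys))"
    proof (rule sum.Sigma)
      show "finite (set_mset m)" by simp
      show "\<forall>c\<in>set_mset m. finite (set_mset (m - {#c#}))" by simp
    qed
    finally show ?thesis .
  qed
  have "(\<Sum>(c, d)\<in>?P. c a * (d b * sym_prod (m - {#c#} - {#d#}) ys)) =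
      (\<Sum>(c, d)\<in>?P. c b * (d a * sym_prod (m - {#c#} - {#d#}) ys))"
  proof (rule sum.reindex_bij_witness[of _ "\<lambda>(x, y). (y, x)" "\<lambda>(x, y). (y, x)"])
    fix t assume t: "t \<in> ?P"
    obtain c d where cd: "t = (c, d)" by (cases t)
    have "m - {#d#} - {#c#} = m - {#c#} - {#d#}" by (rule diff_right_commute)
    thus "(case case t of (x, y) \<Rightarrow> (y, x) of (c, d) \<Rightarrow> c b * (d a * sym_prod (m - {#c#} - {#d#}) ys)) =
        (case t of (c, d) \<Rightarrow> c a * (d b * sym_prod (m - {#c#} - {#d#}) ys))"
      by (simp add: cd mult.left_commute)
    show "(case t of (x, y) \<Rightarrow> (y, x)) \<in> ?P" using sw[of c d] t by (simp only: cd prod.case)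
  next
    fix t assume t: "t \<in> ?P"
    obtain c d where cd: "t = (c, d)" by (cases t)
    show "(case t of (x, y) \<Rightarrow> (y, x)) \<in> ?P" using sw[of c d] t by (simp only: cd prod.case)
  qed (simp_all add: split_beta)
  hence "sym_prod m (a # b # ys) = sym_prod m (b # a # ys)" by (simp only: expand)
  thus ?case by simp
qed simp

lemma sym_prod_cong: "mset w = mset w' \<Longrightarrow> sym_prod m w = sym_prod m w'"
  by (rule mset_invariant_if_adjacent_swap[of "sym_prod m"]) (rule sym_prod_adjacent_swap)

text \<open>Since \<open>sym_prod\<close> runs over distinct functionals, a word matching
  \<open>m\<close> is reached in exactly one way, and the value is 1 rather than a product of
  factorials of the multiplicities.\<close>

lemma sym_prod_dual_vectors:
  assumes "\<And>b c. b \<in> B \<Longrightarrow> c \<in> B \<Longrightarrow> b (e c) = (if b = c then 1 else 0)"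
    and "set_mset m \<subseteq> B" "set J \<subseteq> B"
  shows "sym_prod m (map e J) = (if mset J = m then 1 else 0)"
  using assms(2,3)
proof (induction J arbitrary: m)
  case (Cons j J)
  have "sym_prod m (map e (j # J)) = (\<Sum>b\<in>set_mset m. if b = j then sym_prod (m - {#j#}) (map e J) else 0)"
    unfolding list.map sym_prod.simps
  proof (intro sum.cong refl)
    fix b assume "b \<in> set_mset m"
    hence "b (e j) = (if b = j then 1 else 0)" using Cons.prems by (intro assms(1)) auto
    thus "b (e j) * sym_prod (m - {#b#}) (map e J) = (if b = j then sym_prod (m - {#j#}) (map e J) else 0)"
      by simp
  qed
  also have "\<dots> = (if j \<in># m then sym_prod (m - {#j#}) (map e J) else 0)" by simp
  also have "\<dots> = (if mset (j # J) = m then 1 else 0)"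
  proof (cases "j \<in># m")
    case True
    have "set_mset (m - {#j#}) \<subseteq> B" using Cons.prems(1) in_diffD by fast
    moreover have "mset (j # J) = m \<longleftrightarrow> mset J = m - {#j#}"
      using True by (metis add_mset_remove_trivial insert_DiffM mset.simps(2))
    ultimately show ?thesis using Cons.IH[of "m - {#j#}"] Cons.prems(2) True by simp
  qed auto
  finally show ?case .
qed auto

section \<open>Dual bases for subspaces of the dual space\<close>

context koszul_space
begin

text \<open>A subspace \<open>U\<close> of the dual space is the dual of the quotient of
  \<open>V\<close> by \<open>perp U\<close>; with \<open>L = perp U\<close> the spaces of forms are
  those pulled back from this quotient.\<close>

definition perp :: "('v \<Rightarrow> 'k) set \<Rightarrow> 'v set"
  where "perp U = {v. \<forall>u\<in>U. u v = 0}"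

lemma fin_dim_dual_space: "fin_dim dual_scale (dual_space scale)"
proof -
  define r where "r b = (\<lambda>x. representation Basis x b)" for b
  have "a \<in> functionals.span (r ` Basis)" if "a \<in> dual_space scale" for a
  proof -
    have a: "lin a" using that by (simp add: mem_dual_space_iff)
    have "a = (\<Sum>b\<in>Basis. dual_scale (a b) (r b))"
    proof
      fix x
      have "x = (\<Sum>b\<in>Basis. representation Basis x b *s b)"
        using sum_representation_eq[OF independent_Basis _ finite_Basis order_refl, of x] span_Basis by simp
      hence "a x = (\<Sum>b\<in>Basis. representation Basis x b * a b)"
        by (metis (no_types, lifting) a lin_scale lin_sum sum.cong)
      thus "a x = (\<Sum>b\<in>Basis. dual_scale (a b) (r b)) x"
        by (simp add: sum_fun_apply r_def mult.commute)
    qed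
    also have "\<dots> \<in> functionals.span (r ` Basis)"
      by (intro functionals.span_sum functionals.span_scale functionals.span_base) blast
    finally show ?thesis .
  qed
  thus ?thesis unfolding fin_dim_def using finite_Basis by blast
qed

text \<open>The dual vectors can be found in any subspace \<open>A\<close> that separates the
  elements of \<open>U\<close>. Besides \<open>A = UNIV\<close>, the case \<open>A = perp U'\<close>
  serves to split vectors along two components.\<close>

lemma dual_basis_relative:
  assumes U: "functionals.subspace U" "U \<subseteq> dual_space scale" and A: "subspace A"
    and sep: "\<And>u. u \<in> U \<Longrightarrow> (\<And>x. x \<in> A \<Longrightarrow> u x = 0) \<Longrightarrow> u = 0"
  obtains B e where "finite B" "B \<subseteq> U" "card B = functionals.dim U" "U \<subseteq> functionals.span B"
    "\<And>b. b \<in> B \<Longrightarrow> e b \<in> A"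
    "\<And>b c. b \<in> B \<Longrightarrow> c \<in> B \<Longrightarrow> b (e c) = (if b = c then 1 else 0)"
proof -
  obtain B where B: "B \<subseteq> U" "finite B" "\<not> functionals.dependent B" "U \<subseteq> functionals.span B"
      "card B = functionals.dim U"
    using functionals.fin_dim_basis[OF functionals.fin_dim_subset[OF fin_dim_dual_space U(2)]] by blast
  have "\<exists>e. \<forall>j\<in>B. e j \<in> A \<and> (\<forall>i\<in>B. i (e j) = (if i = j then 1 else 0))"
  proof (rule dual_vectors[OF B(2) A])
    show "Vector_Spaces.linear scale (*) i" if "i \<in> B" for i
      using that B(1) U(2) by (auto simp: dual_space_def)
    fix c assume c: "\<And>x. x \<in> A \<Longrightarrow> (\<Sum>i\<in>B. c i * i x) = 0"
    have "(\<Sum>i\<in>B. dual_scale (c i) i) = 0"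
    proof (rule sep)
      show "(\<Sum>i\<in>B. dual_scale (c i) i) \<in> U"
        using B(1) by (intro functionals.subspace_sum[OF U(1)] functionals.subspace_scale[OF U(1)]) auto
      show "(\<Sum>i\<in>B. dual_scale (c i) i) x = 0" if "x \<in> A" for x
        using c[OF that] by (simp add: sum_fun_apply)
    qed
    thus "\<forall>i\<in>B. c i = 0" using functionals.independentD[OF B(3,2) order_refl] by blast
  qed
  then obtain e where e: "\<And>b. b \<in> B \<Longrightarrow> e b \<in> A"
    "\<And>b c. b \<in> B \<Longrightarrow> c \<in> B \<Longrightarrow> b (e c) = (if b = c then 1 else 0)" by blast
  show thesis by (rule that[OF B(2,1,5,4) e])
qed

lemma subspace_perp: "U \<subseteq> dual_space scale \<Longrightarrow> subspace (perp U)"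
  by (rule subspaceI) (auto simp: perp_def mem_dual_space_iff subset_iff lin_zero lin_add lin_scale)

end

text \<open>The vectors \<open>e b\<close> represent the basis of the quotient of \<open>V\<close>
  by \<open>perp U\<close> that is dual to the basis \<open>B\<close> of \<open>U\<close>.\<close>

locale dual_basis = koszul_space +
  fixes U B :: "('b \<Rightarrow> 'a) set" and e :: "('b \<Rightarrow> 'a) \<Rightarrow> 'b"
  assumes U: "functionals.subspace U" "U \<subseteq> dual_space scale"
    and B: "finite B" "B \<subseteq> U" "card B = functionals.dim U" "U \<subseteq> functionals.span B"
    and e: "\<And>b c. b \<in> B \<Longrightarrow> c \<in> B \<Longrightarrow> b (e c) = (if b = c then 1 else 0)"
begin

lemma lin_B: "b \<in> B \<Longrightarrow> lin b"
  using B(2) U(2) mem_dual_space_iff by blast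

lemma remainder_in_perp: "x - (\<Sum>b\<in>B. b x *s e b) \<in> perp U"
proof -
  let ?r = "x - (\<Sum>b\<in>B. b x *s e b)"
  have "u ?r = 0" if "u \<in> U" for u
  proof -
    have "u \<in> functionals.span B" using that B(4) by blast
    thus ?thesis
    proof (induction rule: functionals.span_induct_alt)
      case (step c b u)
      have "b ?r = b x - (\<Sum>c\<in>B. c x * b (e c))"
        using lin_B[OF step(1)] by (simp add: lin_diff lin_sum lin_scale)
      also have "(\<Sum>c\<in>B. c x * b (e c)) = (\<Sum>c\<in>B. if c = b then b x else 0)"
        using e[OF step(1)] by (intro sum.cong) (auto simp del: e)
      finally show ?case using B(1) step by simp
    qed simp
  qed
  thus ?thesis by (simp add: perp_def)
qed

lemma lin_expand:
  assumes "lin f" "\<And>v. v \<in> perp U \<Longrightarrow> f v = 0"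
  shows "f x = (\<Sum>b\<in>B. b x * f (e b))"
proof -
  have "f (x - (\<Sum>b\<in>B. b x *s e b)) = 0" using assms(2) remainder_in_perp by blast
  thus ?thesis using assms(1) by (simp add: lin_diff lin_sum lin_scale)
qed

lemma mem_if_kills_perp:
  assumes "lin f" "\<And>v. v \<in> perp U \<Longrightarrow> f v = 0"
  shows "f \<in> U"
proof -
  have "f = (\<Sum>b\<in>B. dual_scale (f (e b)) b)"
  proof
    fix x
    have "(\<Sum>b\<in>B. dual_scale (f (e b)) b) x = (\<Sum>b\<in>B. b x * f (e b))"
      by (simp add: sum_fun_apply mult.commute)
    thus "f x = (\<Sum>b\<in>B. dual_scale (f (e b)) b) x"
      using lin_expand[OF assms, of x] by (rule trans[OF _ sym, rotated])
  qed
  also have "\<dots> \<in> U"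
    using B(2) by (intro functionals.subspace_sum[OF U(1)] functionals.subspace_scale[OF U(1)]) auto
  finally show ?thesis .
qed

lemma perp_kills: "b \<in> B \<Longrightarrow> v \<in> perp U \<Longrightarrow> b v = 0"
  using B(2) by (auto simp: perp_def)

lemma sym_prod_in_sym_forms:
  assumes "m \<in> multisets_of_size B p"
  shows "sym_prod m \<in> sym_forms (perp U) p"
proof -
  have m: "set_mset m \<subseteq> B" "size m = p" using assms by (auto simp: multisets_of_size_def)
  show ?thesis
  proof (rule sym_formsI)
    show "lin (\<lambda>v. sym_prod m (v # w))" for w
    proof (rule linI)
      show "sym_prod m ((x + y) # w) = sym_prod m (x # w) + sym_prod m (y # w)" for x y
        unfolding sym_prod.simps sum.distrib[symmetric]
        using m(1) lin_B by (intro sum.cong) (auto simp: lin_add algebra_simps)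
      show "sym_prod m ((c *s x) # w) = c * sym_prod m (x # w)" for c x
        unfolding sym_prod.simps sum_distrib_left
        using m(1) lin_B by (intro sum.cong) (auto simp: lin_scale algebra_simps)
    qed
    show "sym_prod m (v # w) = 0" if "v \<in> perp U" for v w
      using m(1) perp_kills[OF _ that] by (auto intro!: sum.neutral)
  qed (use m sym_prod_length sym_prod_cong in blast)+
qed

text \<open>Any ordering of \<open>m\<close> will do, since symmetric forms depend only on the
  multiset of their arguments.\<close>

definition pt :: "('b \<Rightarrow> 'a) multiset \<Rightarrow> 'b list"
  where "pt m = map e (SOME J. mset J = m)"

lemma sym_prod_pt:
  assumes "m \<in> multisets_of_size B p" "m' \<in> multisets_of_size B p"
  shows "sym_prod m (pt m') = (if m = m' then 1 else 0)"
proof -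
  have J: "mset (SOME J. mset J = m') = m'" by (rule someI_ex) (rule ex_mset)
  have "set (SOME J. mset J = m') \<subseteq> B"
    using assms(2) arg_cong[OF J, of set_mset] by (simp add: multisets_of_size_def)
  moreover have "set_mset m \<subseteq> B" using assms(1) by (simp add: multisets_of_size_def)
  ultimately show ?thesis unfolding pt_def using sym_prod_dual_vectors[of B e m] e J by auto
qed

lemma sym_form_eq_0_if_pt:
  assumes h: "h \<in> sym_forms (perp U) p" and 0: "\<And>m. m \<in> multisets_of_size B p \<Longrightarrow> h (pt m) = 0"
  shows "h w = 0"
proof -
  \<comment> \<open>The letters of the word are expanded one at a time in the dual vectors;
    \<open>J\<close> collects those already expanded.\<close>
  have "h (map e J @ w) = 0" if "set J \<subseteq> B" for J
    using that
  proof (induction w arbitrary: J)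
    case Nil
    show ?case
    proof (cases "length J = p")
      case True
      hence m: "mset J \<in> multisets_of_size B p" using Nil by (simp add: multisets_of_size_def)
      have "mset (SOME I. mset I = mset J) = mset J" by (rule someI) simp
      hence "h (map e J) = h (pt (mset J))" by (intro sym_formsD(2)[OF h]) (simp add: pt_def mset_map)
      thus ?thesis using 0[OF m] by simp
    qed (simp add: sym_formsD(1)[OF h])
  next
    case (Cons v w)
    have "h (map e J @ v # w) = h (v # map e J @ w)" by (intro sym_formsD(2)[OF h]) simp
    also have "\<dots> = (\<Sum>b\<in>B. b v * h (e b # map e J @ w))"
      by (rule lin_expand[OF sym_formsD(3)[OF h] sym_formsD(4)[OF h]])
    also have "\<dots> = 0"
    proof (intro sum.neutral ballI)
      fix b assume "b \<in> B"
      hence "h (map e (b # J) @ w) = 0" using Cons.prems by (intro Cons.IH) simp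
      thus "b v * h (e b # map e J @ w) = 0" by simp
    qed
    finally show ?case .
  qed
  from this[of "[]"] show ?thesis by simp
qed

text \<open>The \<open>sym_prod m\<close> with \<open>m\<close> of size \<open>p\<close> form a
  basis. The truncated subtraction is correct for empty \<open>B\<close>: the value is 1 for
  \<open>p = 0\<close> and 0 otherwise.\<close>

lemma dim_sym_forms:
  "functionals.dim (sym_forms (perp U) p) = (card B + p - 1) choose p"
  "fin_dim dual_scale (sym_forms (perp U) p)"
proof -
  have fin: "finite (multisets_of_size B p)" using B(1) by (rule finite_multisets_of_size)
  have sep: "f = 0" if "f \<in> sym_forms (perp U) p" "\<And>m. m \<in> multisets_of_size B p \<Longrightarrow> f (pt m) = 0" for f
    using sym_form_eq_0_if_pt[OF that] by (simp add: fun_eq_iff)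
  note dim = dim_eq_card_evaluation_points[where F = sym_prod and pt = pt,
      OF subspace_sym_forms fin sym_prod_in_sym_forms sym_prod_pt sep]
  show "functionals.dim (sym_forms (perp U) p) = (card B + p - 1) choose p"
    using dim(1) card_multisets_of_size[OF B(1)] by simp
  show "fin_dim dual_scale (sym_forms (perp U) p)" by (rule dim(2))
qed

lemma dim_one_forms:
  "functionals.dim (one_forms (perp U) p) = card B * ((card B + p - 1) choose p)"
  "fin_dim dual_scale (one_forms (perp U) p)"
proof -
  define M where "M = B \<times> multisets_of_size B p"
  define F where "F = (\<lambda>(b :: 'b \<Rightarrow> 'a, m :: ('b \<Rightarrow> 'a) multiset) (v, w). b v * sym_prod m w)"
  define P where "P = (\<lambda>(b, m). (e b, pt m))"
  have fin: "finite M" unfolding M_def using B(1) finite_multisets_of_size by blast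
  have F: "F t \<in> one_forms (perp U) p" if "t \<in> M" for t
  proof -
    obtain b m where t: "t = (b, m)" "b \<in> B" "m \<in> multisets_of_size B p"
      using \<open>t \<in> M\<close> unfolding M_def by blast
    show ?thesis
    proof (rule one_formsI)
      show "(\<lambda>w. F t (v, w)) \<in> sym_forms (perp U) p" for v
        using functionals.subspace_scale[OF subspace_sym_forms sym_prod_in_sym_forms[OF t(3)], of "b v"]
        by (simp add: t(1) F_def dual_scale_def)
      show "lin (\<lambda>v. F t (v, w))" for w
        using lin_B[OF t(2)] by (simp add: t(1) F_def lin_def algebra_simps)
    qed (simp add: t(1) F_def perp_kills[OF t(2)])
  qed
  have D: "F t (P t') = (if t = t' then 1 else 0)" if "t \<in> M" "t' \<in> M" for t t'
  proof -
    obtain b m b' m' where t: "t = (b, m)" "t' = (b', m')" by (cases t, cases t')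
    thus ?thesis using that e[of b b'] sym_prod_pt[of m p m'] by (simp add: F_def P_def M_def)
  qed
  have S: "\<eta> = 0" if \<eta>: "\<eta> \<in> one_forms (perp U) p" and 0: "\<And>t. t \<in> M \<Longrightarrow> \<eta> (P t) = 0" for \<eta>
  proof (rule ext)
    fix t :: "'b \<times> 'b list"
    obtain v w where t: "t = (v, w)" by (cases t)
    have "\<eta> (e b, w) = 0" if "b \<in> B" for b
    proof (rule sym_form_eq_0_if_pt[OF one_formsD(1)[OF \<eta>]])
      show "\<eta> (e b, pt m) = 0" if "m \<in> multisets_of_size B p" for m
        using 0[of "(b, m)"] \<open>b \<in> B\<close> that by (simp add: P_def M_def)
    qed
    hence "(\<Sum>b\<in>B. b v * \<eta> (e b, w)) = 0" by simp
    thus "\<eta> t = 0 t"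
      using lin_expand[OF one_formsD(2)[OF \<eta>] one_formsD(3)[OF \<eta>], of v w] t by simp
  qed
  have "functionals.dim (one_forms (perp U) p) = card M"
    by (rule dim_eq_card_evaluation_points(1)[of "one_forms (perp U) p" M F P])
      (fact subspace_one_forms fin F D S)+
  thus "functionals.dim (one_forms (perp U) p) = card B * ((card B + p - 1) choose p)"
    using card_multisets_of_size[OF B(1)] by (simp add: M_def card_cartesian_product)
  show "fin_dim dual_scale (one_forms (perp U) p)"
    by (rule dim_eq_card_evaluation_points(2)[of "one_forms (perp U) p" M F P])
      (fact subspace_one_forms fin F D S)+
qed

end

section \<open>The polynomial de Rham complex\<close>

context koszul_space
begin

text \<open>This is minus the transpose of \<open>koszul_delta2\<close>; the factor that
  differentiation of the coefficients would bring in depends only on the degree and is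
  dropped.\<close>

definition ext_deriv :: "('v \<times> 'v list \<Rightarrow> 'k) \<Rightarrow> ('v \<times> 'v \<times> 'v list \<Rightarrow> 'k)"
  where "ext_deriv \<eta> = (\<lambda>(x, y, w). \<eta> (x, y # w) - \<eta> (y, x # w))"

lemma ext_deriv_apply [simp]: "ext_deriv \<eta> (x, y, w) = \<eta> (x, y # w) - \<eta> (y, x # w)"
  by (simp add: ext_deriv_def)

lemma linear_ext_deriv: "Vector_Spaces.linear dual_scale dual_scale ext_deriv"
  by unfold_locales (auto simp: fun_eq_iff ext_deriv_def algebra_simps)

lemma ext_deriv_closed:
  assumes \<eta>: "\<eta> \<in> one_forms L (Suc p)"
  shows "ext_deriv \<eta> \<in> closed_forms L p"
proof -
  have swap: "\<eta> (x, y # z # w) = \<eta> (x, z # y # w)" for x y z w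
    by (rule one_formsD(5)[OF \<eta>]) simp
  show ?thesis
  proof (intro closed_formsI sym_formsI)
    fix x y w
    show "ext_deriv \<eta> (x, y, w) = 0" if "length w \<noteq> p"
      using that one_formsD(4)[OF \<eta>] by simp
    show "ext_deriv \<eta> (x, y, w) = ext_deriv \<eta> (x, y, w')" if "mset w = mset w'" for w'
    proof -
      have "\<eta> (x, y # w) = \<eta> (x, y # w')" for x y using that by (intro one_formsD(5)[OF \<eta>]) simp
      thus ?thesis by simp
    qed
    show "lin (\<lambda>v. ext_deriv \<eta> (x, y, v # w))"
    proof -
      have "(\<lambda>v. ext_deriv \<eta> (x, y, v # w)) = (\<lambda>v. \<eta> (x, v # y # w) - \<eta> (y, v # x # w))"
        using swap[of x y _ w] swap[of y x _ w] by simp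
      thus ?thesis
        using one_formsD(6)[OF \<eta>, of x "y # w"] one_formsD(6)[OF \<eta>, of y "x # w"]
        by (simp add: lin_def algebra_simps)
    qed
    show "ext_deriv \<eta> (x, y, v # w) = 0" if "v \<in> L" for v
      using one_formsD(7)[OF \<eta> that] swap[of x y v w] swap[of y x v w] by simp
    show "lin (\<lambda>x. ext_deriv \<eta> (x, y, w))"
      using one_formsD(2)[OF \<eta>, of "y # w"] one_formsD(6)[OF \<eta>, of y w]
      by (simp add: lin_def algebra_simps)
    show "ext_deriv \<eta> (x, y, w) = 0" if "x \<in> L"
      using one_formsD(3,7)[OF \<eta> that] by simp
    show "ext_deriv \<eta> (x, y, z # w) + ext_deriv \<eta> (y, z, x # w) + ext_deriv \<eta> (z, x, y # w) = 0" for z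
      using swap[of x y z w] swap[of y x z w] swap[of z x y w] by simp
  qed simp
qed

text \<open>Closed 1-forms are exact: if the derivative vanishes, the vector argument can be
  exchanged with the first letter, so \<open>v # w\<close> may be read as a single word in which the
  form is symmetric. Exactness means here that the form factors through
  \<open>koszul_delta1\<close>.\<close>

lemma ext_deriv_eq_0_iff:
  assumes \<eta>: "\<eta> \<in> one_forms L (Suc p)"
  shows "ext_deriv \<eta> = 0 \<longleftrightarrow> (\<exists>h\<in>sym_forms L (Suc (Suc p)). \<eta> = (\<lambda>(v, w). h (v # w)))"
proof
  assume "ext_deriv \<eta> = 0"
  hence sw: "\<eta> (x, y # w) = \<eta> (y, x # w)" for x y w
    by (metis ext_deriv_apply right_minus_eq zero_fun_apply)
  define h where "h = (\<lambda>w. case w of [] \<Rightarrow> 0 | v # u \<Rightarrow> \<eta> (v, u))"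
  have h: "h [] = 0" "h (v # u) = \<eta> (v, u)" for v u by (simp_all add: h_def)
  have "h \<in> sym_forms L (Suc (Suc p))"
  proof (rule sym_formsI)
    show "h w = 0" if "length w \<noteq> Suc (Suc p)" for w
      using that one_formsD(4)[OF \<eta>] by (cases w) (auto simp: h)
    show "h w = h w'" if "mset w = mset w'" for w w'
      using that
    proof (rule mset_invariant_if_adjacent_swap[rotated])
      fix xs a b ys
      show "h (xs @ a # b # ys) = h (xs @ b # a # ys)"
        using sw by (cases xs) (auto simp: h intro: one_formsD(5)[OF \<eta>])
    qed
  qed (use one_formsD(2,3)[OF \<eta>] in \<open>auto simp: h\<close>)
  moreover have "\<eta> = (\<lambda>(v, w). h (v # w))" by (auto simp: h fun_eq_iff)
  ultimately show "\<exists>h\<in>sym_forms L (Suc (Suc p)). \<eta> = (\<lambda>(v, w). h (v # w))" by blast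
next
  assume "\<exists>h\<in>sym_forms L (Suc (Suc p)). \<eta> = (\<lambda>(v, w). h (v # w))"
  then obtain h where h: "h \<in> sym_forms L (Suc (Suc p))" "\<eta> = (\<lambda>(v, w). h (v # w))" by blast
  have "h (x # y # w) = h (y # x # w)" for x y w by (rule sym_formsD(2)[OF h(1)]) simp
  thus "ext_deriv \<eta> = 0" by (auto simp: fun_eq_iff h(2))
qed

text \<open>Contraction of a 2-form with the Euler vector field; \<open>acc\<close> collects the arguments already
  visited.\<close>

primrec euler_sum :: "('v \<times> 'v \<times> 'v list \<Rightarrow> 'k) \<Rightarrow> 'v \<Rightarrow> 'v list \<Rightarrow> 'v list \<Rightarrow> 'k" where
  "euler_sum f x acc [] = 0"
| "euler_sum f x acc (v # w) = f (x, v, acc @ w) + euler_sum f x (v # acc) w"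

lemma euler_sum_cong_acc:
  assumes "f \<in> closed_forms L p" "mset acc = mset acc'"
  shows "euler_sum f x acc w = euler_sum f x acc' w"
  using assms(2)
proof (induction w arbitrary: acc acc')
  case (Cons v w)
  have "f (x, v, acc @ w) = f (x, v, acc' @ w)"
    using Cons.prems by (intro closed_formsD(7)[OF assms(1)]) simp
  thus ?case using Cons.IH[of "v # acc" "v # acc'"] Cons.prems by simp
qed simp

lemma euler_sum_swap:
  assumes f: "f \<in> closed_forms L p"
  shows "euler_sum f x acc (xs @ a # b # ys) = euler_sum f x acc (xs @ b # a # ys)"
proof (induction xs arbitrary: acc)
  case Nil
  have "euler_sum f x (b # a # acc) ys = euler_sum f x (a # b # acc) ys"
    by (rule euler_sum_cong_acc[OF f]) simp
  moreover have "f (x, a, acc @ b # ys) = f (x, a, b # acc @ ys)" "f (x, b, a # acc @ ys) = f (x, b, acc @ a # ys)"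
    by (rule closed_formsD(7)[OF f], simp)+
  ultimately show ?case by simp
next
  case (Cons v xs)
  have "f (x, v, acc @ xs @ a # b # ys) = f (x, v, acc @ xs @ b # a # ys)"
    by (rule closed_formsD(7)[OF f]) simp
  thus ?case using Cons.IH by simp
qed

lemma euler_sum_acc_lin:
  assumes f: "f \<in> closed_forms L p"
  shows "lin (\<lambda>u. euler_sum f x (u # acc) w)" and "u \<in> L \<Longrightarrow> euler_sum f x (u # acc) w = 0"
proof (induction w arbitrary: acc)
  case (Cons v w)
  have sw: "euler_sum f x (v # u # acc) w = euler_sum f x (u # v # acc) w" for u acc
    by (rule euler_sum_cong_acc[OF f]) simp
  {
    case 1
    have "(\<lambda>u. euler_sum f x (u # acc) (v # w)) = (\<lambda>u. f (x, v, u # acc @ w) + euler_sum f x (u # v # acc) w)"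
    proof
      show "euler_sum f x (u # acc) (v # w) = f (x, v, u # acc @ w) + euler_sum f x (u # v # acc) w" for u
        unfolding euler_sum.simps append_Cons sw[of u] ..
    qed
    thus ?case using Cons.IH(1)[of "v # acc"] closed_formsD(8)[OF f, of x v "acc @ w"]
      by (simp add: lin_def algebra_simps)
  next
    case 2
    have "euler_sum f x (v # u # acc) w = 0" unfolding sw using 2 by (rule Cons.IH(2))
    thus ?case using closed_formsD(9)[OF f 2, of x v "acc @ w"] by simp
  }
qed (simp_all add: lin_def)

lemma euler_sum_lin1: "f \<in> closed_forms L p \<Longrightarrow> lin (\<lambda>x. euler_sum f x acc w)"
proof (induction w arbitrary: acc)
  case (Cons v w)
  show ?case using Cons.IH[OF Cons.prems, of "v # acc"] closed_formsD(2)[OF Cons.prems, of v "acc @ w"]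
    by (simp add: lin_def algebra_simps)
qed (simp_all add: lin_def)

lemma euler_sum_kills1: "f \<in> closed_forms L p \<Longrightarrow> x \<in> L \<Longrightarrow> euler_sum f x acc w = 0"
  by (induction w arbitrary: acc) (simp_all add: closed_formsD(4))

text \<open>Each letter \<open>v\<close> of \<open>w\<close> contributes
  \<open>f (x, v, y # ...) - f (y, v, x # ...)\<close>, which closedness turns into
  \<open>f (x, y, v # ...)\<close>; hence the factor \<open>length w\<close>.\<close>

lemma euler_sum_antisym:
  assumes f: "f \<in> closed_forms L p"
  shows "euler_sum f x (y # acc) w - euler_sum f y (x # acc) w = of_nat (length w) * f (x, y, acc @ w)"
proof (induction w arbitrary: acc)
  case (Cons v w)
  have "euler_sum f x (v # y # acc) w = euler_sum f x (y # v # acc) w"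
    "euler_sum f y (v # x # acc) w = euler_sum f y (x # v # acc) w"
    by (rule euler_sum_cong_acc[OF f], simp)+
  hence "euler_sum f x (v # y # acc) w - euler_sum f y (v # x # acc) w = of_nat (length w) * f (x, y, v # acc @ w)"
    using Cons.IH[of "v # acc"] by simp
  moreover have "f (x, v, y # acc @ w) - f (y, v, x # acc @ w) = f (x, y, v # acc @ w)"
    using closed_formsD(5)[OF f, of x y v "acc @ w"] closed_formsD(3)[OF f, of x v "y # acc @ w"]
    by algebra
  moreover have "f (x, y, v # acc @ w) = f (x, y, acc @ v # w)"
    by (rule closed_formsD(7)[OF f]) simp
  ultimately show ?case by (simp add: algebra_simps)
qed simp

text \<open>Cartan's homotopy formula for the Euler vector field, whose Lie derivative multiplies a
  2-form with coefficients of degree \<open>p\<close> by \<open>p + 2\<close>; this number is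
  invertible in characteristic 0.\<close>

lemma poincare:
  assumes f: "f \<in> closed_forms L p"
  shows "\<exists>\<eta>\<in>one_forms L (Suc p). ext_deriv \<eta> = f"
proof -
  \<comment> \<open>Two of the \<open>p + 2\<close> terms come from the pair \<open>x\<close>,
    \<open>y\<close>, the other \<open>p\<close> from the letters of the word.\<close>
  define c where "c = inverse (of_nat (p + 2) :: 'k)"
  define \<eta> where "\<eta> = (\<lambda>(x, w). c * (if length w = Suc p then euler_sum f x [] w else 0))"
  have "\<eta> \<in> one_forms L (Suc p)"
  proof (intro one_formsI sym_formsI)
    fix x w
    show "\<eta> (x, w) = 0" if "length w \<noteq> Suc p" using that by (simp add: \<eta>_def)
    show "\<eta> (x, w) = \<eta> (x, w')" if "mset w = mset w'" for w'
    proof -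
      have "euler_sum f x [] w = euler_sum f x [] w'"
        by (rule mset_invariant_if_adjacent_swap[of "euler_sum f x []", OF _ that]) (rule euler_sum_swap[OF f])
      thus ?thesis using mset_eq_length[OF that] by (simp add: \<eta>_def)
    qed
    show "lin (\<lambda>v. \<eta> (x, v # w))"
      using euler_sum_acc_lin(1)[OF f, of x "[]" w] closed_forms_lin2[OF f, of x w]
      by (simp add: \<eta>_def lin_def algebra_simps)
    show "\<eta> (x, v # w) = 0" if "v \<in> L" for v
      using euler_sum_acc_lin(2)[OF f that, of x "[]" w] closed_forms_kills2[OF f that, of x w]
      by (simp add: \<eta>_def)
    show "lin (\<lambda>x. \<eta> (x, w))"
      using euler_sum_lin1[OF f, of "[]" w] by (simp add: \<eta>_def lin_def algebra_simps)
    show "\<eta> (x, w) = 0" if "x \<in> L"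
      using euler_sum_kills1[OF f that, of "[]" w] by (simp add: \<eta>_def)
  qed
  moreover have "ext_deriv \<eta> (x, y, w) = f (x, y, w)" for x y w
  proof (cases "length w = p")
    case True
    have "ext_deriv \<eta> (x, y, w) = c * (f (x, y, w) - f (y, x, w) + (euler_sum f x [y] w - euler_sum f y [x] w))"
      using True by (simp add: \<eta>_def algebra_simps)
    also have "\<dots> = c * (of_nat (p + 2) * f (x, y, w))"
      using euler_sum_antisym[OF f, of x y "[]" w] closed_formsD(3)[OF f, of y x w] True
      by (simp add: algebra_simps)
    also have "\<dots> = f (x, y, w)"
    proof -
      have "(of_nat (p + 2) :: 'k) \<noteq> 0" by (simp only: of_nat_eq_0_iff)
      thus ?thesis unfolding c_def mult.assoc[symmetric] by (subst left_inverse) simp_all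
    qed
    finally show ?thesis .
  next
    case False
    thus ?thesis using closed_formsD(6)[OF f False] by (simp add: \<eta>_def)
  qed
  hence "ext_deriv \<eta> = f" by (auto simp: fun_eq_iff)
  ultimately show ?thesis by blast
qed

end

text \<open>Rank-nullity for \<open>ext_deriv\<close> in numbers, with \<open>d\<close> the
  dimension of \<open>U\<close>: on the left the 1-forms of degree \<open>q + 1\<close>, on the
  right the symmetric forms of degree \<open>q + 2\<close>, which are the kernel, and the closed
  2-forms of degree \<open>q\<close>.\<close>

lemma koszul_dim_identity:
  "d * ((d + Suc q - 1) choose (Suc q)) = ((d + Suc (Suc q) - 1) choose (Suc (Suc q))) + (q + 1) * ((q + d) choose (q + 2))"
proof (cases d)
  case (Suc d')
  have "(q + 2) * ((q + d) choose (q + 2)) = d' * ((q + d) choose (q + 1))"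
    using binomial_absorb_comp[of "q + d" "q + 1"] times_binomial_minus1_eq[of "q + 2" "q + d"] Suc
    by simp
  moreover have "(Suc (q + d)) choose (Suc (Suc q)) = ((q + d) choose (q + 1)) + ((q + d) choose (q + 2))"
    by simp
  ultimately show ?thesis using Suc by (simp add: algebra_simps)
qed simp

context dual_basis
begin

lemma dim_closed_forms:
  "functionals.dim (closed_forms (perp U) q) = (q + 1) * ((q + functionals.dim U) choose (q + 2))"
  "fin_dim dual_scale (closed_forms (perp U) q)"
proof -
  interpret fp: vector_space_pair "dual_scale :: 'a \<Rightarrow> ('b \<times> 'b list \<Rightarrow> 'a) \<Rightarrow> _"
    "dual_scale :: 'a \<Rightarrow> ('b \<times> 'b \<times> 'b list \<Rightarrow> 'a) \<Rightarrow> _" ..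
  interpret fs: vector_space_pair "dual_scale :: 'a \<Rightarrow> ('b list \<Rightarrow> 'a) \<Rightarrow> _"
    "dual_scale :: 'a \<Rightarrow> ('b \<times> 'b list \<Rightarrow> 'a) \<Rightarrow> _" ..
  let ?L = "perp U" and ?s = "\<lambda>h (v, w). h (v # w)"
  have im: "ext_deriv ` one_forms ?L (Suc q) = closed_forms ?L q"
    using ext_deriv_closed poincare by blast
  have lin_s: "Vector_Spaces.linear dual_scale dual_scale (?s :: ('b list \<Rightarrow> 'a) \<Rightarrow> _)"
    by unfold_locales (auto simp: fun_eq_iff)
  have s_mem: "?s h \<in> one_forms ?L (Suc q)" if h: "h \<in> sym_forms ?L (Suc (Suc q))" for h
  proof (intro one_formsI sym_formsI)
    show "?s h (v, w) = ?s h (v, w')" if "mset w = mset w'" for v w w'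
      using that by (auto intro: sym_formsD(2)[OF h])
    show "lin (\<lambda>u. ?s h (v, u # w))" for v w
    proof -
      have "h (v # u # w) = h (u # v # w)" for u by (rule sym_formsD(2)[OF h]) simp
      thus ?thesis using sym_formsD(3)[OF h, of "v # w"] by simp
    qed
    show "?s h (v, u # w) = 0" if "u \<in> ?L" for v u w
    proof -
      have "h (v # u # w) = h (u # v # w)" by (rule sym_formsD(2)[OF h]) simp
      thus ?thesis using sym_formsD(4)[OF h that] by simp
    qed
  qed (use sym_formsD(1,3,4)[OF h] in simp_all)
  have ker: "{\<eta>\<in>one_forms ?L (Suc q). ext_deriv \<eta> = 0} = ?s ` sym_forms ?L (Suc (Suc q))"
    using ext_deriv_eq_0_iff s_mem by blast
  have "{h\<in>sym_forms ?L (Suc (Suc q)). ?s h = 0} = {0}"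
  proof -
    have "h = 0" if h: "h \<in> sym_forms ?L (Suc (Suc q))" "?s h = 0" for h
    proof
      show "h w = 0 w" for w
        using sym_formsD(1)[OF h(1), of w] fun_cong[OF h(2), of "(hd w, tl w)"] by (cases w) auto
    qed
    moreover have "?s 0 = (0 :: 'b \<times> 'b list \<Rightarrow> 'a)" by (auto simp: fun_eq_iff)
    ultimately show ?thesis using functionals.subspace_0[OF subspace_sym_forms] by blast
  qed
  moreover have "functionals.dim {0 :: 'b list \<Rightarrow> 'a} = 0"
    using functionals.dim_le_card[of "{0}" "{}"] by simp
  ultimately have "functionals.dim (?s ` sym_forms ?L (Suc (Suc q))) = functionals.dim (sym_forms ?L (Suc (Suc q)))"
    using fs.dim_kernel_image(1)[OF subspace_sym_forms dim_sym_forms(2) lin_s, of "Suc (Suc q)"] by simp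
  moreover have "functionals.dim (one_forms ?L (Suc q)) =
      functionals.dim (?s ` sym_forms ?L (Suc (Suc q))) + functionals.dim (closed_forms ?L q)"
    using fp.dim_kernel_image(1)[OF subspace_one_forms dim_one_forms(2) linear_ext_deriv, of "Suc q"] ker im by simp
  ultimately show "functionals.dim (closed_forms ?L q) = (q + 1) * ((q + functionals.dim U) choose (q + 2))"
    using koszul_dim_identity[of "card B" q] dim_sym_forms(1)[of "Suc (Suc q)"] dim_one_forms(1)[of "Suc q"] B(3)
    by simp
  show "fin_dim dual_scale (closed_forms ?L q)"
    using fp.dim_kernel_image(2)[OF subspace_one_forms dim_one_forms(2) linear_ext_deriv, of "Suc q"] im by simp
qed

end

section \<open>Duality between the Koszul module and closed forms\<close>

text \<open>Every functional on the free vector space arises in this way from a function on the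
  generators; the duality below works with such functions.\<close>

definition ev :: "('x \<Rightarrow> 'k::field) \<Rightarrow> ('x \<Rightarrow>\<^sub>0 'k) \<Rightarrow> 'k"
  where "ev h f = (\<Sum>x\<in>Poly_Mapping.keys f. Poly_Mapping.lookup f x * h x)"

lemma ev_superset:
  assumes "finite A" "Poly_Mapping.keys f \<subseteq> A"
  shows "ev h f = (\<Sum>x\<in>A. Poly_Mapping.lookup f x * h x)"
  unfolding ev_def using assms by (intro sum.mono_neutral_left) (auto simp: in_keys_iff)

lemma ev_add: "ev h (f + g) = ev h f + ev h g"
proof -
  let ?A = "Poly_Mapping.keys f \<union> Poly_Mapping.keys g"
  have "Poly_Mapping.keys (f + g) \<subseteq> ?A" by (rule Poly_Mapping.keys_add)
  thus ?thesis by (simp add: ev_superset[of ?A] lookup_add distrib_right sum.distrib)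
qed

lemma ev_fscale: "ev h (fscale c f) = c * ev h f"
proof -
  have "Poly_Mapping.keys (fscale c f) \<subseteq> Poly_Mapping.keys f" by (auto simp: in_keys_iff)
  thus ?thesis by (simp add: ev_superset[of "Poly_Mapping.keys f"] sum_distrib_left mult.assoc)
qed

lemma linear_ev: "Vector_Spaces.linear fscale (*) (ev h)"
  by unfold_locales (auto simp: ev_add ev_fscale algebra_simps)

lemma ev_zero [simp]: "ev h 0 = 0"
  by (simp add: ev_def)

lemma ev_diff: "ev h (f - g) = ev h f - ev h g"
  using Vector_Spaces.linear.axioms(3)[OF linear_ev[of h]] module_hom.diff by blast

lemma ev_sum: "ev h (\<Sum>i\<in>I. f i) = (\<Sum>i\<in>I. ev h (f i))"
  by (induction I rule: infinite_finite_induct) (auto simp: ev_add)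

lemma ev_gen [simp]: "ev h (gen x) = h x"
  by (simp add: ev_def gen_def)

lemma ev_lin_ext: "ev h (lin_ext g f) = ev (\<lambda>x. ev h (g x)) f"
  by (simp add: lin_ext_def ev_sum ev_fscale ev_def[of "\<lambda>x. ev h (g x)"])

lemma ev_cong: "(\<And>x. x \<in> Poly_Mapping.keys f \<Longrightarrow> h x = g x) \<Longrightarrow> ev h f = ev g f"
  by (simp add: ev_def)

lemma ev_uminus: "ev (\<lambda>x. - h x) f = - ev h f"
  by (simp add: ev_def sum_negf)

lemma ev_fun_add: "ev (\<lambda>x. h x + g x) f = ev h f + ev g f"
  by (simp add: ev_def sum.distrib algebra_simps)

lemma ev_fun_diff: "ev (\<lambda>x. h x - g x) f = ev h f - ev g f"
  by (simp add: ev_def sum_subtractf algebra_simps)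

lemma ev_fun_mult: "ev (\<lambda>x. c * h x) f = c * ev h f"
  by (simp add: ev_def sum_distrib_left algebra_simps)

lemma ev_fun_sum: "ev (\<lambda>x. \<Sum>i\<in>I. h i x) f = (\<Sum>i\<in>I. ev (h i) f)"
  unfolding ev_def sum_distrib_left by (rule sum.swap)

lemma ev_swap: "ev (\<lambda>x. ev (\<lambda>y. h x y) g) f = ev (\<lambda>y. ev (\<lambda>x. h x y) f) g"
  unfolding ev_def sum_distrib_left by (subst sum.swap) (simp add: mult.left_commute)

lemma ev_span: "x \<in> fvs.span S \<Longrightarrow> (\<And>s. s \<in> S \<Longrightarrow> ev h s = 0) \<Longrightarrow> ev h x = 0"
  by (induction rule: fvs.span_induct_alt) (auto simp: ev_add ev_fscale)

lemma sum_gen: "(\<Sum>x\<in>Poly_Mapping.keys f. fscale (Poly_Mapping.lookup f x) (gen x)) = f"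
proof (rule poly_mapping_eqI)
  fix y
  have "Poly_Mapping.lookup (\<Sum>x\<in>A. fscale (Poly_Mapping.lookup f x) (gen x)) y =
      (\<Sum>x\<in>A. if x = y then Poly_Mapping.lookup f x else 0)" if "finite A" for A
    using that by (induction A rule: finite_induct) (auto simp: lookup_add gen_def lookup_single when_def)
  thus "Poly_Mapping.lookup (\<Sum>x\<in>Poly_Mapping.keys f. fscale (Poly_Mapping.lookup f x) (gen x)) y =
      Poly_Mapping.lookup f y"
    by (simp add: in_keys_iff)
qed

lemma linear_functional_eq_ev:
  assumes "Vector_Spaces.linear fscale (*) F"
  shows "F f = ev (\<lambda>x. F (gen x)) f"
proof -
  interpret F: Vector_Spaces.linear fscale "(*)" F by fact
  have "F (\<Sum>x\<in>Poly_Mapping.keys f. fscale (Poly_Mapping.lookup f x) (gen x)) =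
      (\<Sum>x\<in>Poly_Mapping.keys f. Poly_Mapping.lookup f x * F (gen x))"
    by (simp add: F.sum F.scale)
  thus ?thesis by (simp add: sum_gen ev_def)
qed

text \<open>A coordinate that is nonzero at \<open>x\<close> after projection along the span does
  it.\<close>

lemma separating_functional:
  assumes "x \<notin> fvs.span S"
  shows "\<exists>h. (\<forall>s\<in>S. ev h s = 0) \<and> ev h x \<noteq> 0"
proof -
  obtain p where p: "Vector_Spaces.linear fscale fscale p" "\<And>x. x \<in> fvs.span S \<Longrightarrow> p x = 0"
      "\<And>x. x - p x \<in> fvs.span S"
    using fvs.projection_along_subspace[OF fvs.subspace_span[of S]] by blast
  interpret p: Vector_Spaces.linear fscale fscale p by (rule p(1))
  have "p x \<noteq> 0" using p(3)[of x] assms by auto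
  then obtain y where y: "Poly_Mapping.lookup (p x) y \<noteq> 0" by (metis lookup_zero poly_mapping_eqI)
  define F where "F z = Poly_Mapping.lookup (p z) y" for z
  have lin: "Vector_Spaces.linear fscale (*) F"
    by unfold_locales (auto simp: F_def p.add p.scale lookup_add algebra_simps)
  have "F s = 0" if "s \<in> S" for s using p(2)[OF fvs.span_base[OF that]] by (simp add: F_def)
  moreover have "F x \<noteq> 0" using y by (simp add: F_def)
  ultimately show ?thesis using linear_functional_eq_ev[OF lin] by metis
qed

text \<open>The \<open>F i\<close> induce a basis of the dual of \<open>A / B\<close>:
  \<open>FB\<close> makes them well defined, \<open>sep\<close> says that they separate classes and
  \<open>ind\<close> that they are independent. As \<open>quotient_dim\<close> rests on an arbitrary
  choice, every \<open>quotient_basis\<close> has to be counted, not only the one formed by the dual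
  vectors.\<close>

lemma quotient_dim_eq_card_functionals:
  assumes A: "fvs.subspace A" and B: "fvs.subspace B" and I: "finite I"
    and F: "\<And>i. i \<in> I \<Longrightarrow> Vector_Spaces.linear fscale (*) (F i)"
    and FB: "\<And>i x. i \<in> I \<Longrightarrow> x \<in> B \<Longrightarrow> F i x = 0"
    and sep: "\<And>x. x \<in> A \<Longrightarrow> (\<And>i. i \<in> I \<Longrightarrow> F i x = 0) \<Longrightarrow> x \<in> B"
    and ind: "\<And>c. (\<And>x. x \<in> A \<Longrightarrow> (\<Sum>i\<in>I. c i * F i x) = 0) \<Longrightarrow> \<forall>i\<in>I. c i = 0"
  shows "quotient_dim A B = card I"
proof -
  have "\<exists>e. \<forall>j\<in>I. e j \<in> A \<and> (\<forall>i\<in>I. F i (e j) = (if i = j then 1 else 0))"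
    by (rule fvs.dual_vectors[OF I A F ind])
  then obtain e where e: "\<And>j. j \<in> I \<Longrightarrow> e j \<in> A"
      "\<And>i j. i \<in> I \<Longrightarrow> j \<in> I \<Longrightarrow> F i (e j) = (if i = j then 1 else 0)"
    by blast
  \<comment> \<open>On \<open>A\<close> the kernel of \<open>r\<close> is \<open>B\<close> and its
    image is the span of the dual vectors, a model of \<open>A / B\<close>.\<close>
  define r where "r x = (\<Sum>i\<in>I. fscale (F i x) (e i))" for x
  have F_lin: "F i (x + y) = F i x + F i y" "F i (fscale c x) = c * F i x" if "i \<in> I" for i x y c
  proof -
    interpret Fi: Vector_Spaces.linear fscale "(*)" "F i" by (rule F[OF that])
    show "F i (x + y) = F i x + F i y" "F i (fscale c x) = c * F i x" by (rule Fi.add, rule Fi.scale)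
  qed
  have F_span: "F i x = 0" if "x \<in> fvs.span S" "i \<in> I" "\<And>s. s \<in> S \<Longrightarrow> F i s = 0" for i x S
    using that(1)
  proof (induction rule: fvs.span_induct_alt)
    case base
    show ?case using F_lin(2)[OF that(2), of 0 0] by simp
  next
    case (step c s y)
    thus ?case using F_lin[OF that(2)] that(3) by simp
  qed
  have lin_r: "Vector_Spaces.linear fscale fscale r"
  proof unfold_locales
    show "r (x + y) = r x + r y" for x y
      unfolding r_def sum.distrib[symmetric] using F_lin(1)
      by (intro sum.cong) (auto simp: fvs.scale_left_distrib)
    show "r (fscale c x) = fscale c (r x)" for c x
      unfolding r_def fvs.scale_sum_right using F_lin(2) by (intro sum.cong) auto
  qed
  interpret r: Vector_Spaces.linear fscale fscale r by (rule lin_r)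
  have rA: "r x \<in> A" for x
    unfolding r_def using e(1) by (intro fvs.subspace_sum[OF A] fvs.subspace_scale[OF A])
  have Fr: "F i (r x) = F i x" if "i \<in> I" for i x
  proof -
    interpret Fi: Vector_Spaces.linear fscale "(*)" "F i" by (rule F[OF that])
    have "F i (r x) = (\<Sum>j\<in>I. F j x * F i (e j))" by (simp add: r_def Fi.sum Fi.scale)
    also have "\<dots> = (\<Sum>j\<in>I. if j = i then F i x else 0)"
      using e(2)[OF that] by (intro sum.cong) auto
    finally show ?thesis using I that by simp
  qed
  have remB: "x - r x \<in> B" if "x \<in> A" for x
  proof (rule sep)
    show "x - r x \<in> A" using fvs.subspace_diff[OF A that rA] .
    show "F i (x - r x) = 0" if "i \<in> I" for i
    proof -
      interpret Fi: Vector_Spaces.linear fscale "(*)" "F i" by (rule F[OF that])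
      show ?thesis using Fr[OF that] by (simp add: Fi.diff)
    qed
  qed
  have rB: "r x = 0" if "x \<in> B" for x unfolding r_def using FB that by (intro sum.neutral) auto
  have re: "r (e j) = e j" if "j \<in> I" for j
  proof -
    have "r (e j) = (\<Sum>i\<in>I. if i = j then e j else 0)"
      unfolding r_def using e(2) that by (intro sum.cong) auto
    thus ?thesis using I that by simp
  qed
  have inj_e: "inj_on e I" using e(2) by (intro inj_onI) (metis zero_neq_one)
  have ind_e: "e j \<notin> fvs.span (B \<union> (e ` I - {e j}))" if "j \<in> I" for j
  proof
    assume "e j \<in> fvs.span (B \<union> (e ` I - {e j}))"
    hence "F j (e j) = 0"
    proof (rule F_span[OF _ that])
      fix s assume "s \<in> B \<union> (e ` I - {e j})"
      thus "F j s = 0" using FB[OF that] e(2)[OF that] by auto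
    qed
    thus False using e(2)[OF that that] by simp
  qed
  have "quotient_basis A B (e ` I)"
    unfolding quotient_basis_def
  proof (intro conjI subsetI ballI)
    show "x \<in> A" if "x \<in> e ` I" for x using that e(1) by blast
    show "x \<notin> fvs.span (B \<union> (e ` I - {x}))" if "x \<in> e ` I" for x using that ind_e by blast
    show "x \<in> fvs.span (B \<union> e ` I)" if "x \<in> A" for x
    proof -
      have "x - r x \<in> fvs.span (B \<union> e ` I)" using remB[OF that] by (intro fvs.span_base) blast
      moreover have "r x \<in> fvs.span (B \<union> e ` I)"
        unfolding r_def by (intro fvs.span_sum fvs.span_scale fvs.span_base) blast
      ultimately have "(x - r x) + r x \<in> fvs.span (B \<union> e ` I)" by (rule fvs.span_add)
      thus ?thesis by simp
    qed
  qed
  define C where "C = (SOME C. quotient_basis A B C)"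
  have "quotient_basis A B C" unfolding C_def using \<open>quotient_basis A B (e ` I)\<close> by (rule someI)
  hence C': "C \<subseteq> A" "A \<subseteq> fvs.span (B \<union> C)" "\<And>x. x \<in> C \<Longrightarrow> x \<notin> fvs.span (B \<union> (C - {x}))"
    unfolding quotient_basis_def by auto
  have indC: "\<not> fvs.dependent C"
    unfolding fvs.dependent_def using C'(3) fvs.span_mono[of "C - {_}" "B \<union> (C - {_})"] by blast
  \<comment> \<open>An element of the span of \<open>C\<close> killed by \<open>r\<close> lies in
    \<open>B\<close>; if it were nonzero, solving for a member of \<open>C\<close> would contradict
    the independence of \<open>C\<close> modulo \<open>B\<close>.\<close>
  have inj: "inj_on r (fvs.span C)"
    unfolding r.inj_on_iff_eq_0[OF fvs.subspace_span]
  proof (intro ballI impI, rule ccontr)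
    fix y assume y: "y \<in> fvs.span C" "r y = 0" "y \<noteq> 0"
    have "y \<in> A" using y(1) C'(1) A fvs.span_minimal by blast
    hence yB: "y \<in> B" using remB[of y] y(2) by simp
    let ?c = "fvs.representation C y"
    have fin: "finite {b. ?c b \<noteq> 0}" by (rule fvs.finite_representation)
    have sum: "(\<Sum>b | ?c b \<noteq> 0. fscale (?c b) b) = y"
      by (rule fvs.sum_nonzero_representation_eq[OF indC y(1)])
    then obtain b where b: "?c b \<noteq> 0" using y(3) by force
    have bC: "b \<in> C" using b by (rule fvs.representation_ne_zero)
    let ?S = "fvs.span (B \<union> (C - {b}))"
    have "b \<in> {a. ?c a \<noteq> 0}" using b by simp
    hence "fscale (?c b) b + (\<Sum>a\<in>{a. ?c a \<noteq> 0} - {b}. fscale (?c a) a) = y"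
      using sum sum.remove[OF fin, of b "\<lambda>b. fscale (?c b) b"] by (metis (no_types))
    hence "y - (\<Sum>a\<in>{a. ?c a \<noteq> 0} - {b}. fscale (?c a) a) = fscale (?c b) b"
      unfolding diff_eq_eq by (rule sym)
    moreover have "y - (\<Sum>a\<in>{a. ?c a \<noteq> 0} - {b}. fscale (?c a) a) \<in> ?S"
    proof (rule fvs.span_diff)
      show "y \<in> ?S" using yB by (intro fvs.span_base) blast
      show "(\<Sum>a\<in>{a. ?c a \<noteq> 0} - {b}. fscale (?c a) a) \<in> ?S"
        using fvs.representation_ne_zero by (intro fvs.span_sum fvs.span_scale fvs.span_base) blast
    qed
    ultimately have "fscale (?c b) b \<in> ?S" by (rule subst)
    hence "fscale (inverse (?c b)) (fscale (?c b) b) \<in> ?S" by (rule fvs.span_scale)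
    hence "b \<in> ?S" using b by simp
    thus False using C'(3)[OF bC] by blast
  qed
  have indrC: "\<not> fvs.dependent (r ` C)" by (rule r.independent_injective_image[OF indC inj])
  have "card C = card (r ` C)"
    using inj card_image[of r C] inj_on_subset[OF inj fvs.span_superset] by simp
  also have "\<dots> = fvs.dim (e ` I)"
  proof -
    have "fvs.span (r ` C) = fvs.span (e ` I)"
    proof (rule equalityI)
      have "r x \<in> fvs.span (e ` I)" for x
        unfolding r_def by (intro fvs.span_sum fvs.span_scale fvs.span_base) blast
      thus "fvs.span (r ` C) \<subseteq> fvs.span (e ` I)" by (intro fvs.span_minimal) auto
      have "e j \<in> fvs.span (r ` C)" if "j \<in> I" for j
      proof -
        have "e j \<in> fvs.span (B \<union> C)" using C'(2) e(1)[OF that] by blast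
        hence "r (e j) \<in> r ` fvs.span (B \<union> C)" by blast
        hence "e j \<in> fvs.span (r ` (B \<union> C))" using re[OF that] r.span_image by simp
        moreover have "fvs.span (r ` (B \<union> C)) \<subseteq> fvs.span (r ` C)"
        proof (intro fvs.span_minimal fvs.subspace_span subsetI)
          fix y assume "y \<in> r ` (B \<union> C)"
          thus "y \<in> fvs.span (r ` C)" using rB by (auto intro: fvs.span_base fvs.span_zero)
        qed
        ultimately show ?thesis by blast
      qed
      thus "fvs.span (e ` I) \<subseteq> fvs.span (r ` C)" by (intro fvs.span_minimal) auto
    qed
    thus ?thesis using fvs.dim_span_eq_card_independent[OF indrC] fvs.dim_span by metis
  qed
  also have "\<dots> = card (e ` I)"
  proof (rule fvs.dim_eq_card_independent)
    show "\<not> fvs.dependent (e ` I)"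
      unfolding fvs.dependent_def
    proof
      assume "\<exists>a\<in>e ` I. a \<in> fvs.span (e ` I - {a})"
      then obtain j where j: "j \<in> I" "e j \<in> fvs.span (e ` I - {e j})" by blast
      have "fvs.span (e ` I - {e j}) \<subseteq> fvs.span (B \<union> (e ` I - {e j}))" by (rule fvs.span_mono) blast
      thus False using ind_e[OF j(1)] j(2) by blast
    qed
  qed
  also have "\<dots> = card I" by (rule card_image[OF inj_e])
  finally show ?thesis unfolding quotient_dim_def C_def .
qed

section \<open>Linear extensions, products and ideals in free vector spaces\<close>

lemma lin_ext_add: "lin_ext h (f + g) = lin_ext h f + lin_ext h g"
  and lin_ext_fscale: "lin_ext h (fscale c f) = fscale c (lin_ext h f)"
  and lin_ext_gen [simp]: "lin_ext h (gen x) = h x"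
proof -
  have look: "Poly_Mapping.lookup (lin_ext h f) y = ev (\<lambda>x. Poly_Mapping.lookup (h x) y) f" for f y
    unfolding lin_ext_def ev_def
    by (induction rule: infinite_finite_induct) (auto simp: lookup_add)
  show "lin_ext h (f + g) = lin_ext h f + lin_ext h g"
    by (rule poly_mapping_eqI) (simp add: look lookup_add ev_add)
  show "lin_ext h (fscale c f) = fscale c (lin_ext h f)"
    by (rule poly_mapping_eqI) (simp add: look ev_fscale)
  show "lin_ext h (gen x) = h x" by (rule poly_mapping_eqI) (simp add: look)
qed

lemma linear_lin_ext: "Vector_Spaces.linear fscale fscale (lin_ext h)"
  by unfold_locales (auto simp: lin_ext_add lin_ext_fscale)

lemma lin_ext_diff: "lin_ext h (f - g) = lin_ext h f - lin_ext h g"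
  using Vector_Spaces.linear.axioms(3)[OF linear_lin_ext[of h]] module_hom.diff by blast

lemma lin_ext_zero [simp]: "lin_ext h 0 = 0"
  by (simp add: lin_ext_def)

lemma free_mult_simps [simp]:
  "free_mult (gen xs) (gen ys) = gen (xs @ ys)"
  "free_mult (f + f') g = free_mult f g + free_mult f' g"
  "free_mult (f - f') g = free_mult f g - free_mult f' g"
  "free_mult (fscale c f) g = fscale c (free_mult f g)"
  "free_mult (gen xs) (g + g') = free_mult (gen xs) g + free_mult (gen xs) g'"
  "free_mult (gen xs) (g - g') = free_mult (gen xs) g - free_mult (gen xs) g'"
  "free_mult (gen xs) (fscale c g) = fscale c (free_mult (gen xs) g)"
  by (simp_all add: free_mult_def lin_ext_add lin_ext_diff lin_ext_fscale)

lemma ev_free_mult: "ev h (free_mult f g) = ev (\<lambda>xs. ev (\<lambda>ys. h (xs @ ys)) g) f"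
  by (simp add: free_mult_def ev_lin_ext)

lemma ev_tensor: "ev h (tensor f g) = ev (\<lambda>x. ev (\<lambda>y. h (x, y)) g) f"
  by (simp add: tensor_def ev_lin_ext)

lemma ev_koszul_delta1: "ev h (koszul_delta1 x) = ev (\<lambda>(v, w). h (v # w)) x"
  by (simp add: koszul_delta1_def ev_lin_ext split_def)

lemma ev_koszul_delta2:
  "ev h (koszul_delta2 x) = ev (\<lambda>(z, w). h (z ! 1, z ! 0 # w) - h (z ! 0, z ! 1 # w)) x"
  by (simp add: koszul_delta2_def ev_lin_ext split_def ev_diff)

lemma free_ideal_memI:
  "set xs \<subseteq> U \<Longrightarrow> r \<in> R \<Longrightarrow> set ys \<subseteq> U \<Longrightarrow> free_mult (free_mult (gen xs) r) (gen ys) \<in> free_ideal U R"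
  unfolding free_ideal_def by (intro fvs.span_base) blast

lemma subspace_free_on: "fvs.subspace (free_on X)"
proof (rule fvs.subspaceI)
  show "f + g \<in> free_on X" if "f \<in> free_on X" "g \<in> free_on X" for f g
    using that Poly_Mapping.keys_add[of f g] by (auto simp: free_on_def)
  show "fscale c f \<in> free_on X" if "f \<in> free_on X" for c f
    using that by (auto simp: free_on_def in_keys_iff subset_iff)
qed (simp add: free_on_def)

lemma gen_in_free_on [simp]: "gen x \<in> free_on X \<longleftrightarrow> x \<in> X"
  by (simp add: free_on_def gen_def)

section \<open>Functionals on the Koszul complex\<close>

context koszul_space
begin

text \<open>With fixed outer words \<open>xs\<close> and \<open>ys\<close>, a symmetric form is
  still symmetric and linear in the inner letters, because these can be moved to the front.\<close>

lemma sym_form_kills_symmetric_ideal: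
  assumes h: "h \<in> sym_forms L p" and r: "r \<in> symmetric_ideal scale UNIV"
  shows "ev h r = 0"
  using r unfolding symmetric_ideal_def free_ideal_def
proof (rule ev_span)
  fix s :: "'v list \<Rightarrow>\<^sub>0 'k"
  assume "s \<in> {free_mult (free_mult (gen xs) r) (gen ys) |xs r ys.
    set xs \<subseteq> UNIV \<and> r \<in> symmetric_rels scale UNIV \<and> set ys \<subseteq> UNIV}"
  then obtain xs r ys where s: "s = free_mult (free_mult (gen xs) r) (gen ys)"
    and r: "r \<in> symmetric_rels scale UNIV" by blast
  have swap: "h (xs @ u # ys) = h (u # xs @ ys)" for u
    by (rule sym_formsD(2)[OF h]) simp
  have swap2: "h (xs @ u # v # ys) = h (xs @ v # u # ys)" for u v
    by (rule sym_formsD(2)[OF h]) simp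
  have lin: "lin (\<lambda>u. h (u # xs @ ys))" by (rule sym_formsD(3)[OF h])
  have "ev h s = ev (\<lambda>m. h (xs @ m @ ys)) r"
    by (simp add: s ev_free_mult)
  also have "\<dots> = 0"
    using r unfolding symmetric_rels_def linear_rels_def
    by (auto simp: ev_diff ev_fscale swap lin_add[OF lin] lin_scale[OF lin] swap2[of _ _ ])
  finally show "ev h s = 0" .
qed

text \<open>For an alternating bilinear \<open>g\<close> this means that \<open>g\<close>, as an
  element of the exterior square of the dual space, lies in the annihilator of
  \<open>K\<close>.\<close>

definition kills :: "('v list \<Rightarrow>\<^sub>0 'k) set \<Rightarrow> ('v \<Rightarrow> 'v \<Rightarrow> 'k) \<Rightarrow> bool"
  where "kills K g \<longleftrightarrow> (\<forall>\<kappa>\<in>K. ev (\<lambda>z. g (z ! 0) (z ! 1)) \<kappa> = 0)"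

text \<open>This is \<open>D\<^sub>q\<close>; for fixed \<open>w\<close> a form takes its value in
  the exterior square of the dual space.\<close>

definition koszul_dual :: "('v list \<Rightarrow>\<^sub>0 'k) set \<Rightarrow> nat \<Rightarrow> ('v \<times> 'v \<times> 'v list \<Rightarrow> 'k) set"
  where "koszul_dual K q = {f \<in> closed_forms {0} q. \<forall>w. kills K (\<lambda>x y. f (x, y, w))}"

text \<open>The relations say nothing about words of length other than \<open>p\<close>, on which
  \<open>h\<close> is arbitrary; hence the truncation.\<close>

lemma one_form_of_functional:
  assumes h: "\<And>s. s \<in> V_tensor_Sym_rels scale p \<Longrightarrow> ev h s = 0"
  shows "(\<lambda>(v, w). if length w = p then h (v, w) else 0) \<in> one_forms {0} p" (is "?\<eta> \<in> _")
proof -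
  have rel: "ev (\<lambda>m. h (v, xs @ m @ ys)) r = 0"
    if r: "r \<in> symmetric_rels scale UNIV"
      and deg: "free_mult (free_mult (gen xs) r) (gen ys) \<in> free_on (words UNIV p)" for v xs r ys
  proof -
    have "free_mult (free_mult (gen xs) r) (gen ys) \<in> symmetric_ideal scale UNIV"
      unfolding symmetric_ideal_def by (rule free_ideal_memI[OF subset_UNIV r subset_UNIV])
    hence "tensor (gen v) (free_mult (free_mult (gen xs) r) (gen ys)) \<in> V_tensor_Sym_rels scale p"
      unfolding V_tensor_Sym_rels_def using deg by (intro fvs.span_base) blast
    from h[OF this] show ?thesis by (simp add: ev_tensor ev_free_mult)
  qed
  note free_on_intros = fvs.subspace_diff[OF subspace_free_on] fvs.subspace_scale[OF subspace_free_on]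
  have ideal: "h (v, xs @ a # b # ys) = h (v, xs @ b # a # ys)" if "length (xs @ a # b # ys) = p" for v xs a b ys
  proof -
    have "ev (\<lambda>m. h (v, xs @ m @ ys)) (gen [a, b] - gen [b, a]) = 0"
      using that by (intro rel) (auto simp: symmetric_rels_def words_def intro!: free_on_intros)
    thus ?thesis by (simp add: ev_diff)
  qed
  have lin_head: "h (v, (a + b) # w) = h (v, a # w) + h (v, b # w)" "h (v, (c *s a) # w) = c * h (v, a # w)"
    if "Suc (length w) = p" for v a b c w
  proof -
    have "ev (\<lambda>m. h (v, [] @ m @ w)) (gen [a + b] - gen [a] - gen [b]) = 0"
      using that by (intro rel) (auto simp: symmetric_rels_def linear_rels_def words_def intro!: free_on_intros)
    thus "h (v, (a + b) # w) = h (v, a # w) + h (v, b # w)"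
      by (simp add: ev_diff diff_eq_eq add.commute)
    have "ev (\<lambda>m. h (v, [] @ m @ w)) (gen [c *s a] - fscale c (gen [a])) = 0"
      using that by (intro rel) (auto simp: symmetric_rels_def linear_rels_def words_def intro!: free_on_intros)
    thus "h (v, (c *s a) # w) = c * h (v, a # w)" by (simp add: ev_diff ev_fscale)
  qed
  have lin_v: "h (u + v, w) = h (u, w) + h (v, w)" "h (c *s v, w) = c * h (v, w)" if "length w = p" for u v c w
  proof -
    have w: "w \<in> words UNIV p" using that by (simp add: words_def)
    hence "gen (u + v, w) - gen (u, w) - gen (v, w) \<in> V_tensor_Sym_rels scale p"
      unfolding V_tensor_Sym_rels_def by (intro fvs.span_base) blast
    from h[OF this] show "h (u + v, w) = h (u, w) + h (v, w)"
      by (simp add: ev_diff diff_eq_eq add.commute)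
    have "gen (c *s v, w) - fscale c (gen (v, w)) \<in> V_tensor_Sym_rels scale p"
      unfolding V_tensor_Sym_rels_def using w by (intro fvs.span_base) blast
    from h[OF this] show "h (c *s v, w) = c * h (v, w)" by (simp add: ev_diff ev_fscale)
  qed
  have lin1: "lin (\<lambda>v. ?\<eta> (v, w))" for w
    by (rule linI) (auto simp: lin_v)
  have lin2: "lin (\<lambda>u. ?\<eta> (v, u # w))" for v w
    by (rule linI) (auto simp: lin_head)
  show ?thesis
  proof (intro one_formsI sym_formsI)
    show "?\<eta> (v, w) = ?\<eta> (v, w')" if "mset w = mset w'" for v w w'
    proof (rule mset_invariant_if_adjacent_swap[OF _ that])
      show "?\<eta> (v, xs @ a # b # ys) = ?\<eta> (v, xs @ b # a # ys)" for xs a b ys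
        using ideal by simp
    qed
    show "?\<eta> (v, w) = 0" if "v \<in> {0}" for v w using lin_zero[OF lin1[of w]] that by simp
    show "?\<eta> (u, v # w) = 0" if "v \<in> {0}" for u v w using lin_zero[OF lin2[of u w]] that by simp
  qed (use lin1 lin2 in auto)
qed

lemma one_form_kills_V_tensor_Sym_rels:
  assumes \<eta>: "\<eta> \<in> one_forms L p" and s: "s \<in> V_tensor_Sym_rels scale p"
  shows "ev \<eta> s = 0"
  using s unfolding V_tensor_Sym_rels_def
proof (rule ev_span)
  fix s :: "'v \<times> 'v list \<Rightarrow>\<^sub>0 'k"
  assume "s \<in> {gen (u + v, w) - gen (u, w) - gen (v, w) |u v w. w \<in> words UNIV p} \<union>
    {gen (c *s v, w) - fscale c (gen (v, w)) |c v w. w \<in> words UNIV p} \<union>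
    {tensor (gen v) r |v r. r \<in> symmetric_ideal (*s) UNIV \<inter> free_on (words UNIV p)}"
  thus "ev \<eta> s = 0"
    using lin_add[OF one_formsD(2)[OF \<eta>]] lin_scale[OF one_formsD(2)[OF \<eta>]]
      sym_form_kills_symmetric_ideal[OF one_formsD(1)[OF \<eta>]]
    by (auto simp: ev_diff ev_fscale ev_tensor)
qed

lemma ev_delta2_tensor:
  assumes "\<kappa> \<in> K" "\<And>w. w \<in> Poly_Mapping.keys f \<Longrightarrow> kills K (\<lambda>x y. \<eta> (y, x # w) - \<eta> (x, y # w))"
  shows "ev \<eta> (koszul_delta2 (tensor \<kappa> f)) = 0"
proof -
  have "ev \<eta> (koszul_delta2 (tensor \<kappa> f)) =
      ev (\<lambda>z. ev (\<lambda>w. \<eta> (z ! 1, z ! 0 # w) - \<eta> (z ! 0, z ! 1 # w)) f) \<kappa>"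
    by (simp add: ev_koszul_delta2 ev_tensor)
  also have "\<dots> = ev (\<lambda>w. ev (\<lambda>z. \<eta> (z ! 1, z ! 0 # w) - \<eta> (z ! 0, z ! 1 # w)) \<kappa>) f"
    by (rule ev_swap)
  also have "\<dots> = ev (\<lambda>w. 0) f"
    using assms by (intro ev_cong) (auto simp: kills_def)
  finally show ?thesis by (simp add: ev_def)
qed

lemma subspace_koszul_cycles: "fvs.subspace (koszul_cycles scale q)"
proof -
  have sub: "fvs.subspace (symmetric_ideal scale UNIV)"
    unfolding symmetric_ideal_def free_ideal_def by (rule fvs.subspace_span)
  show ?thesis unfolding koszul_cycles_def koszul_delta1_def
    using fvs.subspace_0[OF sub] fvs.subspace_add[OF sub] fvs.subspace_scale[OF sub]
      fvs.subspace_0[OF subspace_free_on] fvs.subspace_add[OF subspace_free_on] fvs.subspace_scale[OF subspace_free_on]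
    by (intro fvs.subspaceI) (auto simp: lin_ext_add lin_ext_fscale)
qed

text \<open>The image of a generator under \<open>koszul_delta2\<close>. Evaluating a 1-form on
  these cycles gives minus its derivative.\<close>

lemma koszul_delta2_gen_cycle:
  assumes "length w = q"
  shows "gen (y, x # w) - gen (x, y # w) \<in> koszul_cycles scale q"
proof -
  have "gen [y, x] - gen [x, y] \<in> symmetric_rels scale UNIV" by (auto simp: symmetric_rels_def)
  from free_ideal_memI[OF subset_UNIV this subset_UNIV, of "[]" w]
  have "gen (y # x # w) - gen (x # y # w) \<in> symmetric_ideal scale UNIV" by (simp add: symmetric_ideal_def)
  moreover have "gen (y, x # w) - gen (x, y # w) \<in> free_on (UNIV \<times> words UNIV (q + 1))"
    using assms by (intro fvs.subspace_diff[OF subspace_free_on]) (auto simp: words_def)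
  ultimately show ?thesis by (simp add: koszul_cycles_def koszul_delta1_def lin_ext_diff)
qed

lemma subspace_koszul_dual: "functionals.subspace (koszul_dual K q)"
  using functionals.subspace_0[OF subspace_closed_forms] functionals.subspace_add[OF subspace_closed_forms]
    functionals.subspace_scale[OF subspace_closed_forms]
  unfolding koszul_dual_def kills_def
  by (intro functionals.subspaceI) (auto simp: ev_fun_add ev_fun_mult ev_def[of "\<lambda>x. 0"])

text \<open>A basis \<open>D\<close> of \<open>koszul_dual K q\<close> is lifted to 1-forms by the
  Poincare lemma, and these are regarded as functionals on cycles. They vanish on boundaries because
  their derivatives have values in the annihilator, and they are independent because the cycles of
  \<open>koszul_delta2_gen_cycle\<close> recover the derivatives.\<close>

theorem koszul_module_dim_eq_dim_koszul_dual:
  assumes fd: "fin_dim dual_scale (koszul_dual K q)"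
  shows "koszul_module_dim scale K q = functionals.dim (koszul_dual K q)"
proof -
  obtain D where D: "D \<subseteq> koszul_dual K q" "finite D" "\<not> functionals.dependent D"
      "koszul_dual K q \<subseteq> functionals.span D" "card D = functionals.dim (koszul_dual K q)"
    using functionals.fin_dim_basis[OF fd] by blast
  have "\<forall>f\<in>D. \<exists>\<eta>\<in>one_forms {0} (Suc q). ext_deriv \<eta> = f"
    using D(1) poincare by (auto simp: koszul_dual_def)
  then obtain \<eta> where \<eta>: "\<And>f. f \<in> D \<Longrightarrow> \<eta> f \<in> one_forms {0} (Suc q)" "\<And>f. f \<in> D \<Longrightarrow> ext_deriv (\<eta> f) = f"
    by metis
  interpret ed: Vector_Spaces.linear dual_scale dual_scale ext_deriv by (rule linear_ext_deriv)
  define comb where "comb c = (\<Sum>f\<in>D. dual_scale (c f) (\<eta> f))" for c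
  have comb: "comb c \<in> one_forms {0} (Suc q)" for c
    unfolding comb_def using \<eta>(1)
    by (intro functionals.subspace_sum[OF subspace_one_forms] functionals.subspace_scale[OF subspace_one_forms])
  have d_comb: "ext_deriv (comb c) = (\<Sum>f\<in>D. dual_scale (c f) f)" for c
    unfolding comb_def using \<eta>(2) by (simp add: ed.sum ed.scale)
  have ev_comb: "ev (comb c) x = (\<Sum>f\<in>D. c f * ev (\<eta> f) x)" for c x
  proof -
    have "comb c = (\<lambda>t. \<Sum>f\<in>D. c f * \<eta> f t)" by (rule ext) (simp add: comb_def sum_fun_apply)
    thus ?thesis by (simp add: ev_fun_sum ev_fun_mult)
  qed
  let ?G = "koszul_delta2 ` {tensor \<kappa> f | \<kappa> f. \<kappa> \<in> K \<and> f \<in> free_on (words UNIV q)} \<union>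
    V_tensor_Sym_rels scale (q + 1)"
  have vanish: "ev (\<eta> f) x = 0" if f: "f \<in> D" and x: "x \<in> koszul_boundaries scale K q" for f x
    using x unfolding koszul_boundaries_def
  proof (rule ev_span)
    fix s assume "s \<in> ?G"
    then consider \<kappa> g where "s = koszul_delta2 (tensor \<kappa> g)" "\<kappa> \<in> K" | "s \<in> V_tensor_Sym_rels scale (q + 1)"
      by blast
    thus "ev (\<eta> f) s = 0"
    proof cases
      case 1
      have "kills K (\<lambda>x y. f (x, y, w))" for w using f D(1) by (auto simp: koszul_dual_def)
      hence "kills K (\<lambda>x y. - f (x, y, w))" for w by (simp add: kills_def ev_uminus)
      moreover have "- f (x, y, w) = \<eta> f (y, x # w) - \<eta> f (x, y # w)" for x y w
      proof -
        have "f (x, y, w) = ext_deriv (\<eta> f) (x, y, w)" using \<eta>(2)[OF f] by simp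
        thus ?thesis by simp
      qed
      ultimately show ?thesis unfolding 1(1) by (intro ev_delta2_tensor[OF 1(2)]) simp
    next
      case 2
      thus ?thesis using one_form_kills_V_tensor_Sym_rels[OF \<eta>(1)[OF f]] by simp
    qed
  qed
  have indep: "\<forall>f\<in>D. c f = 0" if c: "\<And>x. x \<in> koszul_cycles scale q \<Longrightarrow> (\<Sum>f\<in>D. c f * ev (\<eta> f) x) = 0" for c
  proof -
    have "ext_deriv (comb c) (x, y, w) = 0" for x y w
    proof (cases "length w = q")
      case True
      have "ev (comb c) (gen (y, x # w) - gen (x, y # w)) = 0"
        unfolding ev_comb by (rule c[OF koszul_delta2_gen_cycle[OF True]])
      thus ?thesis by (simp add: ev_diff)
    next
      case False
      thus ?thesis by (rule closed_formsD(6)[OF ext_deriv_closed[OF comb]])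
    qed
    hence "(\<Sum>f\<in>D. dual_scale (c f) f) = 0" unfolding d_comb[symmetric] by (auto simp: fun_eq_iff)
    thus ?thesis using functionals.independentD[OF D(3,2) order_refl] by blast
  qed
  \<comment> \<open>A functional \<open>h\<close> separating \<open>x\<close> from the boundaries
    would be a 1-form with derivative in the span of \<open>D\<close>. It then differs from a
    combination of the lifts by an exact form, which factors through \<open>koszul_delta1\<close>
    and so vanishes on cycles.\<close>
  have sep: "x \<in> koszul_boundaries scale K q"
    if x: "x \<in> koszul_cycles scale q" and x0: "\<And>f. f \<in> D \<Longrightarrow> ev (\<eta> f) x = 0" for x
  proof (rule ccontr)
    assume "x \<notin> koszul_boundaries scale K q"
    hence "\<exists>h. (\<forall>s\<in>?G. ev h s = 0) \<and> ev h x \<noteq> 0"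
      unfolding koszul_boundaries_def by (rule separating_functional)
    then obtain h where hG: "\<forall>s\<in>?G. ev h s = 0" and hx: "ev h x \<noteq> 0" by (elim exE conjE)
    note h = bspec[OF hG] hx
    \<comment> \<open>Cycles involve only words of length \<open>q + 1\<close>, so the truncation
      does not change the value at \<open>x\<close>.\<close>
    define \<theta> where "\<theta> = (\<lambda>(v, w). if length w = q + 1 then h (v, w) else 0)"
    have \<theta>: "\<theta> \<in> one_forms {0} (Suc q)"
      using one_form_of_functional[of "q + 1" h] h(1) by (simp add: \<theta>_def)
    have "kills K (\<lambda>x y. ext_deriv \<theta> (x, y, w))" for w
      unfolding kills_def
    proof
      fix \<kappa> assume \<kappa>: "\<kappa> \<in> K"
      show "ev (\<lambda>z. ext_deriv \<theta> (z ! 0, z ! 1, w)) \<kappa> = 0"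
      proof (cases "length w = q")
        case True
        have "gen w \<in> free_on (words UNIV q)" using True by (simp add: words_def)
          hence "koszul_delta2 (tensor \<kappa> (gen w)) \<in> ?G" using \<kappa> by blast
        from h(1)[OF this] have "ev (\<lambda>z. h (z ! 1, z ! 0 # w) - h (z ! 0, z ! 1 # w)) \<kappa> = 0"
          by (simp add: ev_koszul_delta2 ev_tensor)
        hence "ev (\<lambda>z. - (h (z ! 1, z ! 0 # w) - h (z ! 0, z ! 1 # w))) \<kappa> = 0"
          unfolding ev_uminus by simp
        thus ?thesis using True by (simp add: \<theta>_def)
      next
        case False
        thus ?thesis using closed_formsD(6)[OF ext_deriv_closed[OF \<theta>] False] by (simp add: ev_def)
      qed
    qed
    hence "ext_deriv \<theta> \<in> functionals.span D"
      using D(4) ext_deriv_closed[OF \<theta>] by (auto simp: koszul_dual_def)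
    then obtain c where c: "ext_deriv \<theta> = (\<Sum>f\<in>D. dual_scale (c f) f)"
      unfolding functionals.span_finite[OF D(2)] by blast
    have "ext_deriv (\<theta> - comb c) = 0" by (simp add: ed.diff d_comb c)
    moreover have "\<theta> - comb c \<in> one_forms {0} (Suc q)"
      by (rule functionals.subspace_diff[OF subspace_one_forms \<theta> comb])
    ultimately obtain g where g: "g \<in> sym_forms {0} (Suc (Suc q))" "\<theta> - comb c = (\<lambda>(v, w). g (v # w))"
      using ext_deriv_eq_0_iff by blast
    have "ev (\<theta> - comb c) x = ev g (koszul_delta1 x)" by (simp add: g(2) ev_koszul_delta1)
    also have "\<dots> = 0" using x sym_form_kills_symmetric_ideal[OF g(1)] by (simp add: koszul_cycles_def)
    finally have "ev \<theta> x = ev (comb c) x" by (simp add: fun_diff_def ev_fun_diff)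
    also have "\<dots> = 0" unfolding ev_comb using x0 by (intro sum.neutral) auto
    also have "ev \<theta> x = ev h x"
      using x by (intro ev_cong) (auto simp: koszul_cycles_def free_on_def words_def \<theta>_def)
    finally show False using h(2) by simp
  qed
  define F where "F f = ev (\<eta> f)" for f
  have "fvs.subspace (koszul_boundaries scale K q)"
    unfolding koszul_boundaries_def by (rule fvs.subspace_span)
  hence "quotient_dim (koszul_cycles scale q) (koszul_boundaries scale K q) = card D"
  proof (rule quotient_dim_eq_card_functionals[of _ _ D F, OF subspace_koszul_cycles _ D(2)])
    show "Vector_Spaces.linear fscale (*) (F f)" for f unfolding F_def by (rule linear_ev)
    show "F f x = 0" if "f \<in> D" "x \<in> koszul_boundaries scale K q" for f x
      unfolding F_def by (rule vanish[OF that])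
    show "x \<in> koszul_boundaries scale K q"
      if "x \<in> koszul_cycles scale q" "\<And>f. f \<in> D \<Longrightarrow> F f x = 0" for x
      using that unfolding F_def by (rule sep)
    show "\<forall>f\<in>D. c f = 0" if "\<And>x. x \<in> koszul_cycles scale q \<Longrightarrow> (\<Sum>f\<in>D. c f * F f x) = 0" for c
      using that unfolding F_def by (rule indep)
  qed
  thus ?thesis using D(5) by (simp add: koszul_module_dim_def)
qed

end

section \<open>Closed forms in high degree\<close>

context koszul_space
begin

lemma dual_basis_exists:
  assumes "functionals.subspace U" "U \<subseteq> dual_space scale"
  obtains B e where "dual_basis scale Basis U B e"
proof -
  obtain B e where B: "finite B" "B \<subseteq> U" "card B = functionals.dim U" "U \<subseteq> functionals.span B"
    "\<And>b c. b \<in> B \<Longrightarrow> c \<in> B \<Longrightarrow> b (e c) = (if b = c then 1 else 0)"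
    using dual_basis_relative[OF assms subspace_UNIV] by (auto simp: fun_eq_iff)
  have "dual_basis scale Basis U B e"
    by unfold_locales (fact assms B)+
  thus thesis by (rule that)
qed

lemma mem_iff_kills_perp:
  assumes "functionals.subspace U" "U \<subseteq> dual_space scale" "lin a"
  shows "a \<in> U \<longleftrightarrow> (\<forall>v\<in>perp U. a v = 0)"
proof
  show "a \<in> U \<Longrightarrow> \<forall>v\<in>perp U. a v = 0" by (simp add: perp_def)
  assume a: "\<forall>v\<in>perp U. a v = 0"
  obtain B e where "dual_basis scale Basis U B e" by (rule dual_basis_exists[OF assms(1,2)])
  then interpret dual_basis scale Basis U B e .
  show "a \<in> U" using mem_if_kills_perp[OF assms(3)] a by blast
qed

text \<open>\<open>V\<close> is the sum of \<open>perp U\<close> and \<open>perp U'\<close>: as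
  \<open>U\<close> meets \<open>U'\<close> only in 0, its elements are still separated by
  \<open>perp U'\<close>, so the dual vectors of a basis of \<open>U\<close> can be taken
  there.\<close>

lemma perp_decompose:
  assumes U: "functionals.subspace U" "U \<subseteq> dual_space scale"
    and U': "functionals.subspace U'" "U' \<subseteq> dual_space scale" and disj: "U \<inter> U' = {0}"
  obtains v where "v \<in> perp U" "x - v \<in> perp U'"
proof -
  have sep: "u = 0" if "u \<in> U" "\<And>x. x \<in> perp U' \<Longrightarrow> u x = 0" for u
  proof -
    have "lin u" using that(1) U(2) mem_dual_space_iff by blast
    hence "u \<in> U'" using mem_iff_kills_perp[OF U'] that(2) by blast
    thus ?thesis using that(1) disj by blast
  qed
  obtain B e where B: "finite B" "B \<subseteq> U" "card B = functionals.dim U" "U \<subseteq> functionals.span B"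
    and eU': "\<And>b. b \<in> B \<Longrightarrow> e b \<in> perp U'"
    and e: "\<And>b c. b \<in> B \<Longrightarrow> c \<in> B \<Longrightarrow> b (e c) = (if b = c then 1 else 0)"
  proof (rule dual_basis_relative[OF U subspace_perp[OF U'(2)]])
    show "u = 0" if "u \<in> U" "\<And>x. x \<in> perp U' \<Longrightarrow> u x = 0" for u using that by (rule sep)
  qed (rule that)
  interpret dual_basis scale Basis U B e
    by unfold_locales (fact U B e)+
  let ?y = "\<Sum>b\<in>B. b x *s e b"
  have "?y \<in> perp U'"
    using eU' by (intro subspace_sum subspace_scale subspace_perp[OF U'(2)])
  hence "x - (x - ?y) \<in> perp U'" by simp
  thus thesis using that remainder_in_perp by blast
qed

lemma
  assumes "functionals.subspace U" "U \<subseteq> dual_space scale"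
  shows dim_closed_forms_perp:
    "functionals.dim (closed_forms (perp U) q) = (q + 1) * ((q + functionals.dim U) choose (q + 2))"
    and fin_dim_closed_forms_perp: "fin_dim dual_scale (closed_forms (perp U) q)"
proof -
  obtain B e where "dual_basis scale Basis U B e" by (rule dual_basis_exists[OF assms])
  then interpret dual_basis scale Basis U B e .
  show "functionals.dim (closed_forms (perp U) q) = (q + 1) * ((q + functionals.dim U) choose (q + 2))"
    "fin_dim dual_scale (closed_forms (perp U) q)" by (rule dim_closed_forms)+
qed

lemma fin_dim_closed_forms: "fin_dim dual_scale (closed_forms {0} q)"
proof -
  have "v = 0" if "v \<in> perp (dual_space scale)" for v
  proof -
    have v: "v \<in> span Basis" by (simp add: span_Basis)
    have "representation Basis v b = 0" for b
    proof -
      have "lin (\<lambda>x. representation Basis x b)"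
        using representation_add[OF independent_Basis] representation_scale[OF independent_Basis]
        by (intro linI) (simp_all add: span_Basis)
      thus ?thesis using that by (auto simp: perp_def mem_dual_space_iff)
    qed
    thus ?thesis using sum_representation_eq[OF independent_Basis v finite_Basis order_refl] by simp
  qed
  hence "closed_forms {0} q \<subseteq> closed_forms (perp (dual_space scale)) q"
    by (intro closed_forms_mono) blast
  thus ?thesis
    using functionals.fin_dim_subset[OF fin_dim_closed_forms_perp[OF subspace_dual_space order_refl]] by blast
qed

lemma contract_zero_vector: "f \<in> closed_forms L p \<Longrightarrow> contract 0 f = 0"
  using lin_zero[OF closed_formsD(8)] by (auto simp: fun_eq_iff)

end

text \<open>The properties of the components on which the rest depends. A form vanishing on pairs
  from \<open>perp U\<close> has its values in the ideal generated by \<open>U\<close>, so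
  \<open>strongly_isotropic\<close> is strong isotropy for values of forms; \<open>resonant\<close>
  says that the family covers the resonance variety.\<close>

locale isotropic_family = koszul_space +
  fixes K :: "('b list \<Rightarrow>\<^sub>0 'a) set" and \<U> :: "('b \<Rightarrow> 'a) set set"
  assumes finite_family: "finite \<U>"
    and subspace_family: "U \<in> \<U> \<Longrightarrow> functionals.subspace U" "U \<in> \<U> \<Longrightarrow> U \<subseteq> dual_space scale"
    and isotropic: "U \<in> \<U> \<Longrightarrow> f \<in> closed_forms (perp U) q \<Longrightarrow> kills K (\<lambda>x y. f (x, y, w))"
    and strongly_isotropic: "U \<in> \<U> \<Longrightarrow> f \<in> koszul_dual K q \<Longrightarrow>
      (\<And>x y. x \<in> perp U \<Longrightarrow> y \<in> perp U \<Longrightarrow> f (x, y, w) = 0) \<Longrightarrow> x \<in> perp U \<Longrightarrow> f (x, y, w) = 0"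
    and disjoint: "U \<in> \<U> \<Longrightarrow> U' \<in> \<U> \<Longrightarrow> U \<noteq> U' \<Longrightarrow> U \<inter> U' = {0}"
    and resonant: "lin a \<Longrightarrow> lin b \<Longrightarrow> kills K (\<lambda>x y. a x * b y - a y * b x) \<Longrightarrow>
      a x * b y - a y * b x \<noteq> 0 \<Longrightarrow> \<exists>U\<in>\<U>. a \<in> U"
begin

text \<open>For \<open>S = \<U>\<close> this is \<open>C\<^sub>q\<close>; subfamilies occur in the
  induction that counts dimensions.\<close>

definition sum_forms :: "('b \<Rightarrow> 'a) set set \<Rightarrow> nat \<Rightarrow> ('b \<times> 'b \<times> 'b list \<Rightarrow> 'a) set"
  where "sum_forms S q = {\<Sum>U\<in>S. g U | g. \<forall>U\<in>S. g U \<in> closed_forms (perp U) q}"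

lemma sum_formsI: "(\<And>U. U \<in> S \<Longrightarrow> g U \<in> closed_forms (perp U) q) \<Longrightarrow> (\<Sum>U\<in>S. g U) \<in> sum_forms S q"
  unfolding sum_forms_def by blast

lemma subspace_sum_forms: "functionals.subspace (sum_forms S q)"
proof (rule functionals.subspaceI)
  have "(\<Sum>U\<in>S. 0) \<in> sum_forms S q"
    by (intro sum_formsI functionals.subspace_0[OF subspace_closed_forms])
  thus "0 \<in> sum_forms S q" by simp
  show "f + f' \<in> sum_forms S q" if ff': "f \<in> sum_forms S q" "f' \<in> sum_forms S q" for f f'
  proof -
    obtain g g' where g: "f = (\<Sum>U\<in>S. g U)" "\<forall>U\<in>S. g U \<in> closed_forms (perp U) q"
      "f' = (\<Sum>U\<in>S. g' U)" "\<forall>U\<in>S. g' U \<in> closed_forms (perp U) q"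
      using ff' unfolding sum_forms_def by auto
    have "(\<Sum>U\<in>S. g U + g' U) \<in> sum_forms S q"
      using g(2,4) by (intro sum_formsI functionals.subspace_add[OF subspace_closed_forms]) auto
    thus ?thesis by (simp add: g(1,3) sum.distrib)
  qed
  show "dual_scale c f \<in> sum_forms S q" if f: "f \<in> sum_forms S q" for c f
  proof -
    obtain g where g: "f = (\<Sum>U\<in>S. g U)" "\<forall>U\<in>S. g U \<in> closed_forms (perp U) q"
      using f unfolding sum_forms_def by auto
    have "(\<Sum>U\<in>S. dual_scale c (g U)) \<in> sum_forms S q"
      using g(2) by (intro sum_formsI functionals.subspace_scale[OF subspace_closed_forms]) auto
    thus ?thesis by (simp add: g(1) functionals.scale_sum_right)
  qed
qed

lemma contract_sum_forms:
  assumes "f \<in> sum_forms S (Suc q)"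
  shows "contract v f \<in> sum_forms S q"
proof -
  obtain g where g: "f = (\<Sum>U\<in>S. g U)" "\<forall>U\<in>S. g U \<in> closed_forms (perp U) (Suc q)"
    using assms unfolding sum_forms_def by auto
  have "(\<Sum>U\<in>S. contract v (g U)) \<in> sum_forms S q"
    using g(2) by (intro sum_formsI contract_closed_forms) auto
  thus ?thesis by (simp add: g(1) contract_sum)
qed

lemma closed_forms_perp_subset: "U \<in> \<U> \<Longrightarrow> closed_forms (perp U) q \<subseteq> koszul_dual K q"
proof
  fix f assume U: "U \<in> \<U>" and f: "f \<in> closed_forms (perp U) q"
  have "{0} \<subseteq> perp U" using subspace_0[OF subspace_perp[OF subspace_family(2)[OF U]]] by simp
  hence "f \<in> closed_forms {0} q" using closed_forms_mono f by blast
  thus "f \<in> koszul_dual K q" using isotropic[OF U f] by (simp add: koszul_dual_def)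
qed

lemma sum_forms_subset: "sum_forms \<U> q \<subseteq> koszul_dual K q"
proof
  fix f assume "f \<in> sum_forms \<U> q"
  then obtain g where g: "f = (\<Sum>U\<in>\<U>. g U)" "\<forall>U\<in>\<U>. g U \<in> closed_forms (perp U) q"
    unfolding sum_forms_def by auto
  show "f \<in> koszul_dual K q"
    unfolding g(1) using g(2) closed_forms_perp_subset by (intro functionals.subspace_sum[OF subspace_koszul_dual]) auto
qed

text \<open>Contraction with a vector of \<open>perp U1\<close> kills the summand in
  \<open>U1\<close> and lowers the degree by 1, and contraction with a vector of
  \<open>perp U\<close> kills \<open>f\<close>; these vectors together span \<open>V\<close>. So it
  suffices that \<open>q\<close> is at least the number of other components involved.\<close>

lemma form_eq_0_if_in_other_components:
  assumes "finite S" "U \<in> \<U>" "S \<subseteq> \<U> - {U}" "card S \<le> q"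
    and "f \<in> closed_forms (perp U) q" "f = (\<Sum>U'\<in>S. g U')" "\<And>U'. U' \<in> S \<Longrightarrow> g U' \<in> closed_forms (perp U') q"
  shows "f = 0"
  using assms(1,3-)
proof (induction S arbitrary: q f g rule: finite_induct)
  case (insert U1 S)
  obtain q' where q: "q = Suc q'" "card S \<le> q'" using insert.prems(2) insert.hyps by (cases q) auto
  have f: "f \<in> closed_forms (perp U) (Suc q')" using insert.prems(3) q by simp
  have U1: "U1 \<in> \<U>" "U1 \<noteq> U" using insert.prems(1) by auto
  show ?case
  proof (rule closed_form_eq_0_if_contractions[OF f])
    fix x
    obtain v where v: "v \<in> perp U1" "x - v \<in> perp U"
      using perp_decompose[OF subspace_family[OF U1(1)] subspace_family[OF assms(2)] disjoint[OF U1(1) assms(2) U1(2)]] .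
    have "contract v f = contract v (g U1) + (\<Sum>U'\<in>S. contract v (g U'))"
      unfolding insert.prems(4) contract_sum by (rule sum.insert[OF insert.hyps])
    also have "contract v (g U1) = 0" using insert.prems(5)[of U1] v(1) by (intro contract_kills) auto
    finally have sum: "contract v f = (\<Sum>U'\<in>S. contract v (g U'))" by simp
    have "contract v f = 0"
    proof (rule insert.IH[OF _ q(2) contract_closed_forms[OF f] sum])
      show "S \<subseteq> \<U> - {U}" using insert.prems(1) by blast
      show "contract v (g U') \<in> closed_forms (perp U') q'" if "U' \<in> S" for U'
        using insert.prems(5)[of U'] that q(1) by (intro contract_closed_forms) simp
    qed
    moreover have "contract (x - v) f = 0" by (rule contract_kills[OF f v(2)])
    ultimately show "contract x f = 0" using contract_add_vector[OF f, of v "x - v"] by simp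
  qed
qed simp

lemma sum_forms_direct:
  assumes "card \<U> \<le> q" "\<And>U. U \<in> \<U> \<Longrightarrow> g U \<in> closed_forms (perp U) q" "(\<Sum>U\<in>\<U>. g U) = 0" "U \<in> \<U>"
  shows "g U = 0"
proof (rule form_eq_0_if_in_other_components[where g = "\<lambda>U'. - g U'" and S = "\<U> - {U}" and U = U])
  show "finite (\<U> - {U})" "card (\<U> - {U}) \<le> q"
    using finite_family assms(1) card_Diff1_le[of \<U> U] by auto
  have "g U + (\<Sum>U'\<in>\<U> - {U}. g U') = 0"
    using assms(3) sum.remove[OF finite_family assms(4), of g] by metis
  thus "g U = (\<Sum>U'\<in>\<U> - {U}. - g U')" unfolding sum_negf by (rule eq_neg_iff_add_eq_0[THEN iffD2])
  show "- g U' \<in> closed_forms (perp U') q" if "U' \<in> \<U> - {U}" for U'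
    using assms(2) that by (intro functionals.subspace_neg[OF subspace_closed_forms]) auto
qed (use assms(2,4) in auto)

lemma sum_forms_unique:
  assumes "card \<U> \<le> q" "\<And>U. U \<in> \<U> \<Longrightarrow> g U \<in> closed_forms (perp U) q"
    "\<And>U. U \<in> \<U> \<Longrightarrow> g' U \<in> closed_forms (perp U) q" "(\<Sum>U\<in>\<U>. g U) = (\<Sum>U\<in>\<U>. g' U)" "U \<in> \<U>"
  shows "g U = g' U"
proof -
  have "g U - g' U = 0"
  proof (rule sum_forms_direct[where g = "\<lambda>U. g U - g' U", OF assms(1) _ _ assms(5)])
    show "g U - g' U \<in> closed_forms (perp U) q" if "U \<in> \<U>" for U
      using assms(2,3)[OF that] by (rule functionals.subspace_diff[OF subspace_closed_forms])
    show "(\<Sum>U\<in>\<U>. g U - g' U) = 0" by (simp add: sum_subtractf assms(4))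
  qed
  thus ?thesis by simp
qed

text \<open>The components of \<open>contract v f\<close> are unique, so they inherit linearity in
  \<open>v\<close> and commuting second contractions from \<open>f\<close> and can be integrated one
  by one. Second contractions live in degree \<open>q\<close>, which explains the bound and the
  degree of \<open>f\<close>. This yields the injectivity hypothesis of
  \<open>graded_common_eigenvector\<close> for \<open>D\<^sub>q / C\<^sub>q\<close>.\<close>

lemma sum_forms_glue:
  assumes q: "card \<U> \<le> q" and f: "f \<in> closed_forms {0} (Suc (Suc q))"
    and "\<And>v. contract v f \<in> sum_forms \<U> (Suc q)"
  shows "f \<in> sum_forms \<U> (Suc (Suc q))"
proof -
  have "\<forall>v. \<exists>g. contract v f = (\<Sum>U\<in>\<U>. g U) \<and> (\<forall>U\<in>\<U>. g U \<in> closed_forms (perp U) (Suc q))"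
    using assms(3) unfolding sum_forms_def by auto
  then obtain G where G: "\<And>v. contract v f = (\<Sum>U\<in>\<U>. G v U)"
      "\<And>v U. U \<in> \<U> \<Longrightarrow> G v U \<in> closed_forms (perp U) (Suc q)" by metis
  have "\<exists>g\<in>closed_forms (perp U) (Suc (Suc q)). \<forall>v. contract v g = G v U" if U: "U \<in> \<U>" for U
  proof (rule closed_form_with_contractions[where G = "\<lambda>v. G v U"])
    show "G v U \<in> closed_forms (perp U) (Suc q)" for v by (rule G(2)[OF U])
    show "G (u + v) U = G u U + G v U" for u v
    proof (rule sum_forms_unique[where g = "G (u + v)" and g' = "\<lambda>U. G u U + G v U" and q = "Suc q", OF _ _ _ _ U])
      show "(\<Sum>U\<in>\<U>. G (u + v) U) = (\<Sum>U\<in>\<U>. G u U + G v U)"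
        using contract_add_vector[OF f, of u v] by (simp only: G(1) sum.distrib)
    qed (use q G(2) functionals.subspace_add[OF subspace_closed_forms] in auto)
    show "G (c *s v) U = dual_scale c (G v U)" for c v
    proof (rule sum_forms_unique[where g = "G (c *s v)" and g' = "\<lambda>U. dual_scale c (G v U)" and q = "Suc q", OF _ _ _ _ U])
      show "(\<Sum>U\<in>\<U>. G (c *s v) U) = (\<Sum>U\<in>\<U>. dual_scale c (G v U))"
        using contract_scale_vector[OF f, of c v] by (simp only: G(1) functionals.scale_sum_right)
    qed (use q G(2) functionals.subspace_scale[OF subspace_closed_forms] in auto)
    show "contract u (G v U) = contract v (G u U)" for u v
    proof (rule sum_forms_unique[where g = "\<lambda>U. contract u (G v U)" and g' = "\<lambda>U. contract v (G u U)", OF q _ _ _ U])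
      show "(\<Sum>U\<in>\<U>. contract u (G v U)) = (\<Sum>U\<in>\<U>. contract v (G u U))"
        using contract_commute[OF f, of u v] by (simp only: G(1) contract_sum)
    qed (use G(2) contract_closed_forms in auto)
  qed
  then obtain g where g: "\<And>U. U \<in> \<U> \<Longrightarrow> g U \<in> closed_forms (perp U) (Suc (Suc q))"
      "\<And>U v. U \<in> \<U> \<Longrightarrow> contract v (g U) = G v U" by metis
  have mem: "(\<Sum>U\<in>\<U>. g U) \<in> sum_forms \<U> (Suc (Suc q))" using g(1) by (rule sum_formsI)
  have "(\<Sum>U\<in>\<U>. g U) \<in> closed_forms {0} (Suc (Suc q))"
    using mem sum_forms_subset by (auto simp: koszul_dual_def)
  hence diff: "f - (\<Sum>U\<in>\<U>. g U) \<in> closed_forms {0} (Suc (Suc q))"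
    by (rule functionals.subspace_diff[OF subspace_closed_forms f])
  have "f - (\<Sum>U\<in>\<U>. g U) = 0"
  proof (rule closed_form_eq_0_if_contractions[OF diff])
    show "contract v (f - (\<Sum>U\<in>\<U>. g U)) = 0" for v
    proof -
      have "contract v (\<Sum>U\<in>\<U>. g U) = contract v f"
        unfolding contract_sum G(1) using g(2) by (intro sum.cong) auto
      thus ?thesis by (simp only: contract_linear(2)) simp
    qed
  qed
  thus ?thesis using mem by simp
qed

lemma no_eigenfamily_modulo_sum_forms:
  assumes a: "lin a" "a e0 \<noteq> 0" and "card \<U> \<le> q1"
    and f: "\<And>q. q \<ge> q1 \<Longrightarrow> f q \<in> koszul_dual K q" "\<And>q. q \<ge> q1 \<Longrightarrow> f q \<notin> sum_forms \<U> q"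
      "\<And>q v. q \<ge> q1 \<Longrightarrow> contract v (f (Suc q)) - dual_scale (a v) (f q) \<in> sum_forms \<U> q"
  shows False
proof -
  have f_closed: "f q \<in> closed_forms {0} q" if "q \<ge> q1" for q
    using f(1)[OF that] by (simp add: koszul_dual_def)
  have "\<forall>q v. \<exists>g. q \<ge> q1 \<longrightarrow> contract v (f (Suc q)) - dual_scale (a v) (f q) = (\<Sum>U\<in>\<U>. g U) \<and>
      (\<forall>U\<in>\<U>. g U \<in> closed_forms (perp U) q)"
    using f(3) unfolding sum_forms_def by auto
  then obtain c where c: "\<And>q v. q \<ge> q1 \<Longrightarrow> contract v (f (Suc q)) - dual_scale (a v) (f q) = (\<Sum>U\<in>\<U>. c q v U)"
      "\<And>q v U. q \<ge> q1 \<Longrightarrow> U \<in> \<U> \<Longrightarrow> c q v U \<in> closed_forms (perp U) q"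
    by metis
  \<comment> \<open>Contractions commute, and the components of the error are unique, so the error
    satisfies a cocycle identity in each component separately.\<close>
  have comm: "contract w (c (Suc q) v U) - dual_scale (a w) (c q v U) =
      contract v (c (Suc q) w U) - dual_scale (a v) (c q w U)" if q: "q \<ge> q1" and U: "U \<in> \<U>" for q v w U
  proof (rule sum_forms_unique[where g = "\<lambda>U. contract w (c (Suc q) v U) - dual_scale (a w) (c q v U)"
        and g' = "\<lambda>U. contract v (c (Suc q) w U) - dual_scale (a v) (c q w U)" and q = q, OF _ _ _ _ U])
    show "card \<U> \<le> q" using assms(3) q by simp
    have mem: "contract w (c (Suc q) v U) - dual_scale (a w) (c q v U) \<in> closed_forms (perp U) q"
      if "U \<in> \<U>" for v w U
      using c(2)[OF _ that] q
      by (intro functionals.subspace_diff[OF subspace_closed_forms] contract_closed_forms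
          functionals.subspace_scale[OF subspace_closed_forms]) auto
    show "contract w (c (Suc q) v U) - dual_scale (a w) (c q v U) \<in> closed_forms (perp U) q"
      "contract v (c (Suc q) w U) - dual_scale (a v) (c q w U) \<in> closed_forms (perp U) q" if "U \<in> \<U>" for U
      using mem[OF that] by blast+
    have sum: "(\<Sum>U\<in>\<U>. contract w (c (Suc q) v U) - dual_scale (a w) (c q v U)) =
        contract w (contract v (f (Suc (Suc q)))) - dual_scale (a v) (contract w (f (Suc q)))
        - dual_scale (a w) (contract v (f (Suc q))) + dual_scale (a w * a v) (f q)" for v w
    proof -
      have "(\<Sum>U\<in>\<U>. contract w (c (Suc q) v U) - dual_scale (a w) (c q v U)) =
          contract w (\<Sum>U\<in>\<U>. c (Suc q) v U) - dual_scale (a w) (\<Sum>U\<in>\<U>. c q v U)"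
        by (simp only: sum_subtractf contract_sum functionals.scale_sum_right)
      also have "(\<Sum>U\<in>\<U>. c (Suc q) v U) = contract v (f (Suc (Suc q))) - dual_scale (a v) (f (Suc q))"
        using c(1)[of "Suc q" v] q by simp
      also have "(\<Sum>U\<in>\<U>. c q v U) = contract v (f (Suc q)) - dual_scale (a v) (f q)"
        using c(1)[OF q, of v] by simp
      finally show ?thesis
        by (simp only: contract_linear functionals.scale_right_diff_distrib functionals.scale_scale
            diff_diff_eq2 diff_add_eq)
    qed
    have "contract w (contract v (f (Suc (Suc q)))) = contract v (contract w (f (Suc (Suc q))))"
      using f_closed[of "Suc (Suc q)"] q by (intro contract_commute) auto
    thus "(\<Sum>U\<in>\<U>. contract w (c (Suc q) v U) - dual_scale (a w) (c q v U)) =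
        (\<Sum>U\<in>\<U>. contract v (c (Suc q) w U) - dual_scale (a v) (c q w U))"
      unfolding sum by (simp add: mult.commute)
  qed
  define S where "S = {U\<in>\<U>. a \<notin> U}"
  have "\<forall>U\<in>S. \<exists>v\<in>perp U. a v = 1"
  proof
    fix U assume "U \<in> S"
    hence U: "U \<in> \<U>" "a \<notin> U" by (auto simp: S_def)
    then obtain v where v: "v \<in> perp U" "a v \<noteq> 0"
      using mem_iff_kills_perp[OF subspace_family[OF U(1)] a(1)] by blast
    hence "inverse (a v) *s v \<in> perp U" "a (inverse (a v) *s v) = 1"
      using subspace_scale[OF subspace_perp[OF subspace_family(2)[OF U(1)]]] lin_scale[OF a(1)] by auto
    thus "\<exists>v\<in>perp U. a v = 1" by blast
  qed
  then obtain n where n: "\<And>U. U \<in> S \<Longrightarrow> n U \<in> perp U" "\<And>U. U \<in> S \<Longrightarrow> a (n U) = 1" by metis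
  \<comment> \<open>Since \<open>n U\<close> kills the component \<open>U\<close> and
    \<open>a (n U) = 1\<close>, the cocycle identity with \<open>v = n U\<close> exhibits the error
    in \<open>U\<close> as minus the coboundary of \<open>c q (n U) U\<close>; adding
    \<open>z\<close> to \<open>f\<close> cancels it.\<close>
  define z where "z q = (\<Sum>U\<in>S. c q (n U) U)" for q
  have SU: "S \<subseteq> \<U>" by (auto simp: S_def)
  have z: "z q \<in> sum_forms \<U> q" if "q \<ge> q1" for q
  proof -
    have "(\<Sum>U\<in>\<U>. if U \<in> S then c q (n U) U else 0) \<in> sum_forms \<U> q"
      using c(2)[OF that] functionals.subspace_0[OF subspace_closed_forms] by (intro sum_formsI) auto
    moreover have "(\<Sum>U\<in>\<U>. if U \<in> S then c q (n U) U else 0) = z q"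
      unfolding z_def using SU finite_family by (simp add: sum.inter_restrict[symmetric] Int_absorb1)
    ultimately show ?thesis by simp
  qed
  define h where "h q = f q + z q" for q
  have h_not: "h q \<notin> sum_forms \<U> q" if "q \<ge> q1" for q
  proof
    assume "h q \<in> sum_forms \<U> q"
    hence "h q - z q \<in> sum_forms \<U> q" using z[OF that] by (rule functionals.subspace_diff[OF subspace_sum_forms])
    thus False using f(2)[OF that] by (simp add: h_def)
  qed
  have h_dual: "h q \<in> koszul_dual K q" if "q \<ge> q1" for q
    unfolding h_def using f(1)[OF that] z[OF that] sum_forms_subset
    by (intro functionals.subspace_add[OF subspace_koszul_dual]) auto
  have h_closed: "h q \<in> closed_forms {0} q" if "q \<ge> q1" for q
    using h_dual[OF that] by (simp add: koszul_dual_def)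
  have h_contract: "contract w (h (Suc q)) = dual_scale (a w) (h q) + (\<Sum>U\<in>\<U> - S. c q w U)" if q: "q \<ge> q1" for q w
  proof -
    have "contract w (c (Suc q) (n U) U) - dual_scale (a w) (c q (n U) U) = - c q w U" if U: "U \<in> S" for U
    proof -
      have "c (Suc q) w U \<in> closed_forms (perp U) (Suc q)" using c(2) q U SU by auto
      hence "contract (n U) (c (Suc q) w U) = 0" using n(1)[OF U] by (rule contract_kills)
      thus ?thesis using comm[OF q, of U w "n U"] U SU n(2)[OF U] by auto
    qed
    hence "contract w (z (Suc q)) - dual_scale (a w) (z q) = (\<Sum>U\<in>S. - c q w U)"
      unfolding z_def contract_sum functionals.scale_sum_right sum_subtractf[symmetric]
      by (intro sum.cong) auto
    moreover have "(\<Sum>U\<in>\<U>. c q w U) = (\<Sum>U\<in>\<U> - S. c q w U) + (\<Sum>U\<in>S. c q w U)"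
      by (rule sum.subset_diff[OF SU finite_family])
    ultimately have "contract w (h (Suc q)) - dual_scale (a w) (h q) = (\<Sum>U\<in>\<U> - S. c q w U)"
      using c(1)[OF q, of w] unfolding h_def contract_linear functionals.scale_right_distrib sum_negf
      by (simp add: algebra_simps)
    thus ?thesis by (simp add: diff_eq_eq add.commute)
  qed
  define e where "e = inverse (a e0) *s e0"
  have ae: "a e = 1" using a lin_scale[OF a(1)] by (simp add: e_def)
  show False
  proof (cases "\<U> - S = {}")
    case True
    have eig: "h (Suc q1) (x, y, v # w) = a v * h q1 (x, y, w)" for x y v w
      using fun_cong[OF h_contract[OF order_refl, of v], of "(x, y, w)"] True by simp
    have "h q1 \<noteq> 0"
      using h_not[OF order_refl] functionals.subspace_0[OF subspace_sum_forms] by metis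
    then obtain x0 y0 w where nz: "h q1 (x0, y0, w) \<noteq> 0" by (metis ext prod_cases3 zero_fun_apply)
    \<comment> \<open>Closedness with third argument \<open>e\<close>, where \<open>a e = 1\<close>,
      expresses \<open>h q1\<close> for the fixed word \<open>w\<close> as the wedge product of
      \<open>a\<close> and \<open>b\<close>.\<close>
    define b where "b = (\<lambda>y. h q1 (e, y, w))"
    have h_eq: "h q1 (x, y, w) = a x * b y - a y * b x" for x y
    proof -
      have "a e * h q1 (x, y, w) + a x * h q1 (y, e, w) + a y * h q1 (e, x, w) = 0"
        using closed_formsD(5)[OF h_closed[of "Suc q1"], of x y e w] by (simp add: eig)
      moreover have "h q1 (y, e, w) = - b y" unfolding b_def by (rule closed_formsD(3)[OF h_closed[OF order_refl]])
      ultimately have "h q1 (x, y, w) + (a y * b x - a x * b y) = 0"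
        by (simp add: ae b_def algebra_simps)
      thus ?thesis by (simp add: eq_neg_iff_add_eq_0[symmetric])
    qed
    have "kills K (\<lambda>x y. a x * b y - a y * b x)"
      using h_dual[OF order_refl] unfolding h_eq[symmetric] by (simp add: koszul_dual_def)
    moreover have "lin b" unfolding b_def by (rule closed_forms_lin2[OF h_closed[OF order_refl]])
    ultimately obtain U where "U \<in> \<U>" "a \<in> U" using resonant[OF a(1), of b x0 y0] nz h_eq by metis
    thus False using True by (auto simp: S_def)
  next
    case False
    then obtain U where U: "U \<in> \<U>" "a \<in> U" by (auto simp: S_def)
    have uniq: "U' = U" if "U' \<in> \<U>" "a \<in> U'" for U'
    proof (rule ccontr)
      assume "U' \<noteq> U"
      hence "a = 0" using disjoint[OF that(1) U(1)] that(2) U(2) by blast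
      thus False using a(2) by simp
    qed
    have US: "\<U> - S = {U}"
    proof (intro equalityI subsetI)
      fix U' assume "U' \<in> \<U> - S"
      thus "U' \<in> {U}" using uniq[of U'] by (simp add: S_def)
    qed (use U in \<open>simp add: S_def\<close>)
    have eig: "h (Suc q) (x, y, v # w) = a v * h q (x, y, w) + c q v U (x, y, w)" if "q \<ge> q1" for q x y v w
      using fun_cong[OF h_contract[OF that, of v], of "(x, y, w)"] US by simp
    have aU: "a v = 0" if "v \<in> perp U" for v using that U(2) by (simp add: perp_def)
    \<comment> \<open>In the closedness relation for \<open>x\<close>, \<open>y\<close>,
      \<open>e\<close> in degree \<open>q1 + 1\<close>, the factors \<open>a x\<close> and
      \<open>a y\<close> vanish, and so do the error terms, being pulled back from the quotient by
      \<open>perp U\<close>; only \<open>h q1 (x, y, w)\<close> survives.\<close>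
    have van: "h q1 (x, y, w) = 0" if x: "x \<in> perp U" and y: "y \<in> perp U" for x y w
    proof -
      note cU = c(2)[OF order_refl U(1)]
      have "h (Suc q1) (x, y, e # w) + h (Suc q1) (y, e, x # w) + h (Suc q1) (e, x, y # w) = 0"
        by (rule closed_formsD(5)[OF h_closed]) simp
      thus ?thesis
        using closed_formsD(4)[OF cU x] closed_formsD(4)[OF cU y] closed_forms_kills2[OF cU x]
        by (simp add: eig aU[OF x] aU[OF y] ae)
    qed
    have van1: "h q1 (x, y, w) = 0" if "x \<in> perp U" for x y w
      by (rule strongly_isotropic[OF U(1) h_dual[OF order_refl] van that])
    have "h q1 \<in> closed_forms (perp U) q1"
    proof (rule closed_forms_strengthen[OF h_closed[OF order_refl] van1])
      \<comment> \<open>Closedness carries the vanishing over from the form arguments to the letters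
        of the word.\<close>
      fix x y v w assume v: "v \<in> perp U"
      have "h q1 (y, v, x # w) = 0"
        using closed_formsD(3)[OF h_closed[OF order_refl], of y v "x # w"] van1[OF v] by simp
      thus "h q1 (x, y, v # w) = 0"
        using closed_formsD(5)[OF h_closed[OF order_refl], of x y v w] van1[OF v] by simp
    qed
    moreover have "(\<Sum>U'\<in>\<U>. if U' = U then h q1 else 0) = h q1" using U(1) finite_family by simp
    moreover have "(\<Sum>U'\<in>\<U>. if U' = U then h q1 else 0) \<in> sum_forms \<U> q1"
      using calculation(1) functionals.subspace_0[OF subspace_closed_forms] by (intro sum_formsI) auto
    ultimately show False using h_not[OF order_refl] by simp
  qed
qed

theorem eventually_koszul_dual_eq_sum_forms: "\<exists>q0. \<forall>q\<ge>q0. koszul_dual K q = sum_forms \<U> q"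
proof -
  have "\<forall>q. \<exists>p. Vector_Spaces.linear dual_scale dual_scale p \<and> (\<forall>f\<in>sum_forms \<U> q. p f = 0) \<and>
      (\<forall>f. f - p f \<in> sum_forms \<U> q)"
    by (intro allI functionals.projection_along_subspace subspace_sum_forms)
  then obtain p where p: "\<And>q. Vector_Spaces.linear dual_scale dual_scale (p q)"
      "\<And>q f. f \<in> sum_forms \<U> q \<Longrightarrow> p q f = 0" "\<And>q f. f - p q f \<in> sum_forms \<U> q" by metis
  have p_add: "p q (f + g) = p q f + p q g" and p_scale: "p q (dual_scale c f) = dual_scale c (p q f)"
    and p_diff: "p q (f - g) = p q f - p q g" for q f g c
  proof -
    interpret Vector_Spaces.linear dual_scale dual_scale "p q" by (rule p(1))
    show "p q (f + g) = p q f + p q g" "p q (dual_scale c f) = dual_scale c (p q f)"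
      "p q (f - g) = p q f - p q g" by (rule add scale diff)+
  qed
  have p_idem: "p q (p q f) = p q f" for q f using p(2)[OF p(3)[of f q]] by (simp add: p_diff)
  have p_eq_0: "f \<in> sum_forms \<U> q" if "p q f = 0" for f q using p(3)[of f q] that by simp
  \<comment> \<open>The image of the projection, a model of \<open>D\<^sub>q / C\<^sub>q\<close> on
    which contraction followed by projection acts.\<close>
  define E where "E q = {f \<in> koszul_dual K q. p q f = f}" for q
  have pE: "p q f \<in> E q" if "f \<in> koszul_dual K q" for f q
  proof -
    have "f - (f - p q f) \<in> koszul_dual K q"
      using that p(3) sum_forms_subset by (meson functionals.subspace_diff subspace_koszul_dual subsetD)
    thus ?thesis by (simp add: E_def p_idem)
  qed
  have E_closed: "f \<in> closed_forms {0} q" if "f \<in> E q" for f q using that by (simp add: E_def koszul_dual_def)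
  have contract_dual: "contract v f \<in> koszul_dual K q" if "f \<in> koszul_dual K (Suc q)" for v f q
    using that contract_closed_forms by (auto simp: koszul_dual_def)
  have no_inf: "\<not> (\<exists>\<^sub>\<infinity>q. E q \<noteq> {0})"
  proof
    assume inf: "\<exists>\<^sub>\<infinity>q. E q \<noteq> {0}"
    have "\<exists>a q1 f. (\<exists>i\<in>Basis. a i \<noteq> 0) \<and>
      (\<forall>q\<ge>q1. f q \<in> E q \<and> f q \<noteq> 0 \<and> (\<forall>i\<in>Basis. p q (contract i (f (Suc q))) = dual_scale (a i) (f q)))"
    proof (rule graded_common_eigenvector[where Y = "\<lambda>i q f. p q (contract i f)" and ?q0.0 = "Suc (card \<U>)",
          OF functionals.vector_space_axioms finite_Basis])
      show "functionals.subspace (E q)" for q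
        using functionals.subspace_0[OF subspace_koszul_dual] functionals.subspace_add[OF subspace_koszul_dual]
          functionals.subspace_scale[OF subspace_koszul_dual] p(2)[OF functionals.subspace_0[OF subspace_sum_forms]]
        by (intro functionals.subspaceI) (auto simp: E_def p_add p_scale)
      show "fin_dim dual_scale (E q)" for q
        using functionals.fin_dim_subset[OF fin_dim_closed_forms] E_closed by blast
      show "p q (contract i f) \<in> E q" if "f \<in> E (Suc q)" for i q f
        using that contract_dual by (intro pE) (auto simp: E_def)
      show "Vector_Spaces.linear dual_scale dual_scale (\<lambda>f. p q (contract i f))" for i q
        by unfold_locales (simp_all only: contract_linear p_add p_scale functionals.scale_right_distrib
            functionals.scale_left_distrib functionals.scale_scale functionals.scale_one)
      show "p q (contract i (p (Suc q) (contract j f))) = p q (contract j (p (Suc q) (contract i f)))"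
        if f: "f \<in> E (Suc (Suc q))" for i j q f
      proof -
        \<comment> \<open>Contraction maps \<open>C\<^sub>q\<^sub>+\<^sub>1\<close> to
          \<open>C\<^sub>q\<close>, so the intermediate projection makes no difference.\<close>
        have "p q (contract i (p (Suc q) g)) = p q (contract i g)" for i g
        proof -
          have "p q (contract i (g - p (Suc q) g)) = 0" by (intro p(2) contract_sum_forms p(3))
          thus ?thesis by (simp add: contract_linear p_diff)
        qed
        thus ?thesis using contract_commute[OF E_closed[OF f], of i j] by simp
      qed
      show "f = 0" if q: "Suc (card \<U>) \<le> q" and f: "f \<in> E (Suc q)"
        and 0: "\<And>i. i \<in> Basis \<Longrightarrow> p q (contract i f) = 0" for q f
      proof -
        \<comment> \<open>Gluing takes place in degree \<open>q + 1 = q' + 2\<close>, which is why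
          the bound is \<open>Suc (card \<U>)\<close>.\<close>
        obtain q' where q': "q = Suc q'" "card \<U> \<le> q'" using q by (cases q) auto
        have "contract v f \<in> sum_forms \<U> q" for v
        proof -
          have "v \<in> span Basis" by (simp add: span_Basis)
          thus ?thesis
          proof (induction rule: span_induct_alt)
            case base
            show ?case unfolding contract_zero_vector[OF E_closed[OF f]]
              by (rule functionals.subspace_0[OF subspace_sum_forms])
          next
            case (step c x y)
            have "contract x f \<in> sum_forms \<U> q" using p_eq_0 0[OF step(1)] by blast
            thus ?case
              unfolding contract_add_vector[OF E_closed[OF f]] contract_scale_vector[OF E_closed[OF f]]
              using step(2)
              by (intro functionals.subspace_add[OF subspace_sum_forms] functionals.subspace_scale[OF subspace_sum_forms])
          qed
        qed
        hence "f \<in> sum_forms \<U> (Suc q)" using sum_forms_glue[OF q'(2)] E_closed[OF f] q'(1) by simp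
        thus "f = 0" using f p(2) by (auto simp: E_def)
      qed
      show "\<exists>\<^sub>\<infinity>q. E q \<noteq> {0}" by (rule inf)
    qed
    then obtain a0 q1 f i0 where a0: "i0 \<in> Basis" "a0 i0 \<noteq> 0" and f: "\<And>q. q \<ge> q1 \<Longrightarrow> f q \<in> E q"
      "\<And>q. q \<ge> q1 \<Longrightarrow> f q \<noteq> 0"
      "\<And>q i. q \<ge> q1 \<Longrightarrow> i \<in> Basis \<Longrightarrow> p q (contract i (f (Suc q))) = dual_scale (a0 i) (f q)" by blast
    define a where "a v = (\<Sum>i\<in>Basis. representation Basis v i * a0 i)" for v
    have a: "lin a"
      using representation_add[OF independent_Basis] representation_scale[OF independent_Basis]
      by (intro linI) (simp_all add: a_def span_Basis algebra_simps sum.distrib sum_distrib_left)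
    have a_Basis: "a i = a0 i" if "i \<in> Basis" for i
    proof -
      have "a i = (\<Sum>j\<in>Basis. if j = i then a0 i else 0)"
        unfolding a_def using that representation_basis[OF independent_Basis that] by (intro sum.cong) auto
      thus ?thesis using that finite_Basis by simp
    qed
    show False
    proof (rule no_eigenfamily_modulo_sum_forms[OF a, of i0 "max q1 (card \<U>)" f])
      show "a i0 \<noteq> 0" using a0 a_Basis by simp
      show "card \<U> \<le> max q1 (card \<U>)" by simp
      show "f q \<in> koszul_dual K q" if "max q1 (card \<U>) \<le> q" for q using f(1)[of q] that by (simp add: E_def)
      show "f q \<notin> sum_forms \<U> q" if "max q1 (card \<U>) \<le> q" for q
        using f(1,2)[of q] p(2)[of "f q" q] that by (auto simp: E_def)
      show "contract v (f (Suc q)) - dual_scale (a v) (f q) \<in> sum_forms \<U> q" if q: "max q1 (card \<U>) \<le> q" for q v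
      proof -
        have fE: "f q \<in> E q" "f (Suc q) \<in> E (Suc q)" using f(1) q by auto
        have "v \<in> span Basis" by (simp add: span_Basis)
        thus ?thesis
        proof (induction rule: span_induct_alt)
          case base
          show ?case unfolding contract_zero_vector[OF E_closed[OF fE(2)]] lin_zero[OF a]
              functionals.scale_zero_left diff_0_right
            by (rule functionals.subspace_0[OF subspace_sum_forms])
        next
          case (step c x y)
          have "p q (contract x (f (Suc q)) - dual_scale (a x) (f q)) = 0"
            using f(3)[of q x] q step(1) fE(1) by (simp add: p_diff p_scale a_Basis E_def)
          hence "contract x (f (Suc q)) - dual_scale (a x) (f q) \<in> sum_forms \<U> q" by (rule p_eq_0)
          hence "dual_scale c (contract x (f (Suc q)) - dual_scale (a x) (f q)) +
              (contract y (f (Suc q)) - dual_scale (a y) (f q)) \<in> sum_forms \<U> q"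
            using step(2) by (intro functionals.subspace_add[OF subspace_sum_forms] functionals.subspace_scale[OF subspace_sum_forms])
          also have "dual_scale c (contract x (f (Suc q)) - dual_scale (a x) (f q)) +
              (contract y (f (Suc q)) - dual_scale (a y) (f q)) =
              contract (c *s x + y) (f (Suc q)) - dual_scale (a (c *s x + y)) (f q)"
            by (simp only: contract_add_vector[OF E_closed[OF fE(2)]] contract_scale_vector[OF E_closed[OF fE(2)]]
                lin_add[OF a] lin_scale[OF a] functionals.scale_right_diff_distrib functionals.scale_left_distrib
                functionals.scale_scale add_diff_add)
          finally show ?case .
        qed
      qed
    qed
  qed
  then obtain q0 where q0: "\<And>q. q > q0 \<Longrightarrow> E q = {0}" unfolding not_INFM MOST_nat by blast
  have "koszul_dual K q = sum_forms \<U> q" if "q \<ge> Suc q0" for q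
  proof (rule equalityI[OF subsetI sum_forms_subset])
    fix f assume "f \<in> koszul_dual K q"
    hence "p q f = 0" using pE[of f q] q0[of q] that by auto
    thus "f \<in> sum_forms \<U> q" by (rule p_eq_0)
  qed
  thus ?thesis by blast
qed

text \<open>When components are added one at a time, the sum stays direct by
  \<open>form_eq_0_if_in_other_components\<close>.\<close>

lemma dim_sum_forms:
  assumes q: "card \<U> \<le> q" and "S \<subseteq> \<U>"
  shows "functionals.dim (sum_forms S q) = (\<Sum>U\<in>S. functionals.dim (closed_forms (perp U) q)) \<and>
    fin_dim dual_scale (sum_forms S q)"
proof -
  have "finite S" using assms(2) finite_family finite_subset by blast
  thus ?thesis using assms(2)
  proof (induction S rule: finite_induct)
    case empty
    have "sum_forms {} q = {0}" by (auto simp: sum_forms_def)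
    moreover have "functionals.dim {0 :: 'b \<times> 'b \<times> 'b list \<Rightarrow> 'a} = 0"
      using functionals.dim_le_card[of "{0}" "{}"] by simp
    moreover have "fin_dim dual_scale {0 :: 'b \<times> 'b \<times> 'b list \<Rightarrow> 'a}"
      unfolding fin_dim_def by (intro exI[of _ "{}"]) simp
    ultimately show ?case by (simp only: sum.empty simp_thms)
  next
    case (insert U S)
    have U: "U \<in> \<U>" using insert.prems by blast
    let ?C = "closed_forms (perp U) q"
    have eq: "sum_forms (insert U S) q = {x + y | x y. x \<in> ?C \<and> y \<in> sum_forms S q}"
    proof (intro equalityI subsetI)
      fix f assume "f \<in> sum_forms (insert U S) q"
      then obtain g where g: "f = (\<Sum>U\<in>insert U S. g U)" "\<forall>U'\<in>insert U S. g U' \<in> closed_forms (perp U') q"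
        unfolding sum_forms_def by auto
      have "f = g U + (\<Sum>U\<in>S. g U)" unfolding g(1) using insert.hyps by (rule sum.insert)
      moreover have "(\<Sum>U\<in>S. g U) \<in> sum_forms S q" using g(2) by (intro sum_formsI) auto
      ultimately show "f \<in> {x + y | x y. x \<in> ?C \<and> y \<in> sum_forms S q}" using g(2) by blast
    next
      fix f assume "f \<in> {x + y | x y. x \<in> ?C \<and> y \<in> sum_forms S q}"
      then obtain x g where f: "f = x + (\<Sum>U\<in>S. g U)" "x \<in> ?C" "\<forall>U'\<in>S. g U' \<in> closed_forms (perp U') q"
        unfolding sum_forms_def by auto
      have "(\<Sum>U'\<in>insert U S. (g(U := x)) U') \<in> sum_forms (insert U S) q"
        using f(2,3) by (intro sum_formsI) auto
      moreover have "(\<Sum>U'\<in>insert U S. (g(U := x)) U') = x + (\<Sum>U'\<in>S. g U')"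
      proof -
        have "(\<Sum>U'\<in>S. (g(U := x)) U') = (\<Sum>U'\<in>S. g U')" using insert.hyps by (intro sum.cong) auto
        thus ?thesis using sum.insert[OF insert.hyps, of "g(U := x)"] by simp
      qed
      ultimately show "f \<in> sum_forms (insert U S) q" using f(1) by simp
    qed
    have "?C \<inter> sum_forms S q = {0}"
    proof -
      have "f = 0" if f: "f \<in> ?C" "f \<in> sum_forms S q" for f
      proof -
        obtain g where g: "f = (\<Sum>U\<in>S. g U)" "\<forall>U\<in>S. g U \<in> closed_forms (perp U) q"
          using f(2) unfolding sum_forms_def by auto
        have "card S \<le> q"
          using card_mono[OF finite_family, of S] insert.prems q by simp
        thus ?thesis using form_eq_0_if_in_other_components[OF insert.hyps(1) U _ _ f(1) g(1)] g(2) insert by auto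
      qed
      thus ?thesis using functionals.subspace_0[OF subspace_closed_forms] functionals.subspace_0[OF subspace_sum_forms] by blast
    qed
    note direct = functionals.dim_sum_direct[OF subspace_closed_forms subspace_sum_forms this
        fin_dim_closed_forms_perp[OF subspace_family[OF U]]]
    have IH: "functionals.dim (sum_forms S q) = (\<Sum>U\<in>S. functionals.dim (closed_forms (perp U) q))"
      "fin_dim dual_scale (sum_forms S q)"
      using insert.IH insert.prems by blast+
    show ?case unfolding eq sum.insert[OF insert.hyps]
      using direct(1)[OF IH(2)] direct(2)[OF IH(2)] IH(1) by (simp only: simp_thms)
  qed
qed

theorem eventually_koszul_module_dim:
  "\<exists>q0. \<forall>q\<ge>q0. koszul_module_dim scale K q = (\<Sum>U\<in>\<U>. (q + 1) * ((q + functionals.dim U) choose (q + 2)))"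
proof -
  obtain q0 where q0: "\<And>q. q \<ge> q0 \<Longrightarrow> koszul_dual K q = sum_forms \<U> q"
    using eventually_koszul_dual_eq_sum_forms by blast
  have "koszul_module_dim scale K q = (\<Sum>U\<in>\<U>. (q + 1) * ((q + functionals.dim U) choose (q + 2)))"
    if q: "q \<ge> max q0 (card \<U>)" for q
  proof -
    have dim: "functionals.dim (sum_forms \<U> q) = (\<Sum>U\<in>\<U>. functionals.dim (closed_forms (perp U) q))"
      "fin_dim dual_scale (sum_forms \<U> q)"
      using dim_sum_forms[of q \<U>] q by auto
    have "koszul_module_dim scale K q = functionals.dim (koszul_dual K q)"
      using dim(2) q0[of q] q by (intro koszul_module_dim_eq_dim_koszul_dual) simp
    also have "\<dots> = (\<Sum>U\<in>\<U>. functionals.dim (closed_forms (perp U) q))" using q0[of q] q dim(1) by simp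
    also have "\<dots> = (\<Sum>U\<in>\<U>. (q + 1) * ((q + functionals.dim U) choose (q + 2)))"
      using dim_closed_forms_perp[OF subspace_family] by (intro sum.cong) auto
    finally show ?thesis .
  qed
  thus ?thesis by blast
qed

end

section \<open>Strong isotropy and resonance\<close>

text \<open>The value at \<open>x\<close>, \<open>y\<close> of the 2-form represented by a word.
  Extended by 0 to other lengths it vanishes on the whole exterior ideal, so a nonzero value
  certifies that an element is outside the ideal.\<close>

definition wedge_value :: "'v \<Rightarrow> 'v \<Rightarrow> ('v \<Rightarrow> 'k::field) list \<Rightarrow> 'k"
  where "wedge_value x y l = (if length l = 2 then (l ! 0) x * (l ! 1) y - (l ! 0) y * (l ! 1) x else 0)"

lemma wedge_value_pair [simp]: "wedge_value x y [a, b] = a x * b y - a y * b x"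
  by (simp add: wedge_value_def)

lemma wedge_value_exterior_ideal:
  assumes "r \<in> exterior_ideal dual_scale D"
  shows "ev (wedge_value x y) r = 0"
  using assms unfolding exterior_ideal_def free_ideal_def
proof (rule ev_span)
  fix s :: "('a \<Rightarrow> 'b) list \<Rightarrow>\<^sub>0 'b"
  assume "s \<in> {free_mult (free_mult (gen xs) r) (gen ys) |xs r ys.
    set xs \<subseteq> D \<and> r \<in> exterior_rels dual_scale D \<and> set ys \<subseteq> D}"
  then obtain xs r ys where s: "s = free_mult (free_mult (gen xs) r) (gen ys)"
    and r: "r \<in> exterior_rels dual_scale D" by blast
  have "ev (wedge_value x y) s = ev (\<lambda>m. wedge_value x y (xs @ m @ ys)) r"
    by (simp add: s ev_free_mult)
  moreover consider u v where "r = gen [u + v] - gen [u] - gen [v]"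
    | c u where "r = gen [dual_scale c u] - fscale c (gen [u])" | u where "r = gen [u, u]"
    using r unfolding exterior_rels_def linear_rels_def by blast
  hence "ev (\<lambda>m. wedge_value x y (xs @ m @ ys)) r = 0"
  proof cases
    case 1
    \<comment> \<open>A linear relation reaches length 2 only with one further letter on one of its
      sides.\<close>
    consider "length xs + length ys \<noteq> 1" | z where "xs = []" "ys = [z]" | z where "xs = [z]" "ys = []"
      by (cases xs; cases ys) auto
    thus ?thesis by cases (auto simp: 1 ev_diff ev_add wedge_value_def algebra_simps)
  next
    case 2
    consider "length xs + length ys \<noteq> 1" | z where "xs = []" "ys = [z]" | z where "xs = [z]" "ys = []"
      by (cases xs; cases ys) auto
    thus ?thesis by cases (auto simp: 2 ev_diff ev_fscale wedge_value_def algebra_simps)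
  next
    case 3
    thus ?thesis by (cases xs; cases ys) (auto simp: wedge_value_def)
  qed
  ultimately show "ev (wedge_value x y) s = 0" by simp
qed

lemma exterior_pairing_eq_ev:
  "exterior_pairing \<phi> \<kappa> =
    ev (\<lambda>l. ev (\<lambda>z. (l ! 0) (z ! 0) * (l ! 1) (z ! 1) - (l ! 0) (z ! 1) * (l ! 1) (z ! 0)) \<kappa>) \<phi>"
  by (simp add: exterior_pairing_def ev_def sum_distrib_left mult.assoc)

context koszul_space
begin

lemma gen_in_annihilator_iff:
  "gen [a, b] \<in> annihilator scale K \<longleftrightarrow> lin a \<and> lin b \<and> kills K (\<lambda>x y. a x * b y - a y * b x)"
  by (auto simp: annihilator_def words_def mem_dual_space_iff exterior_pairing_eq_ev kills_def)

lemma subspace_exterior_ideal_generated: "fvs.subspace (exterior_ideal_generated scale U)"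
  unfolding exterior_ideal_generated_def free_ideal_def by (rule fvs.subspace_span)

lemma gen_in_exterior_ideal_generated:
  assumes "a \<in> U" "lin b"
  shows "gen [a, b] \<in> exterior_ideal_generated scale U"
proof -
  have "gen [a] \<in> exterior_rels dual_scale (dual_space scale) \<union> {gen [u] |u. u \<in> U}"
    using assms(1) by blast
  from free_ideal_memI[OF _ this, of "[]" "dual_space scale" "[b]"] assms(2)
  show ?thesis by (simp add: exterior_ideal_generated_def mem_dual_space_iff)
qed

lemma wedge_value_exterior_square_of:
  assumes "\<phi> \<in> exterior_square_of scale U" "x \<in> perp U"
  shows "ev (wedge_value x y) \<phi> = 0"
  using assms(1) unfolding exterior_square_of_def
proof (rule ev_span)
  fix s assume "s \<in> {gen [u, w] |u w. u \<in> U \<and> w \<in> U} \<union>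
    exterior_ideal dual_scale (dual_space scale) \<inter> free_on (words (dual_space scale) 2)"
  then consider u w where "s = gen [u, w]" "u \<in> U" "w \<in> U" | "s \<in> exterior_ideal dual_scale (dual_space scale)"
    by blast
  thus "ev (wedge_value x y) s = 0"
  proof cases
    case 1
    hence "u x = 0" "w x = 0" using assms(2) by (auto simp: perp_def)
    thus ?thesis by (simp add: 1(1))
  qed (rule wedge_value_exterior_ideal)
qed

section \<open>Consequences of strong isotropy for a single subspace\<close>

context
  fixes K :: "('v list \<Rightarrow>\<^sub>0 'k) set" and U
  assumes U: "strongly_isotropic_subspace scale K U"
begin

lemma strongly_isotropic_subspaceD:
  "functionals.subspace U" "U \<subseteq> dual_space scale"
  "annihilator scale K \<inter> exterior_ideal_generated scale U = exterior_square_of scale U"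
  using U by (auto simp: strongly_isotropic_subspace_def)

lemma lin_if_in_strongly_isotropic: "u \<in> U \<Longrightarrow> lin u"
  using strongly_isotropic_subspaceD(2) mem_dual_space_iff by blast

lemma kills_wedge_of_strongly_isotropic:
  assumes "u \<in> U" "v \<in> U"
  shows "kills K (\<lambda>x y. u x * v y - u y * v x)"
proof -
  have "gen [u, v] \<in> exterior_square_of scale U"
    unfolding exterior_square_of_def using assms by (intro fvs.span_base) blast
  hence "gen [u, v] \<in> annihilator scale K" using strongly_isotropic_subspaceD(3) by blast
  thus ?thesis by (simp add: gen_in_annihilator_iff)
qed

text \<open>By strong isotropy the wedge product of \<open>a\<close> and \<open>b\<close> lies in
  the exterior square of \<open>U\<close>, hence vanishes on all pairs \<open>v\<close>,
  \<open>z\<close> with \<open>v\<close> in \<open>perp U\<close>; its value there is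
  \<open>- a z * b v\<close>.\<close>

lemma mem_strongly_isotropic:
  assumes "lin a" "lin b" "kills K (\<lambda>x y. a x * b y - a y * b x)" "a \<in> U" "a z \<noteq> 0"
  shows "b \<in> U"
proof -
  have "gen [a, b] \<in> annihilator scale K" using assms(1-3) by (simp add: gen_in_annihilator_iff)
  hence sq: "gen [a, b] \<in> exterior_square_of scale U"
    using gen_in_exterior_ideal_generated[OF assms(4,2)] strongly_isotropic_subspaceD(3) by blast
  have "b v = 0" if v: "v \<in> perp U" for v
  proof -
    have "a v * b z - a z * b v = 0" using wedge_value_exterior_square_of[OF sq v, of z] by simp
    moreover have "a v = 0" using v assms(4) by (simp add: perp_def)
    ultimately show ?thesis using assms(5) by simp
  qed
  thus ?thesis using mem_iff_kills_perp[OF strongly_isotropic_subspaceD(1,2) assms(2)] by blast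
qed

text \<open>The values of a pulled back form are combinations of wedge products of members of
  \<open>U\<close>, all of which lie in the annihilator.\<close>

lemma kills_pullback:
  assumes f: "f \<in> closed_forms (perp U) q"
  shows "kills K (\<lambda>x y. f (x, y, w))"
proof -
  obtain B e where "dual_basis scale Basis U B e"
    by (rule dual_basis_exists[OF strongly_isotropic_subspaceD(1,2)])
  then interpret dual_basis scale Basis U B e .
  define F where "F b c = f (e b, e c, w)" for b c
  have ex: "f (x, y, w) = (\<Sum>b\<in>B. \<Sum>c\<in>B. F b c * (b x * c y))" for x y
  proof -
    have "f (x, y, w) = (\<Sum>b\<in>B. b x * f (e b, y, w))"
      using lin_expand[OF closed_formsD(2)[OF f, of y w] closed_formsD(4)[OF f, of _ y w], of x] .
    also have "\<dots> = (\<Sum>b\<in>B. b x * (\<Sum>c\<in>B. c y * f (e b, e c, w)))"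
    proof (intro sum.cong refl)
      fix b
      show "b x * f (e b, y, w) = b x * (\<Sum>c\<in>B. c y * f (e b, e c, w))"
        using lin_expand[OF closed_forms_lin2[OF f, of "e b" w] closed_forms_kills2[OF f, of _ "e b" w], of y]
        by (rule arg_cong)
    qed
    finally show ?thesis by (simp add: sum_distrib_left F_def mult_ac)
  qed
  \<comment> \<open>Antisymmetrizing the expansion turns the products into wedge products, at the
    cost of a factor 2.\<close>
  have two: "2 * f (x, y, w) = (\<Sum>b\<in>B. \<Sum>c\<in>B. F b c * (b x * c y - b y * c x))" for x y
  proof -
    have "2 * f (x, y, w) = f (x, y, w) - f (y, x, w)" using closed_formsD(3)[OF f, of y x w] by simp
    thus ?thesis unfolding ex by (simp add: sum_subtractf right_diff_distrib)
  qed
  show ?thesis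
    unfolding kills_def
  proof
    fix \<kappa> assume \<kappa>: "\<kappa> \<in> K"
    have "2 * ev (\<lambda>z. f (z ! 0, z ! 1, w)) \<kappa> =
        (\<Sum>b\<in>B. \<Sum>c\<in>B. F b c * ev (\<lambda>z. b (z ! 0) * c (z ! 1) - b (z ! 1) * c (z ! 0)) \<kappa>)"
      unfolding ev_fun_mult[symmetric] ev_fun_sum[symmetric] two ..
    also have "\<dots> = 0"
      using kills_wedge_of_strongly_isotropic B(2) \<kappa> by (intro sum.neutral ballI) (auto simp: kills_def)
    finally show "ev (\<lambda>z. f (z ! 0, z ! 1, w)) \<kappa> = 0" by simp
  qed
qed

text \<open>For fixed \<open>w\<close> the form is a sum of wedge products
  \<open>b \<and> \<beta> b\<close> with \<open>b\<close> in \<open>U\<close>, since it vanishes on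
  pairs from \<open>perp U\<close>. So it lies in the annihilator and in the ideal of
  \<open>U\<close>, hence in the exterior square of \<open>U\<close>, whose elements vanish as soon
  as one argument is in \<open>perp U\<close>.\<close>

lemma form_eq_0_if_strongly_isotropic:
  assumes f: "f \<in> koszul_dual K q"
    and van: "\<And>x y. x \<in> perp U \<Longrightarrow> y \<in> perp U \<Longrightarrow> f (x, y, w) = 0" and x: "x \<in> perp U"
  shows "f (x, y, w) = 0"
proof -
  obtain B e where "dual_basis scale Basis U B e"
    by (rule dual_basis_exists[OF strongly_isotropic_subspaceD(1,2)])
  then interpret dual_basis scale Basis U B e .
  define g where "g = (\<lambda>x y. f (x, y, w))"
  have fc: "f \<in> closed_forms {0} q" using f by (simp add: koszul_dual_def)
  have lin1: "lin (\<lambda>x. g x y)" for y unfolding g_def by (rule closed_formsD(2)[OF fc])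
  have lin2: "lin (\<lambda>y. g x y)" for x unfolding g_def by (rule closed_forms_lin2[OF fc])
  have anti: "g y x = - g x y" for x y unfolding g_def by (rule closed_formsD(3)[OF fc])
  \<comment> \<open>The projection to the span of the \<open>e b\<close> along
    \<open>perp U\<close>.\<close>
  define P where "P x = (\<Sum>b\<in>B. b x *s e b)" for x
  have P_lin: "lin (\<lambda>x. h (P x))" if "lin h" for h
    using that lin_B unfolding P_def
    by (intro linI) (simp_all add: lin_sum lin_scale lin_add sum_distrib_left sum.distrib distrib_right mult.assoc)
  have g_P: "g (P x) y = (\<Sum>b\<in>B. b x * g (e b) y)" for x y
    using lin1 by (simp add: P_def lin_sum[OF lin1] lin_scale[OF lin1])
  \<comment> \<open>The part of the form with both arguments in that span arises from the sum over
    \<open>b\<close> and again after exchanging the arguments; halving it avoids counting it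
    twice.\<close>
  define \<beta> where "\<beta> b = (\<lambda>y. g (e b) y - g (e b) (P y) / 2)" for b
  have \<beta>_lin: "lin (\<beta> b)" for b
    using lin2[of "e b"] P_lin[OF lin2, of "e b"] unfolding \<beta>_def
    by (intro linI) (simp_all add: lin_add lin_scale lin_add[OF P_lin[OF lin2]] lin_scale[OF P_lin[OF lin2]] algebra_simps add_divide_distrib)
  have sum_\<beta>: "(\<Sum>b\<in>B. b x * \<beta> b y) = g (P x) y - g (P x) (P y) / 2" for x y
    by (simp add: \<beta>_def g_P right_diff_distrib sum_subtractf sum_divide_distrib)
  have g_eq: "(\<Sum>b\<in>B. b x * \<beta> b y - b y * \<beta> b x) = g x y" for x y
  proof -
    have "x - P x \<in> perp U" "y - P y \<in> perp U" unfolding P_def by (rule remainder_in_perp)+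
    hence "g (x - P x) (y - P y) = 0" unfolding g_def by (rule van)
    hence "g x y - g (P x) y - (g x (P y) - g (P x) (P y)) = 0"
      by (simp add: lin_diff[OF lin2] lin_diff[OF lin1])
    moreover have "g (P y) x = - g x (P y)" "g (P y) (P x) = - g (P x) (P y)" by (rule anti)+
    moreover have "(\<Sum>b\<in>B. b x * \<beta> b y - b y * \<beta> b x) =
        (g (P x) y - g (P x) (P y) / 2) - (g (P y) x - g (P y) (P x) / 2)"
      by (simp only: sum_subtractf sum_\<beta>)
    moreover have "g (P x) (P y) / 2 + g (P x) (P y) / 2 = g (P x) (P y)" by simp
    ultimately have "g (P x) (P y) + (\<Sum>b\<in>B. b x * \<beta> b y - b y * \<beta> b x) = g (P x) (P y) + g x y"
      by (simp add: algebra_simps)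
    thus ?thesis by (rule add_left_imp_eq)
  qed
  define \<Phi> where "\<Phi> = (\<Sum>b\<in>B. gen [b, \<beta> b] :: ('v \<Rightarrow> 'k) list \<Rightarrow>\<^sub>0 'k)"
  have ev_\<Phi>: "ev h \<Phi> = (\<Sum>b\<in>B. h [b, \<beta> b])" for h by (simp add: \<Phi>_def ev_sum)
  have "\<Phi> \<in> annihilator scale K"
    unfolding annihilator_def
  proof (intro CollectI conjI ballI)
    show "\<Phi> \<in> free_on (words (dual_space scale) 2)"
      unfolding \<Phi>_def using \<beta>_lin lin_B
      by (intro fvs.subspace_sum[OF subspace_free_on]) (auto simp: words_def mem_dual_space_iff)
    fix \<kappa> assume \<kappa>: "\<kappa> \<in> K"
    have "exterior_pairing \<Phi> \<kappa> = ev (\<lambda>z. \<Sum>b\<in>B. b (z ! 0) * \<beta> b (z ! 1) - b (z ! 1) * \<beta> b (z ! 0)) \<kappa>"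
      unfolding exterior_pairing_eq_ev ev_\<Phi> ev_fun_sum by simp
    also have "\<dots> = ev (\<lambda>z. g (z ! 0) (z ! 1)) \<kappa>" unfolding g_eq ..
    also have "\<dots> = 0" using f \<kappa> by (auto simp: koszul_dual_def kills_def g_def)
    finally show "exterior_pairing \<Phi> \<kappa> = 0" .
  qed
  moreover have "\<Phi> \<in> exterior_ideal_generated scale U"
    unfolding \<Phi>_def using B(2) \<beta>_lin
    by (intro fvs.subspace_sum[OF subspace_exterior_ideal_generated] gen_in_exterior_ideal_generated) auto
  ultimately have "\<Phi> \<in> exterior_square_of scale U" using strongly_isotropic_subspaceD(3) by blast
  hence "ev (wedge_value x y) \<Phi> = 0" using x by (rule wedge_value_exterior_square_of)
  thus ?thesis using g_eq[of x y] by (simp add: ev_\<Phi> g_def)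
qed

end

section \<open>Irreducible components of the resonance variety\<close>

lemma resonance_variety_subset: "resonance_variety scale K \<subseteq> dual_space scale"
  using functionals.subspace_0[OF subspace_dual_space] by (auto simp: resonance_variety_def)

lemma mem_resonance_variety:
  assumes "lin a" "lin b" "kills K (\<lambda>x y. a x * b y - a y * b x)" "a x * b y - a y * b x \<noteq> 0"
  shows "a \<in> resonance_variety scale K"
proof -
  have "gen [a, b] \<notin> exterior_ideal dual_scale (dual_space scale)"
    using wedge_value_exterior_ideal[of "gen [a, b]" _ x y] assms(4) by auto
  moreover have "gen [a, b] \<in> annihilator scale K" using assms(1-3) by (simp add: gen_in_annihilator_iff)
  ultimately show ?thesis using assms(1,2) by (auto simp: resonance_variety_def mem_dual_space_iff)
qed

text \<open>If neither closed set contained the union, two members of the chain would show it, and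
  so would the larger of them alone.\<close>

lemma zariski_irreducible_Union_chain:
  assumes "\<C> \<noteq> {}" "\<And>Y Y'. Y \<in> \<C> \<Longrightarrow> Y' \<in> \<C> \<Longrightarrow> Y \<subseteq> Y' \<or> Y' \<subseteq> Y"
    and irr: "\<And>Y. Y \<in> \<C> \<Longrightarrow> zariski_irreducible scale Y"
  shows "zariski_irreducible scale (\<Union>\<C>)"
  unfolding zariski_irreducible_def
proof (intro conjI allI impI)
  show "\<Union>\<C> \<noteq> {}" "\<Union>\<C> \<subseteq> dual_space scale"
    using assms(1) irr by (auto simp: zariski_irreducible_def)
  fix Z1 Z2 assume Z: "zariski_closed scale Z1 \<and> zariski_closed scale Z2 \<and> \<Union>\<C> \<subseteq> Z1 \<union> Z2"
  show "\<Union>\<C> \<subseteq> Z1 \<or> \<Union>\<C> \<subseteq> Z2"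
  proof (rule ccontr)
    assume "\<not> ?thesis"
    then obtain Y1 Y2 where Y: "Y1 \<in> \<C>" "\<not> Y1 \<subseteq> Z1" "Y2 \<in> \<C>" "\<not> Y2 \<subseteq> Z2" by blast
    then obtain Y where "Y \<in> \<C>" "Y1 \<subseteq> Y" "Y2 \<subseteq> Y" using assms(2) by (metis order_refl)
    moreover from this have "Y \<subseteq> Z1 \<or> Y \<subseteq> Z2"
      using irr[of Y] Z unfolding zariski_irreducible_def by blast
    ultimately show False using Y by blast
  qed
qed

text \<open>Zorn's lemma for the irreducible subsets of \<open>X\<close> through \<open>a\<close>,
  starting from the singleton.\<close>

lemma mem_irreducible_component:
  assumes "X \<subseteq> dual_space scale" "a \<in> X"
  shows "\<exists>Y\<in>irreducible_components scale X. a \<in> Y"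
proof -
  let ?A = "{Y. Y \<subseteq> X \<and> zariski_irreducible scale Y \<and> a \<in> Y}"
  have "{a} \<in> ?A" using assms by (auto simp: zariski_irreducible_def)
  hence "?A \<noteq> {}" by blast
  hence "\<exists>M\<in>?A. \<forall>Y\<in>?A. M \<subseteq> Y \<longrightarrow> Y = M"
  proof (rule subset_Zorn_nonempty)
    show "\<Union>\<C> \<in> ?A" if "\<C> \<noteq> {}" "subset.chain ?A \<C>" for \<C>
    proof -
      have sub: "\<C> \<subseteq> ?A" and ch: "\<And>Y Y'. Y \<in> \<C> \<Longrightarrow> Y' \<in> \<C> \<Longrightarrow> Y \<subseteq> Y' \<or> Y' \<subseteq> Y"
        using that(2) by (auto simp: subset_chain_def)
      have "zariski_irreducible scale (\<Union>\<C>)"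
        using sub by (intro zariski_irreducible_Union_chain[OF that(1) ch]) auto
      thus ?thesis using sub that(1) by blast
    qed
  qed
  then obtain M where M: "M \<in> ?A" "\<forall>Y\<in>?A. M \<subseteq> Y \<longrightarrow> Y = M" by (elim bexE)
  have "M \<in> irreducible_components scale X"
    unfolding irreducible_components_def using M by blast
  thus ?thesis using M(1) by blast
qed

lemma isotropic_family_irreducible_components:
  assumes K: "strongly_isotropic_koszul scale K"
    and fin: "finite (irreducible_components scale (resonance_variety scale K))"
  shows "isotropic_family scale Basis K (irreducible_components scale (resonance_variety scale K))"
    (is "isotropic_family _ _ _ ?\<U>")
proof -
  have iso: "strongly_isotropic_subspace scale K U" if "U \<in> ?\<U>" for U
    using K that by (simp add: strongly_isotropic_koszul_def)
  \<comment> \<open>For \<open>b\<close> in \<open>U\<close>, the wedge product of \<open>a\<close>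
    and \<open>b\<close> lies in the annihilator of \<open>K\<close>, and \<open>a\<close> is in
    \<open>U'\<close>; strong isotropy of \<open>U'\<close> puts \<open>b\<close> there too. By
    symmetry a common nonzero element forces the components to be equal.\<close>
  have sub: "U \<subseteq> U'" if U: "U \<in> ?\<U>" and U': "U' \<in> ?\<U>" and a: "a \<in> U" "a \<in> U'" "a \<noteq> 0" for U U' a
  proof
    fix b assume b: "b \<in> U"
    obtain z where z: "a z \<noteq> 0" using a(3) by (auto simp: fun_eq_iff)
    show "b \<in> U'"
      using mem_strongly_isotropic[OF iso[OF U'] _ _ kills_wedge_of_strongly_isotropic[OF iso[OF U] a(1) b] a(2) z]
        lin_if_in_strongly_isotropic[OF iso[OF U]] a(1) b by blast
  qed
  show ?thesis
  proof unfold_locales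
    show "finite ?\<U>" by (rule fin)
    show "functionals.subspace U" "U \<subseteq> dual_space scale" if "U \<in> ?\<U>" for U
      by (rule strongly_isotropic_subspaceD[OF iso[OF that]])+
    show "kills K (\<lambda>x y. f (x, y, w))" if "U \<in> ?\<U>" "f \<in> closed_forms (perp U) q" for U f q w
      by (rule kills_pullback[OF iso[OF that(1)] that(2)])
    show "f (x, y, w) = 0" if "U \<in> ?\<U>" "f \<in> koszul_dual K q"
      "\<And>x y. x \<in> perp U \<Longrightarrow> y \<in> perp U \<Longrightarrow> f (x, y, w) = 0" "x \<in> perp U" for U f q w x y
      by (rule form_eq_0_if_strongly_isotropic[OF iso[OF that(1)] that(2-4)])
    show "U \<inter> U' = {0}" if "U \<in> ?\<U>" "U' \<in> ?\<U>" "U \<noteq> U'" for U U'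
    proof -
      have "0 \<in> U" "0 \<in> U'"
        using that functionals.subspace_0[OF strongly_isotropic_subspaceD(1)[OF iso]] by blast+
      moreover have "a = 0" if "a \<in> U" "a \<in> U'" for a
        using sub[of U U' a] sub[of U' U a] that \<open>U \<in> ?\<U>\<close> \<open>U' \<in> ?\<U>\<close> \<open>U \<noteq> U'\<close> by blast
      ultimately show ?thesis by blast
    qed
    show "\<exists>U\<in>?\<U>. a \<in> U" if "lin a" "lin b" "kills K (\<lambda>x y. a x * b y - a y * b x)"
      "a x * b y - a y * b x \<noteq> 0" for a b x y
      by (rule mem_irreducible_component[OF resonance_variety_subset mem_resonance_variety[OF that]])
  qed
qed

end

theorem corollary1p3:
  fixes scale :: "'k::{alg_closed_field, field_char_0} \<Rightarrow> 'v::ab_group_add \<Rightarrow> 'v"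
    and Basis :: "'v set"
    and K :: "('v list \<Rightarrow>\<^sub>0 'k) set"
    and U :: "nat \<Rightarrow> ('v \<Rightarrow> 'k) set"
    and k :: nat
  assumes "finite_dimensional_vector_space scale Basis"
    and "subspace_of_exterior_square scale K"
    and "strongly_isotropic_koszul scale K"
    and "bij_betw U {1..k} (irreducible_components scale (resonance_variety scale K))"
  shows "\<forall>\<^sub>F q in sequentially.
    koszul_module_dim scale K q =
      (\<Sum>t = 1..k. (q + 1) * ((q + functionals.dim (U t)) choose (q + 2)))"
proof -
  interpret finite_dimensional_vector_space scale Basis by fact
  interpret koszul_space scale Basis ..
  have "finite (irreducible_components scale (resonance_variety scale K))"
    using bij_betw_finite[OF assms(4)] by simp
  then interpret isotropic_family scale Basis K "irreducible_components scale (resonance_variety scale K)"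
    by (rule isotropic_family_irreducible_components[OF assms(3)])
  show ?thesis
    using eventually_koszul_module_dim
    unfolding eventually_sequentially sum.reindex_bij_betw[OF assms(4), symmetric] .
qed

end
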